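(* Let $p_1\equiv p_2\equiv1\pmod4$ be primes such that at least two of $\left(\frac{p_1}{p_2}\right),\left(\frac{2}{p_1}\right),\left(\frac{2}{p_2}\right)$ equal $-1$ (equivalently, $\mathbf{C}_{k,2}$ is of type $(2,2,2)$ for $k=\mathbb{Q}(\sqrt{2p_1p_2},i)$). Let $\mathbb{K}_3=k(\sqrt2)=\mathbb{Q}(\sqrt2,\sqrt{p_1p_2},i)$. (1) If $q(\mathbb{K}_3^+/\mathbb{Q})=1$, then exactly four classes capitulate in $\mathbb{K}_3$ and $\ker J_{\mathbb{K}_3}=\langle[\mathcal{H}_0],[\mathcal{H}_1\mathcal{H}_2]\rangle$. (2) If $q(\mathbb{K}_3^+/\mathbb{Q})=2$, then $\ker J_{\mathbb{K}_3}=\langle[\mathcal{H}_0]\rangle$.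
   Context: $i=\sqrt{-1}$; $\left(\frac{\cdot}{\cdot}\right)$ is the Legendre symbol. $\mathbb{K}_3^+=\mathbb{Q}(\sqrt2,\sqrt{p_1p_2})$ and $q(\mathbb{K}_3^+/\mathbb{Q})=[E_{\mathbb{K}_3^+}:E_{\mathbb{Q}(\sqrt2)}E_{\mathbb{Q}(\sqrt{p_1p_2})}E_{\mathbb{Q}(\sqrt{2p_1p_2})}]$, $E$ denoting unit groups. Write $p_1=e^2+4f^2$, $p_2=g^2+4h^2$ with integers $e,f,g,h$, and $\pi_1=e+2if$, $\pi_2=e-2if$. $\mathcal{H}_1,\mathcal{H}_2$ are the prime ideals of $k$ above $\pi_1,\pi_2$ ($\mathcal{H}_j^2=\pi_j\mathcal{O}_k$), and $\mathcal{H}_0$ the prime of $k$ above $1+i$ ($\mathcal{H}_0^2=(1+i)\mathcal{O}_k$). $J_L:\mathbf{C}_k\to\mathbf{C}_L$ is the map on class groups induced by extension of ideals. *)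

theory Defs
  imports Complex_Main "HOL-Computational_Algebra.Polynomial" "HOL-Number_Theory.Number_Theory"
begin

text \<open>Number fields are modelled as subfields of the complex numbers.\<close>

definition is_subfield :: "complex set \<Rightarrow> bool" where
  "is_subfield F \<longleftrightarrow> 0 \<in> F \<and> 1 \<in> F \<and>
     (\<forall>x\<in>F. \<forall>y\<in>F. x + y \<in> F \<and> x - y \<in> F \<and> x * y \<in> F) \<and>
     (\<forall>x\<in>F. x \<noteq> 0 \<longrightarrow> inverse x \<in> F)"

definition field_gen :: "complex set \<Rightarrow> complex set" where
  "field_gen S = \<Inter>{F. is_subfield F \<and> S \<subseteq> F}"

definition ring_of_integers :: "complex set \<Rightarrow> complex set" where
  "ring_of_integers F = {x \<in> F. algebraic_int x}"

definition units_of_ring :: "complex set \<Rightarrow> complex set" where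
  "units_of_ring R = {x \<in> R. \<exists>y\<in>R. x * y = 1}"

definition group_index :: "complex set \<Rightarrow> complex set \<Rightarrow> nat" where
  "group_index E U = card ((\<lambda>x. (\<lambda>u. x * u) ` U) ` E)"

definition set_prod :: "complex set \<Rightarrow> complex set \<Rightarrow> complex set" where
  "set_prod A B = {a * b | a b. a \<in> A \<and> b \<in> B}"

definition is_ideal :: "complex set \<Rightarrow> complex set \<Rightarrow> bool" where
  "is_ideal R I \<longleftrightarrow> I \<subseteq> R \<and> 0 \<in> I \<and> (\<forall>x\<in>I. \<forall>y\<in>I. x + y \<in> I) \<and>
     (\<forall>r\<in>R. \<forall>x\<in>I. r * x \<in> I)"

definition nonzero_ideal :: "complex set \<Rightarrow> complex set \<Rightarrow> bool" where
  "nonzero_ideal R I \<longleftrightarrow> is_ideal R I \<and> I \<noteq> {0}"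

definition prime_ideal :: "complex set \<Rightarrow> complex set \<Rightarrow> bool" where
  "prime_ideal R P \<longleftrightarrow> is_ideal R P \<and> P \<noteq> R \<and>
     (\<forall>x\<in>R. \<forall>y\<in>R. x * y \<in> P \<longrightarrow> x \<in> P \<or> y \<in> P)"

definition ideal_gen :: "complex set \<Rightarrow> complex set \<Rightarrow> complex set" where
  "ideal_gen R S = \<Inter>{I. is_ideal R I \<and> S \<subseteq> I}"

definition ideal_mult :: "complex set \<Rightarrow> complex set \<Rightarrow> complex set \<Rightarrow> complex set" where
  "ideal_mult R I J = ideal_gen R {x * y | x y. x \<in> I \<and> y \<in> J}"

primrec ideal_pow :: "complex set \<Rightarrow> complex set \<Rightarrow> nat \<Rightarrow> complex set" where
  "ideal_pow R I 0 = R"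
| "ideal_pow R I (Suc n) = ideal_mult R I (ideal_pow R I n)"

definition principal_ideal :: "complex set \<Rightarrow> complex \<Rightarrow> complex set" where
  "principal_ideal R a = (\<lambda>r. a * r) ` R"

definition is_principal :: "complex set \<Rightarrow> complex set \<Rightarrow> bool" where
  "is_principal R I \<longleftrightarrow> (\<exists>a\<in>R. I = principal_ideal R a)"

definition ideal_equiv :: "complex set \<Rightarrow> complex set \<Rightarrow> complex set \<Rightarrow> bool" where
  "ideal_equiv R I J \<longleftrightarrow> (\<exists>a\<in>R. \<exists>b\<in>R. a \<noteq> 0 \<and> b \<noteq> 0 \<and>
      (\<lambda>x. a * x) ` I = (\<lambda>x. b * x) ` J)"

definition ideal_class :: "complex set \<Rightarrow> complex set \<Rightarrow> complex set set" where
  "ideal_class R I = {J. nonzero_ideal R J \<and> ideal_equiv R I J}"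

text \<open>Kernel of the extension map J_L : C_k -> C_L (k \<subseteq> L fields):
  the classes of ideals I of O_k whose extension I O_L is principal.\<close>
definition capitulation_kernel :: "complex set \<Rightarrow> complex set \<Rightarrow> complex set set set" where
  "capitulation_kernel k L =
     {ideal_class (ring_of_integers k) I | I.
        nonzero_ideal (ring_of_integers k) I \<and>
        is_principal (ring_of_integers L) (ideal_gen (ring_of_integers L) I)}"

definition unit_index_q :: "int \<Rightarrow> int \<Rightarrow> nat" where
  "unit_index_q a b =
     (let s = (\<lambda>n::int. complex_of_real (sqrt (real_of_int n))) in
      group_index (units_of_ring (ring_of_integers (field_gen {s a, s b})))
        (set_prod (units_of_ring (ring_of_integers (field_gen {s a})))
          (set_prod (units_of_ring (ring_of_integers (field_gen {s b})))
                    (units_of_ring (ring_of_integers (field_gen {s (a * b)}))))))"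

end

theory Submission
  imports Defs "Jordan_Normal_Form.Char_Poly" "HOL-Analysis.Kronecker_Approximation_Theorem"
    "HOL-Computational_Algebra.Squarefree"
begin

text \<open>
  Let \<open>\<sigma>\<close> generate the Galois group of \<open>L = K3\<close> over \<open>k\<close>. If an ideal \<open>I\<close> of \<open>k\<close> becomes principal
  in \<open>L\<close>, generated by \<open>\<alpha>\<close>, then \<open>u = \<sigma>\<alpha>/\<alpha>\<close> is a unit of relative norm one, and the class of \<open>I\<close> depends
  only on \<open>u\<close> modulo the units \<open>\<sigma>v/v\<close>; so the kernel is read off from the units of relative norm one.
  The square of such a \<open>u\<close> is a product of a unit of \<open>\<rat>(\<surd>2, \<i>)\<close> and a unit of \<open>\<rat>(\<surd>(p1 p2), \<i>)\<close>. With
  fundamental units \<open>a\<close> of \<open>\<rat>(\<surd>2)\<close> and \<open>b\<close> of \<open>\<rat>(\<surd>(p1 p2))\<close> this gives \<open>u = \<plusminus> (\<i> a)\<^sup>s w\<^sup>t\<close>, where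
  \<open>w = a b\<close> or \<open>w = b\<close> according as \<open>b\<close> has norm \<open>-1\<close> or \<open>1\<close>.

  The factor \<open>\<i> a\<close> is accounted for by \<open>H0\<close>, whose extension is generated by \<open>1 + \<zeta>\<^sub>8\<close>. The factor \<open>w\<close>
  depends on the unit index. The conditions on the Legendre symbols force a unit \<open>c\<close> of norm \<open>-1\<close> in
  \<open>\<rat>(\<surd>(2 p1 p2))\<close>, and if \<open>b\<close> also has norm \<open>-1\<close>, then either \<open>a b c\<close> or \<open>p1 a b c\<close> is a square in the
  real subfield of \<open>L\<close>. If \<open>a b c\<close> is a square, the index is \<open>2\<close> and \<open>w\<close> is of the form \<open>\<plusminus> \<sigma>v/v\<close>; otherwise
  (or if \<open>b\<close> has norm \<open>1\<close>, when \<open>p1 b\<close> is a square) the index is \<open>1\<close> and \<open>w\<close> comes from \<open>H1 H2\<close>,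
  whose square is \<open>(p1)\<close>. The Legendre conditions also show that \<open>H0\<close>, \<open>H1 H2\<close> and \<open>H0 H1 H2\<close> are not
  principal in \<open>k\<close>.
\<close>

section \<open>Algebraic integers\<close>

text \<open>Ideals are never factored. Every ideal that has to be recognised has a principal square
  \<open>(c)\<close>, so its class is its own inverse and its extension to \<open>L\<close> is
  generated by a square root of \<open>c\<close> times a unit. The way back from \<open>L\<close> to
  \<open>k\<close> is a direct descent: an ideal of \<open>k\<close> whose extension has a generator
  in \<open>k\<close> is already generated by it. The arithmetic input concerns square classes of
  units. A positive unit of norm one in a real quadratic field becomes a square after multiplication
  by some squarefree r > 0, and ramification leaves only a few divisors for r. For radicand
  \<open>d = 2 p1 p2\<close> such an r gives a solution of r x^2 - r' z^2 = 1 or -1 with r r' = d.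
  Reduced modulo p1 and p2, where -1 is a residue, a nontrivial r would make two of the three
  Legendre symbols equal to 1. Hence positive units of norm one are squares there, the fundamental
  unit has norm -1, and (1 + i)^s p1^t times a unit is a square in \<open>k\<close> only for even s
  and t. In \<open>L\<close> the integers 2, q and d are squares, so 1 and p1 represent the only
  square classes left among the positive divisors of d. This is the source of the dichotomy.\<close>

lemma algebraic_int_eigenvalue:
  fixes z :: complex and c :: "nat \<Rightarrow> nat \<Rightarrow> int" and v :: "nat \<Rightarrow> complex"
  assumes eq: "\<And>i. i < n \<Longrightarrow> z * v i = (\<Sum>j<n. of_int (c i j) * v j)"
    and nz: "i0 < n" "v i0 \<noteq> 0"
  shows "algebraic_int z"
proof -
  define B :: "int mat" where "B = Matrix.mat n n (\<lambda>(i,j). c i j)"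
  define A :: "complex mat" where "A = map_mat of_int B"
  have B: "B \<in> carrier_mat n n" and A: "A \<in> carrier_mat n n"
    by (auto simp: A_def B_def)
  have "A *\<^sub>v Matrix.vec n v = z \<cdot>\<^sub>v Matrix.vec n v"
    by (rule eq_vecI) (auto simp: A_def B_def scalar_prod_def eq atLeast0LessThan)
  moreover have "Matrix.vec n v \<noteq> 0\<^sub>v n"
    using nz by (metis index_vec index_zero_vec(1))
  ultimately have "eigenvalue A z"
    using A unfolding eigenvalue_def eigenvector_def
    by (intro exI[of _ "Matrix.vec n v"]) auto
  then have "poly (char_poly A) z = 0"
    by (simp add: eigenvalue_root_char_poly[OF A])
  moreover have "char_poly A = map_poly of_int (char_poly B)"
    unfolding A_def by (rule of_int_hom.char_poly_hom[OF B])
  moreover have "lead_coeff (char_poly B) = 1"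
    using degree_monic_char_poly[OF B] by auto
  ultimately show ?thesis
    unfolding algebraic_int_altdef_ipoly by (intro exI[of _ "char_poly B"]) simp
qed

text \<open>The additive group generated by \<open>S\<close>, built one integer multiple at a time
  so that closure properties follow by induction.\<close>

inductive_set int_span :: "complex set \<Rightarrow> complex set" for S where
  zero: "0 \<in> int_span S"
| add: "x \<in> int_span S \<Longrightarrow> s \<in> S \<Longrightarrow> x + of_int k * s \<in> int_span S"

lemma int_span_base: "s \<in> S \<Longrightarrow> s \<in> int_span S"
  using int_span.add[OF int_span.zero, of s S 1] by simp

lemma int_span_plus: 
  assumes "x \<in> int_span S" "y \<in> int_span S"
  shows "x + y \<in> int_span S"
  using assms(2)
proof (induction y rule: int_span.induct)
  case (add y s k)
  then show ?case using int_span.add[of "x + y" S s k] by (simp add: add.assoc)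
qed (use assms in simp)

lemma int_span_int_mult: "x \<in> int_span S \<Longrightarrow> of_int n * x \<in> int_span S"
proof (induction x rule: int_span.induct)
  case (add y s k)
  then show ?case using int_span.add[of "of_int n * y" S s "n * k"] by (simp add: algebra_simps)
qed (simp add: int_span.zero)

lemma int_span_sum: "(\<And>i. i \<in> A \<Longrightarrow> f i \<in> int_span S) \<Longrightarrow> sum f A \<in> int_span S"
  by (induction A rule: infinite_finite_induct) (simp_all add: int_span_plus int_span.zero)

lemma int_span_mult:
  assumes "\<And>s. s \<in> S \<Longrightarrow> z * s \<in> int_span S" and "x \<in> int_span S"
  shows "z * x \<in> int_span S"
  using assms(2)
proof (induction x rule: int_span.induct)
  case (add y s k)
  have "z * (y + of_int k * s) = z * y + of_int k * (z * s)"
    by (simp add: algebra_simps)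
  with add assms(1) show ?case by (metis int_span_int_mult int_span_plus)
qed (simp add: int_span.zero)

lemma int_span_coeffs:
  assumes "x \<in> int_span (v ` {..<n})"
  shows "\<exists>c. x = (\<Sum>j<n. of_int (c j) * v (j::nat))"
  using assms
proof (induction x rule: int_span.induct)
  case zero
  show ?case by (rule exI[of _ "\<lambda>_. 0"]) simp
next
  case (add x s k)
  then obtain c i where c: "x = (\<Sum>j<n. of_int (c j) * v j)" and i: "i < n" "s = v i" by auto
  have "(\<Sum>j<n. of_int ((c(i := c i + k)) j) * v j)
      = (\<Sum>j<n. of_int (c j) * v j + (if j = i then of_int k * v j else 0))"
    by (rule sum.cong) (auto simp: algebra_simps)
  also have "\<dots> = x + of_int k * s"
    using i by (simp add: sum.distrib c)
  finally show ?case by metis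
qed

text \<open>Multiplication by \<open>z\<close> acts on a finite generating set through an integer
  matrix, so \<open>z\<close> is a root of its monic characteristic polynomial. The member 1
  guarantees that the eigenvector is nonzero.\<close>

lemma algebraic_int_stable_span:
  assumes "finite S" "1 \<in> S" and st: "\<And>s. s \<in> S \<Longrightarrow> z * s \<in> int_span S"
  shows "algebraic_int z"
proof -
  obtain n :: nat and v where v: "S = v ` {..<n}"
    using finite_imp_nat_seg_image_inj_on[OF assms(1)] unfolding lessThan_def by metis
  have "\<forall>i<n. \<exists>c. z * v i = (\<Sum>j<n. of_int (c j) * v j)"
    using st v int_span_coeffs by simp
  then obtain c where c: "\<And>i. i < n \<Longrightarrow> z * v i = (\<Sum>j<n. of_int (c i j) * v j)" by metis
  obtain i0 where i0: "i0 < n" "v i0 = 1" using v assms(2) by auto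
  show ?thesis by (rule algebraic_int_eigenvalue[OF c i0(1)]) (simp_all add: i0)
qed

text \<open>Solves the monic equation for its leading power. The bound \<open>n > 0\<close> is what
  later puts 1 = x^0 y^0 among the generating monomials.\<close>

lemma algebraic_int_power_reduction:
  fixes x :: complex
  assumes "algebraic_int x"
  shows "\<exists>n c. n > 0 \<and> x ^ n = (\<Sum>i<n. of_int (c i) * x ^ i)"
proof -
  obtain p where p: "poly (map_poly of_int p) x = 0" "lead_coeff p = (1::int)"
    using assms unfolding algebraic_int_altdef_ipoly by blast
  have nz: "degree p > 0"
  proof (rule ccontr)
    assume "\<not> degree p > 0"
    then have "p = 1" using p(2) by (metis degree_eq_zeroE gr0I lead_coeff_pCons(2) one_pCons)
    then show False using p(1) by simp
  qed
  have "0 = (\<Sum>i\<le>degree p. of_int (Polynomial.coeff p i) * x ^ i)"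
    using p(1) by (simp add: poly_altdef)
  also have "\<dots> = (\<Sum>i<degree p. of_int (Polynomial.coeff p i) * x ^ i) + x ^ degree p"
    using p(2) by (simp add: lessThan_Suc_atMost[symmetric])
  finally have "x ^ degree p = (\<Sum>i<degree p. of_int (- Polynomial.coeff p i) * x ^ i)"
    by (simp add: sum_negf eq_neg_iff_add_eq_0 add.commute)
  then show ?thesis using nz by (intro exI conjI)
qed

text \<open>The monomials x^i y^j with i < n and j < m span a group stable under both factors:
  multiplying by \<open>x\<close> or \<open>y\<close> either moves to the next monomial or hits the
  leading power, which is rewritten by lower ones.\<close>

lemma algebraic_int_plus_times:
  fixes x y :: complex
  assumes "algebraic_int x" "algebraic_int y"
  shows "algebraic_int (x + y) \<and> algebraic_int (x * y)"
proof -
  obtain n c where n: "n > 0" "x ^ n = (\<Sum>i<n. of_int (c i) * x ^ i)"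
    using algebraic_int_power_reduction[OF assms(1)] by blast
  obtain m e where m: "m > 0" "y ^ m = (\<Sum>i<m. of_int (e i) * y ^ i)"
    using algebraic_int_power_reduction[OF assms(2)] by blast
  define S where "S = (\<lambda>(i,j). x ^ i * y ^ j) ` ({..<n} \<times> {..<m})"
  have S: "x ^ i * y ^ j \<in> S" if "i < n" "j < m" for i j
    unfolding S_def using that by (intro image_eqI[of _ _ "(i, j)"]) simp_all
  have "finite S" by (simp add: S_def)
  have "1 \<in> S" using S[of 0 0] n(1) m(1) by simp
  have xs: "x * s \<in> int_span S" if sS: "s \<in> S" for s
  proof -
    obtain i j where ij: "i < n" "j < m" "s = x ^ i * y ^ j" using sS by (auto simp only: S_def image_iff mem_Sigma_iff lessThan_iff split: prod.splits)
    show ?thesis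
    proof (cases "Suc i < n")
      case True
      then show ?thesis using int_span_base[OF S[of "Suc i" j]] ij by (simp add: mult.assoc)
    next
      case False
      then have *: "Suc i = n" using ij by simp
      have "x * s = x ^ n * y ^ j" unfolding *[symmetric] using ij by simp
      also have "\<dots> = (\<Sum>k<n. of_int (c k) * (x ^ k * y ^ j))"
        unfolding n(2) by (simp add: sum_distrib_left sum_distrib_right mult_ac)
      also have "\<dots> \<in> int_span S"
        by (intro int_span_sum int_span_int_mult int_span_base S) (use ij in auto)
      finally show ?thesis .
    qed
  qed
  have ys: "y * s \<in> int_span S" if sS: "s \<in> S" for s
  proof -
    obtain i j where ij: "i < n" "j < m" "s = x ^ i * y ^ j" using sS by (auto simp only: S_def image_iff mem_Sigma_iff lessThan_iff split: prod.splits)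
    show ?thesis
    proof (cases "Suc j < m")
      case True
      then show ?thesis using int_span_base[OF S[of i "Suc j"]] ij by (simp add: mult_ac)
    next
      case False
      then have *: "Suc j = m" using ij by simp
      have "y * s = x ^ i * y ^ m" unfolding *[symmetric] using ij by simp
      also have "\<dots> = (\<Sum>k<m. of_int (e k) * (x ^ i * y ^ k))"
        unfolding m(2) by (simp add: sum_distrib_left mult_ac)
      also have "\<dots> \<in> int_span S"
        by (intro int_span_sum int_span_int_mult int_span_base S) (use ij in auto)
      finally show ?thesis .
    qed
  qed
  have "(x + y) * s \<in> int_span S" if "s \<in> S" for s
    using xs[OF that] ys[OF that] by (simp add: distrib_right int_span_plus)
  moreover have "(x * y) * s \<in> int_span S" if "s \<in> S" for s
    using int_span_mult[OF xs ys[OF that]] by (simp add: mult.assoc)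
  ultimately show ?thesis
    using algebraic_int_stable_span[OF \<open>finite S\<close> \<open>1 \<in> S\<close>] by simp
qed

lemma algebraic_int_add: "algebraic_int x \<Longrightarrow> algebraic_int y \<Longrightarrow> algebraic_int (x + y :: complex)"
  and algebraic_int_mult: "algebraic_int x \<Longrightarrow> algebraic_int y \<Longrightarrow> algebraic_int (x * y :: complex)"
  using algebraic_int_plus_times by auto

lemma algebraic_int_diff: "algebraic_int x \<Longrightarrow> algebraic_int y \<Longrightarrow> algebraic_int (x - y :: complex)"
  using algebraic_int_add[of x "- y"] by simp

lemma algebraic_int_of_power:
  fixes x :: complex
  assumes "algebraic_int (x ^ n)" "n > 0"
  shows "algebraic_int x"
  by (rule algebraic_int_root[OF assms(1), where p = "Polynomial.monom 1 n"])
    (use assms(2) in \<open>auto simp: poly_monom degree_monom_eq\<close>)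

section \<open>Subfields and quadratic extensions\<close>

text \<open>A field automorphism is a total function constrained on \<open>L\<close> only;
  \<open>\<phi> 1 = 1\<close> excludes the zero map and makes inverses and nonvanishing
  follow.\<close>

definition is_hom_on :: "complex set \<Rightarrow> (complex \<Rightarrow> complex) \<Rightarrow> bool" where
  "is_hom_on L \<phi> \<longleftrightarrow> \<phi> 1 = 1 \<and> (\<forall>x\<in>L. \<phi> x \<in> L) \<and>
     (\<forall>x\<in>L. \<forall>y\<in>L. \<phi> (x + y) = \<phi> x + \<phi> y \<and> \<phi> (x * y) = \<phi> x * \<phi> y)"

locale subfield =
  fixes L :: "complex set"
  assumes is_subfield: "is_subfield L"
begin

lemma zero [simp]: "0 \<in> L" and one [simp]: "1 \<in> L"
  and add [simp]: "x \<in> L \<Longrightarrow> y \<in> L \<Longrightarrow> x + y \<in> L"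
  and diff [simp]: "x \<in> L \<Longrightarrow> y \<in> L \<Longrightarrow> x - y \<in> L"
  and mult [simp]: "x \<in> L \<Longrightarrow> y \<in> L \<Longrightarrow> x * y \<in> L"
  using is_subfield by (auto simp: is_subfield_def)

lemma inverse [simp]: "x \<in> L \<Longrightarrow> inverse x \<in> L"
  using is_subfield by (cases "x = 0") (auto simp: is_subfield_def)

lemma divide [simp]: "x \<in> L \<Longrightarrow> y \<in> L \<Longrightarrow> x / y \<in> L"
  by (simp add: divide_inverse)

lemma uminus [simp]: "x \<in> L \<Longrightarrow> - x \<in> L"
  using diff[of 0 x] by simp

lemma uminus_iff [simp]: "- x \<in> L \<longleftrightarrow> x \<in> L"
  using uminus[of "- x"] by auto

lemma power [simp]: "x \<in> L \<Longrightarrow> x ^ n \<in> L"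
  by (induction n) auto

lemma power_int [simp]: "x \<in> L \<Longrightarrow> x powi n \<in> L"
  by (auto simp: power_int_def)

lemma of_nat [simp]: "of_nat n \<in> L"
  by (induction n) auto

lemma of_int [simp]: "of_int n \<in> L"
  by (cases n) (auto simp del: of_nat_Suc)

lemma numeral [simp]: "numeral n \<in> L"
  using of_nat[of "numeral n"] by simp

lemma Rats: "x \<in> \<rat> \<Longrightarrow> x \<in> L"
  by (auto elim!: Rats_cases' simp: Rats_def of_rat_def elim: Rats_induct)

end

lemma is_subfield_Rats: "is_subfield \<rat>"
  by (auto simp: is_subfield_def)

lemma is_subfield_Reals: "is_subfield \<real>"
  by (auto simp: is_subfield_def)

lemma is_subfield_field_gen: "is_subfield (field_gen S)"
  by (auto simp: field_gen_def is_subfield_def)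

lemma field_gen_superset: "S \<subseteq> field_gen S"
  by (auto simp: field_gen_def)

lemma field_gen_least: "is_subfield F \<Longrightarrow> S \<subseteq> F \<Longrightarrow> field_gen S \<subseteq> F"
  by (auto simp: field_gen_def)

lemma field_gen_empty: "field_gen {} = \<rat>"
  using field_gen_least[OF is_subfield_Rats, of "{}"]
    subfield.Rats[OF subfield.intro[OF is_subfield_field_gen, of "{}"]] by auto

definition qext :: "complex set \<Rightarrow> complex \<Rightarrow> complex set" where
  "qext F s = {x + y * s | x y. x \<in> F \<and> y \<in> F}"

text \<open>A description operator, meaningful on \<open>qext F s\<close> once \<open>s\<close> lies
  outside \<open>F\<close> and the coordinates are unique. Base field and root are parameters
  because \<open>L\<close> is later read as a quadratic extension in three ways.\<close>

definition qconj :: "complex set \<Rightarrow> complex \<Rightarrow> complex \<Rightarrow> complex" where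
  "qconj F s z = (THE w. \<exists>x\<in>F. \<exists>y\<in>F. z = x + y * s \<and> w = x - y * s)"

locale hom_on = subfield L for L +
  fixes \<phi> :: "complex \<Rightarrow> complex"
  assumes hom: "is_hom_on L \<phi>"
begin

lemma hom_one [simp]: "\<phi> 1 = 1"
  and hom_closed [simp]: "x \<in> L \<Longrightarrow> \<phi> x \<in> L"
  and hom_add [simp]: "x \<in> L \<Longrightarrow> y \<in> L \<Longrightarrow> \<phi> (x + y) = \<phi> x + \<phi> y"
  and hom_mult [simp]: "x \<in> L \<Longrightarrow> y \<in> L \<Longrightarrow> \<phi> (x * y) = \<phi> x * \<phi> y"
  using hom by (auto simp: is_hom_on_def)

lemma hom_zero [simp]: "\<phi> 0 = 0"
  using hom_add[of 0 0] by simp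

lemma hom_uminus [simp]: "x \<in> L \<Longrightarrow> \<phi> (- x) = - \<phi> x"
  using hom_add[of x "- x"] by (simp add: eq_neg_iff_add_eq_0 add.commute)

lemma hom_diff [simp]: "x \<in> L \<Longrightarrow> y \<in> L \<Longrightarrow> \<phi> (x - y) = \<phi> x - \<phi> y"
  using hom_add[of x "- y"] by simp

lemma hom_inverse [simp]: "x \<in> L \<Longrightarrow> \<phi> (inverse x) = inverse (\<phi> x)"
  using hom_mult[of x "inverse x"] by (cases "x = 0") (auto intro: inverse_unique[symmetric])

lemma hom_eq_0_iff [simp]: "x \<in> L \<Longrightarrow> \<phi> x = 0 \<longleftrightarrow> x = 0"
  using hom_mult[of x "inverse x"] by (cases "x = 0") auto

lemma hom_divide [simp]: "x \<in> L \<Longrightarrow> y \<in> L \<Longrightarrow> \<phi> (x / y) = \<phi> x / \<phi> y"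
  by (simp add: divide_inverse)

lemma hom_power [simp]: "x \<in> L \<Longrightarrow> \<phi> (x ^ n) = \<phi> x ^ n"
  by (induction n) auto

lemma hom_power_int [simp]: "x \<in> L \<Longrightarrow> \<phi> (x powi n) = \<phi> x powi n"
  by (auto simp: power_int_def)

lemma hom_of_nat [simp]: "\<phi> (of_nat n) = of_nat n"
  by (induction n) auto

lemma hom_of_int [simp]: "\<phi> (of_int n) = of_int n"
  by (cases n) (auto simp del: of_nat_Suc)

lemma hom_numeral [simp]: "\<phi> (numeral n) = numeral n"
  using hom_of_nat[of "numeral n"] by simp

lemma hom_Rats: "x \<in> \<rat> \<Longrightarrow> \<phi> x = x"
  by (auto elim!: Rats_cases')

lemma algebraic_int_hom:
  assumes "x \<in> L" "algebraic_int x"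
  shows "algebraic_int (\<phi> x)"
proof -
  obtain p where p: "poly (map_poly of_int p) x = 0" "lead_coeff p = (1::int)"
    using assms(2) unfolding algebraic_int_altdef_ipoly by auto
  have "poly (map_poly of_int p) x \<in> L \<and>
      \<phi> (poly (map_poly of_int p) x) = poly (map_poly of_int p) (\<phi> x)" for p
    by (induction p) (use assms(1) in \<open>auto simp: map_poly_pCons\<close>)
  with p show ?thesis
    unfolding algebraic_int_altdef_ipoly by (intro exI[of _ p]) (metis hom_zero)
qed

lemma is_subfield_agree:
  assumes "hom_on L \<psi>"
  shows "is_subfield {x \<in> L. \<phi> x = \<psi> x}"
proof -
  interpret h: hom_on L \<psi> by fact
  show ?thesis by (auto simp: is_subfield_def)
qed

text \<open>The agreement set of two homomorphisms is a subfield. Identities between compositions of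
  automorphisms thereby reduce to the generators.\<close>

lemma hom_eq_on_gen:
  assumes "hom_on L \<psi>" "L = field_gen A" "\<And>x. x \<in> A \<Longrightarrow> \<phi> x = \<psi> x" "x \<in> L"
  shows "\<phi> x = \<psi> x"
  using field_gen_least[OF is_subfield_agree[OF assms(1)], of A] field_gen_superset[of A] assms
  by auto

lemma hom_comp: "hom_on L \<psi> \<Longrightarrow> hom_on L (\<lambda>x. \<phi> (\<psi> x))"
  by unfold_locales (auto simp: is_hom_on_def hom_on_def hom_on_axioms_def)

end

lemma hom_on_id: "is_subfield L \<Longrightarrow> hom_on L (\<lambda>x. x)"
  by unfold_locales (auto simp: is_hom_on_def)

lemma hom_on_cnj: "is_subfield L \<Longrightarrow> (\<And>x. x \<in> L \<Longrightarrow> cnj x \<in> L) \<Longrightarrow> hom_on L cnj"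
  by unfold_locales (auto simp: is_hom_on_def)

lemma cnj_field_gen:
  assumes "\<And>x. x \<in> A \<Longrightarrow> cnj x \<in> field_gen A" "x \<in> field_gen A"
  shows "cnj x \<in> field_gen A"
proof -
  have "is_subfield {x. cnj x \<in> field_gen A}"
    using is_subfield_field_gen[of A] by (simp add: is_subfield_def)
  then have "field_gen A \<subseteq> {x. cnj x \<in> field_gen A}"
    using assms(1) by (intro field_gen_least) auto
  then show ?thesis using assms(2) by auto
qed

locale quad_ext = subfield F for F +
  fixes s :: complex
  assumes sq: "s * s \<in> F" and ns: "s \<notin> F"
begin

lemma unique:
  assumes "x \<in> F" "y \<in> F" "x' \<in> F" "y' \<in> F" "x + y * s = x' + y' * s"
  shows "x = x' \<and> y = y'"
proof -
  have "y = y'"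
  proof (rule ccontr)
    assume "y \<noteq> y'"
    then have "s = (x' - x) / (y - y')" using assms(5) by (simp add: field_simps)
    then show False using ns assms by simp
  qed
  then show ?thesis using assms(5) by simp
qed

lemma qconj_eq:
  assumes "x \<in> F" "y \<in> F"
  shows "qconj F s (x + y * s) = x - y * s"
  unfolding qconj_def
  by (rule the_equality) (use assms unique in \<open>blast+\<close>)

lemma qconj_base [simp]: "x \<in> F \<Longrightarrow> qconj F s x = x"
  using qconj_eq[of x 0] by simp

lemma qconj_gen [simp]: "qconj F s s = - s"
  using qconj_eq[of 0 1] by simp

lemma qextE:
  assumes "z \<in> qext F s"
  obtains x y where "x \<in> F" "y \<in> F" "z = x + y * s"
  using assms by (auto simp: qext_def)

lemma qextI: "x \<in> F \<Longrightarrow> y \<in> F \<Longrightarrow> x + y * s \<in> qext F s"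
  by (auto simp: qext_def)

lemma base_qext: "x \<in> F \<Longrightarrow> x \<in> qext F s"
  using qextI[of x 0] by simp

lemma gen_qext: "s \<in> qext F s"
  using qextI[of 0 1] by simp

lemma mult_eq: "(x + y * s) * (x' + y' * s) = (x * x' + y * y' * (s * s)) + (x * y' + y * x') * s"
  by (simp add: algebra_simps)

lemma is_subfield_qext: "is_subfield (qext F s)"
proof -
  have "x + y * s + (x' + y' * s) \<in> qext F s" "x + y * s - (x' + y' * s) \<in> qext F s"
    "(x + y * s) * (x' + y' * s) \<in> qext F s" if "x \<in> F" "y \<in> F" "x' \<in> F" "y' \<in> F" for x y x' y'
  proof -
    show "x + y * s + (x' + y' * s) \<in> qext F s" "x + y * s - (x' + y' * s) \<in> qext F s"
      using qextI[of "x + x'" "y + y'"] qextI[of "x - x'" "y - y'"] that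
      by (simp_all add: algebra_simps)
    show "(x + y * s) * (x' + y' * s) \<in> qext F s"
      unfolding mult_eq using that sq by (intro qextI) simp_all
  qed
  moreover have "inverse (x + y * s) \<in> qext F s" if xy: "x \<in> F" "y \<in> F" "x + y * s \<noteq> 0" for x y
  proof -
    define N where "N = x * x - y * y * (s * s)"
    have N: "N \<in> F" using xy sq by (simp add: N_def)
    have eq: "(x + y * s) * (x - y * s) = N" by (simp add: N_def algebra_simps)
    have "x - y * s \<noteq> 0"
      using unique[of x "- y" 0 0] xy by auto
    then have "N \<noteq> 0" using eq xy(3) by auto
    then have "inverse (x + y * s) = x / N + (- y / N) * s"
      using eq xy(3) by (simp add: field_simps)
    then show ?thesis using qextI[of "x / N" "- y / N"] xy N by simp
  qed
  ultimately show ?thesis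
    using base_qext[of 0] base_qext[of 1] unfolding is_subfield_def
    by (auto elim!: qextE)
qed

lemma field_gen_insert:
  assumes "F = field_gen A"
  shows "field_gen (insert s A) = qext F s"
proof
  show "field_gen (insert s A) \<subseteq> qext F s"
    using gen_qext base_qext field_gen_superset[of A] assms
    by (intro field_gen_least[OF is_subfield_qext]) auto
  interpret G: subfield "field_gen (insert s A)"
    by unfold_locales (rule is_subfield_field_gen)
  have "F \<subseteq> field_gen (insert s A)"
    unfolding assms using field_gen_superset[of "insert s A"]
    by (intro field_gen_least is_subfield_field_gen) auto
  then show "qext F s \<subseteq> field_gen (insert s A)"
    using field_gen_superset[of "insert s A"] by (auto elim!: qextE simp: subset_iff)
qed

lemma hom_on_qconj: "hom_on (qext F s) (qconj F s)"
proof
  show "is_subfield (qext F s)" by (rule is_subfield_qext)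
  have *: "qconj F s (x + y * s + (x' + y' * s)) = (x - y * s) + (x' - y' * s)"
    "qconj F s ((x + y * s) * (x' + y' * s)) = (x - y * s) * (x' - y' * s)"
    if "x \<in> F" "y \<in> F" "x' \<in> F" "y' \<in> F" for x y x' y'
  proof -
    show "qconj F s (x + y * s + (x' + y' * s)) = (x - y * s) + (x' - y' * s)"
      using that qconj_eq[of "x + x'" "y + y'"] by (simp add: algebra_simps)
    have "qconj F s ((x + y * s) * (x' + y' * s)) = (x * x' + y * y' * (s * s)) - (x * y' + y * x') * s"
      unfolding mult_eq using that sq by (intro qconj_eq) simp_all
    then show "qconj F s ((x + y * s) * (x' + y' * s)) = (x - y * s) * (x' - y' * s)"
      by (simp add: algebra_simps)
  qed
  have "qconj F s (x + y * s) \<in> qext F s" if "x \<in> F" "y \<in> F" for x y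
    using that qconj_eq[of x y] qextI[of x "- y"] by simp
  with * show "is_hom_on (qext F s) (qconj F s)"
    unfolding is_hom_on_def by (auto elim!: qextE simp: qconj_eq)
qed

lemma qconj_qconj: "z \<in> qext F s \<Longrightarrow> qconj F s (qconj F s z) = z"
  using qconj_eq[of _ "- _"] by (auto elim!: qextE simp: qconj_eq)

lemma qconj_fixed: 
  assumes "z \<in> qext F s" "qconj F s z = z"
  shows "z \<in> F"
proof -
  obtain x y where xy: "x \<in> F" "y \<in> F" "z = x + y * s" using assms(1) by (elim qextE)
  then have "x - y * s = x + y * s" using assms(2) by (simp add: qconj_eq)
  then have "y * s = 0" by (simp add: algebra_simps)
  then show ?thesis using xy by auto
qed

text \<open>Kummer theory in degree two: the \<open>s\<close>-coordinate of (x + y s)^2 is 2 x y, so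
  one coordinate vanishes. This is how square roots are kept out of composite fields.\<close>

lemma sqrt_in_qext:
  assumes "t \<in> qext F s" "t * t \<in> F"
  shows "t \<in> F \<or> t * s \<in> F"
proof -
  obtain x y where xy: "x \<in> F" "y \<in> F" "t = x + y * s" using assms(1) by (elim qextE)
  have tt: "t * t = (x * x + y * y * (s * s)) + (x * y + y * x) * s"
    unfolding xy(3) by (rule mult_eq)
  have "x * y + y * x = 0"
    using unique[of "t * t" 0 "x * x + y * y * (s * s)" "x * y + y * x"] tt xy sq assms(2) by auto
  then have "x = 0 \<or> y = 0" by simp
  then show ?thesis
  proof
    assume "x = 0"
    then show ?thesis using xy sq by (simp add: mult.assoc)
  qed (use xy in simp)
qed

end

lemma field_gen_eqI: "A \<subseteq> field_gen B \<Longrightarrow> B \<subseteq> field_gen A \<Longrightarrow> field_gen A = field_gen B"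
  by (intro equalityI field_gen_least is_subfield_field_gen)

section \<open>Ideals and units\<close>

locale complex_ring =
  fixes R :: "complex set"
  assumes ring_zero [simp]: "0 \<in> R" and ring_one [simp]: "1 \<in> R"
    and ring_add [simp]: "x \<in> R \<Longrightarrow> y \<in> R \<Longrightarrow> x + y \<in> R"
    and ring_uminus [simp]: "x \<in> R \<Longrightarrow> - x \<in> R"
    and ring_mult [simp]: "x \<in> R \<Longrightarrow> y \<in> R \<Longrightarrow> x * y \<in> R"
begin

lemma ideal_subset: "is_ideal R I \<Longrightarrow> I \<subseteq> R"
  by (simp add: is_ideal_def)

lemma ideal_in: "is_ideal R I \<Longrightarrow> x \<in> I \<Longrightarrow> x \<in> R"
  by (auto simp: is_ideal_def)

lemma is_ideal_ring: "is_ideal R R"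
  by (simp add: is_ideal_def)

lemma is_ideal_scale:
  assumes "a \<in> R" "is_ideal R I"
  shows "is_ideal R ((\<lambda>x. a * x) ` I)"
  unfolding is_ideal_def
proof (intro conjI ballI)
  show "(\<lambda>x. a * x) ` I \<subseteq> R" using assms by (auto simp: is_ideal_def subset_iff)
  show "0 \<in> (\<lambda>x. a * x) ` I" using assms by (intro image_eqI[of _ _ 0]) (auto simp: is_ideal_def)
next
  fix x y assume "x \<in> (\<lambda>x. a * x) ` I" "y \<in> (\<lambda>x. a * x) ` I"
  then obtain x' y' where "x = a * x'" "y = a * y'" "x' \<in> I" "y' \<in> I" by auto
  then show "x + y \<in> (\<lambda>x. a * x) ` I"
    using assms(2) by (intro image_eqI[of _ _ "x' + y'"]) (auto simp: is_ideal_def algebra_simps)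
next
  fix r x assume "r \<in> R" "x \<in> (\<lambda>x. a * x) ` I"
  then obtain x' where "x = a * x'" "x' \<in> I" by auto
  then show "r * x \<in> (\<lambda>x. a * x) ` I"
    using assms(2) \<open>r \<in> R\<close> by (intro image_eqI[of _ _ "r * x'"]) (auto simp: is_ideal_def)
qed

lemma is_ideal_principal: "a \<in> R \<Longrightarrow> is_ideal R (principal_ideal R a)"
  unfolding principal_ideal_def by (rule is_ideal_scale[OF _ is_ideal_ring])

lemma principal_ideal_self: "a \<in> principal_ideal R a"
  unfolding principal_ideal_def by (rule image_eqI[of _ _ 1]) auto

lemma principal_ideal_one: "principal_ideal R 1 = R"
  by (simp add: principal_ideal_def)

lemma principal_ideal_subset: "is_ideal R I \<Longrightarrow> principal_ideal R a \<subseteq> I \<longleftrightarrow> a \<in> I"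
  using principal_ideal_self[of a] by (auto simp: principal_ideal_def is_ideal_def mult.commute)

lemma is_ideal_gen:
  assumes "S \<subseteq> R"
  shows "is_ideal R (ideal_gen R S)"
proof -
  have "ideal_gen R S \<subseteq> R" using assms is_ideal_ring by (auto simp: ideal_gen_def)
  then show ?thesis by (auto simp: ideal_gen_def is_ideal_def)
qed

lemma ideal_gen_superset: "S \<subseteq> ideal_gen R S"
  by (auto simp: ideal_gen_def)

lemma ideal_gen_subset_iff: "is_ideal R I \<Longrightarrow> ideal_gen R S \<subseteq> I \<longleftrightarrow> S \<subseteq> I"
  by (auto simp: ideal_gen_def)

lemma is_ideal_mult:
  assumes "is_ideal R I" "is_ideal R J"
  shows "is_ideal R (ideal_mult R I J)"
  unfolding ideal_mult_def
  by (rule is_ideal_gen) (use assms in \<open>auto simp: is_ideal_def subset_iff\<close>)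

lemma ideal_multI: "x \<in> I \<Longrightarrow> y \<in> J \<Longrightarrow> x * y \<in> ideal_mult R I J"
  unfolding ideal_mult_def by (rule subsetD[OF ideal_gen_superset]) auto

lemma ideal_mult_subset_iff:
  assumes "is_ideal R T"
  shows "ideal_mult R I J \<subseteq> T \<longleftrightarrow> (\<forall>x\<in>I. \<forall>y\<in>J. x * y \<in> T)"
  unfolding ideal_mult_def ideal_gen_subset_iff[OF assms] by auto

text \<open>Colon ideals reduce a claim about all elements of a generated ideal to a claim about its
  generators.\<close>

lemma is_ideal_colon:
  assumes "is_ideal R T" "a \<in> R"
  shows "is_ideal R {z \<in> R. a * z \<in> T}"
  using assms by (auto simp: is_ideal_def algebra_simps)

lemma is_ideal_colon':
  assumes "is_ideal R T"
  shows "is_ideal R {z \<in> R. \<forall>c\<in>J. z * c \<in> T}"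
  using assms by (auto simp: is_ideal_def algebra_simps)

lemma ideal_mult_commute: "ideal_mult R I J = ideal_mult R J I"
  unfolding ideal_mult_def by (rule arg_cong[of _ _ "ideal_gen R"]) (auto, (metis mult.commute)+)

lemma ideal_mult_assoc_subset:
  assumes "is_ideal R I" "is_ideal R J" "is_ideal R K"
  shows "ideal_mult R (ideal_mult R I J) K \<subseteq> ideal_mult R I (ideal_mult R J K)"
proof -
  let ?T = "ideal_mult R I (ideal_mult R J K)"
  have T: "is_ideal R ?T" using assms by (intro is_ideal_mult)
  have "ideal_mult R I J \<subseteq> {z \<in> R. \<forall>c\<in>K. z * c \<in> ?T}"
    unfolding ideal_mult_subset_iff[OF is_ideal_colon'[OF T]]
    using ideal_in[OF assms(1)] ideal_in[OF assms(2)] by (auto simp: mult.assoc intro!: ideal_multI)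
  then show ?thesis unfolding ideal_mult_subset_iff[OF T] by auto
qed

text \<open>The second inclusion is the first one with the three factors in reverse order, read
  through commutativity.\<close>

lemma ideal_mult_assoc:
  assumes "is_ideal R I" "is_ideal R J" "is_ideal R K"
  shows "ideal_mult R (ideal_mult R I J) K = ideal_mult R I (ideal_mult R J K)"
  using ideal_mult_assoc_subset[OF assms] ideal_mult_assoc_subset[OF assms(3,2,1)]
  by (auto simp: ideal_mult_commute)

lemma ideal_mult_scale:
  assumes "is_ideal R I" "is_ideal R J" "a \<in> R"
  shows "ideal_mult R ((\<lambda>x. a * x) ` I) J = (\<lambda>x. a * x) ` ideal_mult R I J" (is "?l = ?r")
proof
  have r: "is_ideal R ?r" and l: "is_ideal R ?l"
    using assms by (intro is_ideal_mult is_ideal_scale; simp)+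
  show "?l \<subseteq> ?r"
    unfolding ideal_mult_subset_iff[OF r] using assms 
    by (auto simp: mult.assoc intro!: ideal_multI image_eqI[of _ _ "_ * _"])
  have "ideal_mult R I J \<subseteq> {z \<in> R. a * z \<in> ?l}"
    unfolding ideal_mult_subset_iff[OF is_ideal_colon[OF l assms(3)]]
    using ideal_in[OF assms(1)] ideal_in[OF assms(2)] assms(3)
    by (auto simp flip: mult.assoc intro!: ideal_multI)
  then show "?r \<subseteq> ?l" by auto
qed

lemma ideal_mult_ring:
  assumes "is_ideal R I"
  shows "ideal_mult R R I = I"
proof
  show "ideal_mult R R I \<subseteq> I"
    unfolding ideal_mult_subset_iff[OF assms] using assms by (auto simp: is_ideal_def)
  show "I \<subseteq> ideal_mult R R I" using ideal_multI[of 1 R] by fastforce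
qed

lemma ideal_mult_principal:
  assumes "is_ideal R I" "a \<in> R"
  shows "ideal_mult R (principal_ideal R a) I = (\<lambda>x. a * x) ` I"
  unfolding principal_ideal_def
  by (subst ideal_mult_scale) (use assms is_ideal_ring ideal_mult_ring in auto)

lemma is_ideal_pow: "is_ideal R I \<Longrightarrow> is_ideal R (ideal_pow R I n)"
  by (induction n) (auto intro: is_ideal_mult is_ideal_ring)

lemma nonzero_ideal_iff: "nonzero_ideal R I \<longleftrightarrow> is_ideal R I \<and> (\<exists>x\<in>I. x \<noteq> 0)"
  by (auto simp: nonzero_ideal_def is_ideal_def)

lemma nonzero_ideal_mult:
  assumes "nonzero_ideal R I" "nonzero_ideal R J"
  shows "nonzero_ideal R (ideal_mult R I J)"
proof -
  obtain x y where "x \<in> I" "x \<noteq> 0" "y \<in> J" "y \<noteq> 0" using assms by (auto simp: nonzero_ideal_iff)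
  then show ?thesis using assms ideal_multI[of x I y J] is_ideal_mult
    by (metis no_zero_divisors nonzero_ideal_iff)
qed

lemma nonzero_ideal_ring: "nonzero_ideal R R"
  unfolding nonzero_ideal_iff using is_ideal_ring by (auto intro!: bexI[of _ 1])

lemma nonzero_ideal_pow: "nonzero_ideal R I \<Longrightarrow> nonzero_ideal R (ideal_pow R I n)"
  by (induction n) (auto intro: nonzero_ideal_mult nonzero_ideal_ring)

lemma ideal_equiv_refl: "ideal_equiv R I I"
  unfolding ideal_equiv_def by (intro bexI[of _ 1]) auto

lemma ideal_equiv_sym: "ideal_equiv R I J \<Longrightarrow> ideal_equiv R J I"
  unfolding ideal_equiv_def by metis

lemma scale_scale: "(\<lambda>x. a * x) ` (\<lambda>x. b * x) ` I = (\<lambda>x. (a * b) * x) ` (I :: complex set)"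
  by (simp add: image_image mult.assoc)

lemma ideal_equiv_trans:
  assumes "ideal_equiv R I J" "ideal_equiv R J K"
  shows "ideal_equiv R I K"
proof -
  obtain a b where ab: "a \<in> R" "b \<in> R" "a \<noteq> 0" "b \<noteq> 0" "(\<lambda>x. a * x) ` I = (\<lambda>x. b * x) ` J"
    using assms(1) unfolding ideal_equiv_def by metis
  obtain c d where cd: "c \<in> R" "d \<in> R" "c \<noteq> 0" "d \<noteq> 0" "(\<lambda>x. c * x) ` J = (\<lambda>x. d * x) ` K"
    using assms(2) unfolding ideal_equiv_def by metis
  have "(\<lambda>x. (c * a) * x) ` I = (\<lambda>x. c * x) ` (\<lambda>x. b * x) ` J"
    unfolding scale_scale[symmetric] ab(5) ..
  also have "\<dots> = (\<lambda>x. b * x) ` (\<lambda>x. c * x) ` J" unfolding scale_scale by (simp add: mult.commute)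
  also have "\<dots> = (\<lambda>x. (b * d) * x) ` K" unfolding cd(5) scale_scale ..
  finally show ?thesis
    unfolding ideal_equiv_def using ab cd by (intro bexI[of _ "c * a"] bexI[of _ "b * d"]) auto
qed

lemma ideal_class_eq_iff:
  assumes "nonzero_ideal R I" "nonzero_ideal R J"
  shows "ideal_class R I = ideal_class R J \<longleftrightarrow> ideal_equiv R I J"
proof
  assume "ideal_class R I = ideal_class R J"
  then have "J \<in> ideal_class R I" using assms ideal_equiv_refl by (simp add: ideal_class_def)
  then show "ideal_equiv R I J" by (simp add: ideal_class_def)
next
  assume "ideal_equiv R I J"
  then show "ideal_class R I = ideal_class R J"
    unfolding ideal_class_def using ideal_equiv_sym[of I J] ideal_equiv_trans[of I J]
      ideal_equiv_trans[of J I] by blast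
qed

lemma ideal_equiv_mult_right:
  assumes "is_ideal R I" "is_ideal R I'" "is_ideal R J" "ideal_equiv R I I'"
  shows "ideal_equiv R (ideal_mult R I J) (ideal_mult R I' J)"
proof -
  obtain a b where ab: "a \<in> R" "b \<in> R" "a \<noteq> 0" "b \<noteq> 0" "(\<lambda>x. a * x) ` I = (\<lambda>x. b * x) ` I'"
    using assms(4) unfolding ideal_equiv_def by metis
  then show ?thesis
    unfolding ideal_equiv_def
    by (intro bexI[of _ a] bexI[of _ b] conjI) (simp_all add: assms flip: ideal_mult_scale)
qed

lemma ideal_equiv_principal:
  assumes "c \<in> R" "c \<noteq> 0"
  shows "ideal_equiv R (principal_ideal R c) R"
  unfolding ideal_equiv_def principal_ideal_def
  by (intro bexI[of _ 1] bexI[of _ c]) (use assms in auto)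

end

abbreviation unit_group :: "complex set \<Rightarrow> complex set" where
  "unit_group F \<equiv> units_of_ring (ring_of_integers F)"

context subfield
begin

lemma mem_ring_of_integers: "x \<in> ring_of_integers L \<longleftrightarrow> x \<in> L \<and> algebraic_int x"
  by (simp add: ring_of_integers_def)

sublocale O: complex_ring "ring_of_integers L"
  by unfold_locales (auto simp: mem_ring_of_integers intro: algebraic_int_add algebraic_int_mult)

lemma mem_unit_group:
  "u \<in> unit_group L \<longleftrightarrow> u \<in> L \<and> u \<noteq> 0 \<and> algebraic_int u \<and> algebraic_int (inverse u)"
proof -
  have "inverse u = y" if "u * y = 1" for y
    using that by (rule inverse_unique)
  then show ?thesis
    by (auto simp: units_of_ring_def mem_ring_of_integers intro!: bexI[of _ "inverse u"])
qed

lemma unitD: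
  assumes "u \<in> unit_group L"
  shows "u \<in> L" "u \<noteq> 0" "algebraic_int u" "algebraic_int (inverse u)" "u \<in> ring_of_integers L"
    "inverse u \<in> ring_of_integers L"
  using assms by (auto simp: mem_unit_group mem_ring_of_integers)

lemma unit_mult: "u \<in> unit_group L \<Longrightarrow> v \<in> unit_group L \<Longrightarrow> u * v \<in> unit_group L"
  by (simp add: mem_unit_group algebraic_int_mult)

lemma unit_one: "1 \<in> unit_group L"
  by (simp add: mem_unit_group)

lemma unit_inverse: "u \<in> unit_group L \<Longrightarrow> inverse u \<in> unit_group L"
  by (simp add: mem_unit_group)

lemma unit_uminus: "u \<in> unit_group L \<Longrightarrow> - u \<in> unit_group L"
  by (simp add: mem_unit_group)

lemma unit_power: "u \<in> unit_group L \<Longrightarrow> u ^ n \<in> unit_group L"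
  by (induction n) (auto intro: unit_one unit_mult)

lemma unit_power_int: "u \<in> unit_group L \<Longrightarrow> u powi n \<in> unit_group L"
  unfolding power_int_def by (auto intro: unit_power unit_inverse)

lemma unit_of_power:
  assumes "u \<in> L" "u ^ n \<in> unit_group L" "n > 0"
  shows "u \<in> unit_group L"
proof -
  have "algebraic_int u" "algebraic_int (inverse u)"
    using assms algebraic_int_of_power[of u n] algebraic_int_of_power[of "inverse u" n]
    by (simp_all add: mem_unit_group power_inverse)
  then show ?thesis using assms by (auto simp: mem_unit_group zero_power)
qed

lemma unit_mono: "is_subfield K \<Longrightarrow> L \<subseteq> K \<Longrightarrow> u \<in> unit_group L \<Longrightarrow> u \<in> unit_group K"
  using subfield.mem_unit_group[of K] by (auto simp: mem_unit_group subfield_def)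

lemma unit_sub: "is_subfield K \<Longrightarrow> u \<in> unit_group L \<Longrightarrow> u \<in> K \<Longrightarrow> u \<in> unit_group K"
  using subfield.mem_unit_group[of K] by (auto simp: mem_unit_group subfield_def)

lemma rational_unit:
  assumes "u \<in> unit_group L" "u \<in> \<rat>"
  shows "u = 1 \<or> u = -1"
proof -
  have "u \<in> \<int>" "inverse u \<in> \<int>"
    using assms by (auto simp: mem_unit_group intro: rational_algebraic_int_is_int)
  then obtain a b where ab: "u = of_int a" "inverse u = of_int b" by (auto elim!: Ints_cases)
  have "u * inverse u = 1" using assms unitD(2) by simp
  then have "of_int (a * b) = (1 :: complex)" by (simp add: ab(1) flip: ab(2))
  then have "a * b = 1" by (simp only: of_int_eq_1_iff)
  then have "a = 1 \<or> a = -1" by (simp add: zmult_eq_1_iff) auto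
  then show ?thesis using ab by auto
qed

lemma principal_ideal_unit:
  assumes "u \<in> unit_group L"
  shows "principal_ideal (ring_of_integers L) (a * u) = principal_ideal (ring_of_integers L) a"
proof -
  have "a * u * r \<in> principal_ideal (ring_of_integers L) a" if "r \<in> ring_of_integers L" for r
    using unitD[OF assms] that unfolding principal_ideal_def by (intro image_eqI[of _ _ "u * r"]) auto
  moreover have "a * r \<in> principal_ideal (ring_of_integers L) (a * u)" if "r \<in> ring_of_integers L" for r
    using unitD[OF assms] that unfolding principal_ideal_def
    by (intro image_eqI[of _ _ "inverse u * r"]) auto
  ultimately show ?thesis unfolding principal_ideal_def by auto
qed

lemma principal_ideal_eq:
  assumes "principal_ideal (ring_of_integers L) a = principal_ideal (ring_of_integers L) b"
    "b \<noteq> 0"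
  shows "a / b \<in> unit_group L"
proof -
  obtain r where r: "a = b * r" "r \<in> ring_of_integers L"
    using O.principal_ideal_self[of a] assms(1) by (auto simp: principal_ideal_def)
  obtain t where t: "b = a * t" "t \<in> ring_of_integers L"
    using O.principal_ideal_self[of b] assms(1)[symmetric] by (auto simp: principal_ideal_def)
  have "a / b = r" using r assms(2) by simp
  moreover have "b * (r * t) = b * 1" using r t by (metis mult.assoc mult.right_neutral)
  then have "r * t = 1" using assms(2) by (simp only: mult_cancel_left) simp
  ultimately show ?thesis using r(2) t(2) by (auto simp: units_of_ring_def)
qed

end

context hom_on
begin

lemma unit_hom:
  assumes "u \<in> unit_group L"
  shows "\<phi> u \<in> unit_group L"
proof -
  have "algebraic_int (\<phi> (inverse u))"
    using assms by (intro algebraic_int_hom) (auto simp: mem_unit_group)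
  then show ?thesis using assms by (auto simp: mem_unit_group algebraic_int_hom)
qed

lemma integer_hom: "x \<in> ring_of_integers L \<Longrightarrow> \<phi> x \<in> ring_of_integers L"
  by (auto simp: mem_ring_of_integers algebraic_int_hom)

end

section \<open>Extension of ideals to a larger ring, and descent\<close>

context complex_ring
begin

lemma is_ideal_contract:
  assumes "complex_ring R'" "R' \<subseteq> R" "is_ideal R T"
  shows "is_ideal R' (R' \<inter> T)"
proof -
  interpret R': complex_ring R' by fact
  show ?thesis using assms(2,3) by (auto simp: is_ideal_def subset_iff)
qed

lemma ideal_gen_ideal_mult:
  assumes R': "complex_ring R'" "R' \<subseteq> R" and IJ: "is_ideal R' I" "is_ideal R' J"
    and I: "ideal_gen R I = principal_ideal R \<alpha>" and J: "ideal_gen R J = principal_ideal R \<beta>"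
  shows "ideal_gen R (ideal_mult R' I J) = principal_ideal R (\<alpha> * \<beta>)"
proof
  interpret R': complex_ring R' by fact
  have sub: "I \<subseteq> R" "J \<subseteq> R" using IJ R'(2) by (auto simp: is_ideal_def)
  have "\<alpha> \<in> ideal_gen R I" "\<beta> \<in> ideal_gen R J" using I J principal_ideal_self by auto
  then have ab: "\<alpha> \<in> R" "\<beta> \<in> R"
    using ideal_subset[OF is_ideal_gen[OF sub(1)]] ideal_subset[OF is_ideal_gen[OF sub(2)]] by auto
  have P: "is_ideal R (principal_ideal R (\<alpha> * \<beta>))"
    using ab by (intro is_ideal_principal) simp
  have IJR: "ideal_mult R' I J \<subseteq> R"
    using R'.ideal_subset[OF R'.is_ideal_mult[OF IJ]] R'(2) by auto
  let ?E = "ideal_gen R (ideal_mult R' I J)"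
  have E: "is_ideal R ?E" by (rule is_ideal_gen[OF IJR])
  have "x * y \<in> principal_ideal R (\<alpha> * \<beta>)" if xy: "x \<in> I" "y \<in> J" for x y
  proof -
    have "x \<in> principal_ideal R \<alpha>" "y \<in> principal_ideal R \<beta>"
      using xy I J ideal_gen_superset by blast+
    then obtain r t where rt: "r \<in> R" "t \<in> R" "x = \<alpha> * r" "y = \<beta> * t"
      by (auto simp: principal_ideal_def)
    then have "x * y = \<alpha> * \<beta> * (r * t)" by simp
    then show ?thesis unfolding principal_ideal_def using rt(1,2) by (intro image_eqI[of _ _ "r * t"]) auto
  qed
  then have "ideal_mult R' I J \<subseteq> R' \<inter> principal_ideal R (\<alpha> * \<beta>)"
    unfolding R'.ideal_mult_subset_iff[OF is_ideal_contract[OF R' P]]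
    using R'.ideal_in[OF IJ(1)] R'.ideal_in[OF IJ(2)] by auto
  then show "?E \<subseteq> principal_ideal R (\<alpha> * \<beta>)"
    unfolding ideal_gen_subset_iff[OF P] by auto
  \<comment> \<open>Two passes through colon ideals: with \<open>x\<close> in \<open>I\<close>
    fixed, pass from \<open>J\<close> to its extension and so reach \<open>\<beta>\<close>; then,
    with \<open>\<beta>\<close> fixed, pass from \<open>I\<close> to its extension.\<close>
  have "J \<subseteq> {z \<in> R. x * z \<in> ?E}" if "x \<in> I" for x
    using that sub R'.ideal_multI ideal_gen_superset by blast
  then have "ideal_gen R J \<subseteq> {z \<in> R. x * z \<in> ?E}" if "x \<in> I" for x
    using that sub is_ideal_colon[OF E, of x] by (subst ideal_gen_subset_iff) auto
  then have "I \<subseteq> {z \<in> R. \<beta> * z \<in> ?E}"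
    using sub \<open>\<beta> \<in> ideal_gen R J\<close> by (auto simp: mult.commute subset_iff)
  then have "ideal_gen R I \<subseteq> {z \<in> R. \<beta> * z \<in> ?E}"
    using ab is_ideal_colon[OF E, of \<beta>] by (subst ideal_gen_subset_iff) auto
  then have "\<alpha> * \<beta> \<in> ?E"
    using \<open>\<alpha> \<in> ideal_gen R I\<close> by (auto simp: mult.commute)
  then show "principal_ideal R (\<alpha> * \<beta>) \<subseteq> ?E"
    by (simp add: principal_ideal_subset[OF E])
qed

end

locale subfield_pair = L: subfield L + k: subfield k for L k +
  assumes k_subset: "k \<subseteq> L"
begin

abbreviation "S \<equiv> ring_of_integers L"
abbreviation "R \<equiv> ring_of_integers k"

lemma R_subset_S: "R \<subseteq> S"
  using k_subset by (auto simp: ring_of_integers_def)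

text \<open>\<open>y\<close> acts as a square root of \<open>c\<close>. For \<open>x\<close> in
  \<open>J\<close> the square of \<open>x / y\<close> is integral, hence so is \<open>x / y\<close>.
  Conversely J J lies in \<open>y\<close> times the extension of \<open>J\<close>, so
  \<open>c\<close> does too, and cancelling \<open>y\<close> puts \<open>y\<close> itself into the
  extension.\<close>

lemma ideal_gen_sqrt:
  assumes J: "is_ideal R J" "ideal_mult R J J = principal_ideal R c"
    and c: "c \<noteq> 0" "c \<in> R" and y: "y \<in> L" "y ^ 2 / c \<in> unit_group L"
  shows "ideal_gen S J = principal_ideal S y"
proof
  define \<eta> where "\<eta> = y ^ 2 / c"
  have \<eta>: "\<eta> \<in> unit_group L" "y ^ 2 = c * \<eta>" using y c by (auto simp: \<eta>_def)
  have "algebraic_int (y ^ 2)"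
    using \<eta> L.unitD(3)[OF \<eta>(1)] c by (auto simp: k.mem_ring_of_integers intro: algebraic_int_mult)
  then have "algebraic_int y" by (rule algebraic_int_of_power) simp
  then have yS: "y \<in> S" using y by (simp add: L.mem_ring_of_integers)
  have y0: "y \<noteq> 0" using \<eta> c L.unitD(2)[OF \<eta>(1)] by auto
  have JS: "J \<subseteq> S" using J(1) R_subset_S by (auto simp: is_ideal_def)
  have "x \<in> principal_ideal S y" if "x \<in> J" for x
  proof -
    have "x * x \<in> principal_ideal R c" using k.O.ideal_multI[OF that that] J(2) by simp
    then obtain r where r: "r \<in> R" "x * x = c * r" by (auto simp: principal_ideal_def)
    have "(x / y) ^ 2 = r * inverse \<eta>"
      using r \<eta> c y0 L.unitD(2)[OF \<eta>(1)] by (simp add: power_divide power2_eq_square field_simps)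
    then have "algebraic_int ((x / y) ^ 2)"
      using L.unitD(4)[OF \<eta>(1)] r by (auto simp: k.mem_ring_of_integers intro: algebraic_int_mult)
    then have "algebraic_int (x / y)" by (rule algebraic_int_of_power) simp
    moreover have "x / y \<in> L" using that JS y by (auto simp: L.mem_ring_of_integers)
    ultimately show ?thesis unfolding principal_ideal_def
      using y0 by (intro image_eqI[of _ _ "x / y"]) (auto simp: L.mem_ring_of_integers)
  qed
  then have J_sub: "J \<subseteq> principal_ideal S y" by auto
  then show "ideal_gen S J \<subseteq> principal_ideal S y"
    by (subst L.O.ideal_gen_subset_iff[OF L.O.is_ideal_principal[OF yS]])
  have E: "is_ideal S (ideal_gen S J)" by (rule L.O.is_ideal_gen[OF JS])
  have T: "is_ideal S ((\<lambda>x. y * x) ` ideal_gen S J)"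
    using E yS by (rule L.O.is_ideal_scale[rotated])
  have "x * x' \<in> (\<lambda>x. y * x) ` ideal_gen S J" if xx: "x \<in> J" "x' \<in> J" for x x'
  proof -
    obtain s where s: "s \<in> S" "x = y * s"
      using J_sub xx by (auto simp: principal_ideal_def)
    have "s * x' \<in> ideal_gen S J"
      using E s xx L.O.ideal_gen_superset[of J] by (auto simp: is_ideal_def)
    then show ?thesis using s by (intro image_eqI[of _ _ "s * x'"]) auto
  qed
  then have "ideal_mult R J J \<subseteq> R \<inter> (\<lambda>x. y * x) ` ideal_gen S J"
    using k.O.ideal_mult_subset_iff[OF L.O.is_ideal_contract[OF k.O.complex_ring_axioms R_subset_S T]]
      k.O.ideal_in[OF J(1)] by auto
  then have "c \<in> (\<lambda>x. y * x) ` ideal_gen S J"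
    using k.O.principal_ideal_self[of c] J(2) by auto
  then obtain z where z: "z \<in> ideal_gen S J" "c = y * z" by auto
  have "y * y = y * (\<eta> * z)" using z \<eta> by (simp add: power2_eq_square mult_ac)
  then have "y = \<eta> * z" using y0 by simp
  then have "y \<in> ideal_gen S J"
    using z E L.unitD(5)[OF \<eta>(1)] by (auto simp: is_ideal_def)
  then show "principal_ideal S y \<subseteq> ideal_gen S J"
    by (simp add: L.O.principal_ideal_subset[OF E])
qed

end

locale quadratic_pair = subfield_pair L k + hom_on L \<sigma> for L k \<sigma> +
  assumes fixed_iff: "x \<in> L \<Longrightarrow> \<sigma> x = x \<longleftrightarrow> x \<in> k"
    and involution: "x \<in> L \<Longrightarrow> \<sigma> (\<sigma> x) = x"
begin

lemma norm_in_k: "x \<in> L \<Longrightarrow> x * \<sigma> x \<in> k" and trace_in_k: "x \<in> L \<Longrightarrow> x + \<sigma> x \<in> k"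
  using fixed_iff[of "x * \<sigma> x"] fixed_iff[of "x + \<sigma> x"] involution by (auto simp: algebra_simps)

lemma norm_in_R: "x \<in> S \<Longrightarrow> x * \<sigma> x \<in> R"
  using norm_in_k[of x] algebraic_int_hom[of x]
  by (auto simp: L.mem_ring_of_integers k.mem_ring_of_integers intro: algebraic_int_mult)

lemma trace_in_R: "x \<in> S \<Longrightarrow> x + \<sigma> x \<in> R"
  using trace_in_k[of x] algebraic_int_hom[of x]
  by (auto simp: L.mem_ring_of_integers k.mem_ring_of_integers intro: algebraic_int_add)

text \<open>The elements of \<open>\<beta>S\<close> whose norm and whose traces against \<open>S\<close> stay in the appropriate
  multiples of \<open>I\<close> form an ideal containing \<open>I\<close>, hence contain \<open>\<beta>\<close>; no factorisation theory of
  ideals is needed.\<close>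
lemma ideal_gen_principal_descend:
  assumes I: "is_ideal R I" "ideal_gen S I = principal_ideal S \<beta>" and \<beta>: "\<beta> \<in> k" "\<beta> \<noteq> 0"
  shows "I = principal_ideal R \<beta>"
proof
  have IS: "I \<subseteq> S" using I(1) R_subset_S by (auto simp: is_ideal_def)
  have E: "is_ideal S (ideal_gen S I)" by (rule L.O.is_ideal_gen[OF IS])
  have "\<beta> \<in> S" using I(2) L.O.principal_ideal_self[of \<beta>] E by (auto simp: is_ideal_def)
  then have \<beta>R: "\<beta> \<in> R" "algebraic_int \<beta>" "\<beta> \<in> L" and \<sigma>\<beta>: "\<sigma> \<beta> = \<beta>"
    using \<beta> k_subset fixed_iff by (auto simp: L.mem_ring_of_integers k.mem_ring_of_integers)
  have quot: "x / \<beta> \<in> R" if "x \<in> I" for x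
  proof -
    have "x \<in> principal_ideal S \<beta>" using that I(2) L.O.ideal_gen_superset[of I] by auto
    then obtain s where "s \<in> S" "x = \<beta> * s" by (auto simp: principal_ideal_def)
    then have "algebraic_int (x / \<beta>)" using \<beta> by (auto simp: L.mem_ring_of_integers)
    moreover have "x / \<beta> \<in> k" using that I(1) \<beta> by (auto simp: is_ideal_def k.mem_ring_of_integers subset_iff)
    ultimately show ?thesis by (simp add: k.mem_ring_of_integers)
  qed
  then show "I \<subseteq> principal_ideal R \<beta>"
    unfolding principal_ideal_def using \<beta> by (auto intro!: image_eqI[of _ _ "_ / \<beta>"])
  define J where "J = {x \<in> S. x / \<beta> \<in> S \<and> x * \<sigma> x / \<beta> \<in> I \<and> (\<forall>s\<in>S. x * \<sigma> s + \<sigma> x * s \<in> I)}"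
  have Iadd: "x + y \<in> I" if "x \<in> I" "y \<in> I" for x y using that I(1) by (auto simp: is_ideal_def)
  have Imult: "r * x \<in> I" if "r \<in> R" "x \<in> I" for r x using that I(1) by (auto simp: is_ideal_def)
  have SL: "x \<in> L" if "x \<in> S" for x using that by (simp add: L.mem_ring_of_integers)
  have "is_ideal S J"
    unfolding is_ideal_def
  proof (intro conjI ballI)
    show "J \<subseteq> S" by (auto simp: J_def)
    show "0 \<in> J" using I(1) by (auto simp: J_def is_ideal_def)
  next
    fix x y assume x: "x \<in> J" and y: "y \<in> J"
    have xy: "x \<in> S" "y \<in> S" "x \<in> L" "y \<in> L" using x y SL by (auto simp: J_def)
    \<comment> \<open>The trace condition at s = y/beta is the cross term in the norm of x + y,
      divided by beta. This is why membership also demands that quotients by beta be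
      integral.\<close>
    have "x * \<sigma> (y / \<beta>) + \<sigma> x * (y / \<beta>) \<in> I" using x y by (auto simp: J_def)
    then have "(x * \<sigma> y + \<sigma> x * y) / \<beta> \<in> I"
      using xy \<beta>R \<sigma>\<beta> by (simp add: add_divide_distrib)
    moreover have "x * \<sigma> x / \<beta> \<in> I" "y * \<sigma> y / \<beta> \<in> I" using x y by (auto simp: J_def)
    ultimately have "x * \<sigma> x / \<beta> + y * \<sigma> y / \<beta> + (x * \<sigma> y + \<sigma> x * y) / \<beta> \<in> I"
      by (intro Iadd)
    moreover have "(x + y) * \<sigma> (x + y) / \<beta> =
        x * \<sigma> x / \<beta> + y * \<sigma> y / \<beta> + (x * \<sigma> y + \<sigma> x * y) / \<beta>"
      using xy by (simp add: algebra_simps add_divide_distrib)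
    moreover have "(x + y) * \<sigma> s + \<sigma> (x + y) * s = (x * \<sigma> s + \<sigma> x * s) + (y * \<sigma> s + \<sigma> y * s)" for s
      using xy by (simp add: algebra_simps)
    moreover have "(x + y) / \<beta> \<in> S" using x y by (simp add: J_def add_divide_distrib)
    ultimately show "x + y \<in> J"
      unfolding J_def using x y xy Iadd by (simp add: J_def)
  next
    fix r x assume r: "r \<in> S" and x: "x \<in> J"
    have rx: "r \<in> L" "x \<in> S" "x \<in> L" using r x SL by (auto simp: J_def)
    have "(r * \<sigma> r) * (x * \<sigma> x / \<beta>) \<in> I"
      using x norm_in_R[OF r] by (intro Imult) (auto simp: J_def)
    then have 1: "r * x * \<sigma> (r * x) / \<beta> \<in> I" using rx by (simp add: mult_ac)
    have 2: "r * x / \<beta> \<in> S" using r x L.O.ring_mult[of r "x / \<beta>"] by (simp add: J_def)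
    have "r * x * \<sigma> s + \<sigma> (r * x) * s \<in> I" if s: "s \<in> S" for s
    proof -
      \<comment> \<open>The trace of \<open>r x\<close> against \<open>s\<close> is the trace of
        \<open>x\<close> against \<open>\<sigma> r * s\<close>.\<close>
      have "x * \<sigma> (\<sigma> r * s) + \<sigma> x * (\<sigma> r * s) \<in> I"
        using x s integer_hom[OF r] by (auto simp: J_def)
      then show ?thesis using rx s SL[OF s] involution[of r] by (simp add: mult_ac)
    qed
    with 1 2 r rx show "r * x \<in> J" by (simp add: J_def)
  qed
  moreover have "I \<subseteq> J"
  proof
    fix x assume x: "x \<in> I"
    then have xk: "x \<in> R" "x \<in> S" "x \<in> k" "x \<in> L" "\<sigma> x = x" using I(1) R_subset_S k_subset fixed_iff
      by (auto simp: is_ideal_def k.mem_ring_of_integers subset_iff)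
    have "(s + \<sigma> s) * x \<in> I" if "s \<in> S" for s using trace_in_R[OF that] x by (intro Imult)
    moreover have "x / \<beta> * x \<in> I" using quot[OF x] x by (rule Imult)
    ultimately show "x \<in> J" using xk quot[OF x] R_subset_S by (auto simp: J_def algebra_simps)
  qed
  ultimately have "ideal_gen S I \<subseteq> J" by (simp add: L.O.ideal_gen_subset_iff)
  then have "\<beta> \<in> J" using I(2) L.O.principal_ideal_self[of \<beta>] by auto
  \<comment> \<open>At x = beta the norm condition reads beta^2 / beta in \<open>I\<close>.\<close>
  then have "\<beta> \<in> I" using \<sigma>\<beta> \<beta> by (auto simp: J_def)
  then show "principal_ideal R \<beta> \<subseteq> I" by (simp add: k.O.principal_ideal_subset[OF I(1)])
qed

end

section \<open>Real quadratic fields\<close>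

lemma squarefree_dvd:
  fixes r m :: int
  assumes "squarefree r" "m \<noteq> 0" "\<And>p. prime p \<Longrightarrow> p dvd r \<Longrightarrow> p dvd m"
  shows "r dvd m"
proof (rule multiplicity_le_imp_dvd)
  fix p :: int assume p: "prime p"
  show "multiplicity p r \<le> multiplicity p m"
  proof (cases "p dvd r")
    case True
    then have "multiplicity p r \<le> 1"
      using assms(1) p by (metis One_nat_def not_squarefree_0 squarefree_factorial_semiring'')
    moreover have "multiplicity p m \<ge> 1"
      using True p assms prime_multiplicity_gt_zero_iff[OF prime_imp_prime_elem[OF p], of m] by (simp add: Suc_le_eq)
    ultimately show ?thesis by simp
  qed (simp add: not_dvd_imp_multiplicity_0)
qed (use assms in auto)

lemma squarefree_dvd_square:
  fixes r x :: int
  assumes "squarefree r" "r dvd x\<^sup>2"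
  shows "r dvd x"
proof (cases "x = 0")
  case False
  show ?thesis
  proof (rule squarefree_dvd[OF assms(1) False])
    fix p :: int assume "prime p" "p dvd r"
    then show "p dvd x" using assms(2) by (meson dvd_trans prime_dvd_power)
  qed
qed simp

text \<open>The squared denominator would divide \<open>m\<close>.\<close>

lemma rational_square_times_squarefree:
  fixes z :: complex and m :: int
  assumes "z \<in> \<rat>" "squarefree m" "z\<^sup>2 * of_int m \<in> \<int>"
  shows "z \<in> \<int>"
proof -
  obtain a b where ab: "b > 0" "coprime a b" "z = of_int a / of_int b"
    using assms(1) by (rule Rats_cases')
  obtain n where n: "z\<^sup>2 * of_int m = of_int n" using assms(3) by (auto elim: Ints_cases)
  have "of_int (a\<^sup>2 * m) = (of_int (n * b\<^sup>2) :: complex)"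
    using n ab by (simp add: power_divide field_simps)
  then have "a\<^sup>2 * m = n * b\<^sup>2" by (simp only: of_int_eq_iff)
  then have "b\<^sup>2 dvd a\<^sup>2 * m" by simp
  moreover have "coprime (b\<^sup>2) (a\<^sup>2)" using ab(2) by (simp add: coprime_commute)
  ultimately have "b\<^sup>2 dvd m" by (simp add: coprime_dvd_mult_right_iff)
  then have "b dvd 1" using assms(2) squarefreeD by blast
  then show ?thesis using ab by auto
qed

text \<open>Good rational approximations to the root give infinitely many pairs of bounded norm; two
  of them that agree in norm and in residues modulo that norm have a quotient with integral
  coordinates and norm one.\<close>

lemma Pell_exists:
  fixes m :: int
  assumes m: "m > 0" "sqrt (real_of_int m) \<notin> \<rat>"
  shows "\<exists>x y. x\<^sup>2 - m * y\<^sup>2 = 1 \<and> y \<noteq> 0"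
proof -
  define \<theta> where "\<theta> = sqrt (real_of_int m)"
  have \<theta>: "\<theta> > 0" "\<theta> * \<theta> = real_of_int m" "\<theta> \<notin> \<rat>" using m by (auto simp: \<theta>_def)
  have irr: "of_int k * \<theta> \<noteq> of_int h" if "k \<noteq> 0" for h k
  proof
    assume "of_int k * \<theta> = of_int h"
    then have "\<theta> = of_int h / of_int k" using that by (simp add: field_simps)
    then show False using \<theta>(3) by simp
  qed
  \<comment> \<open>If |k theta - h| < 1/N and k <= N, then |k theta + h| <= 2 k theta + 1, and the
    product of the two factors is at most 2 theta + 1.\<close>
  define C where "C = \<lceil>2 * \<theta> + 1\<rceil>"
  define P where "P = {(h, k). k > 0 \<and> \<bar>h\<^sup>2 - m * k\<^sup>2\<bar> \<le> C}"
  have step: "\<exists>h k. (h, k) \<in> P \<and> \<bar>of_int k * \<theta> - of_int h\<bar> < 1 / real N" if N: "N > 0" for N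
  proof -
    obtain h k where hk: "0 < k" "k \<le> int N" "\<bar>of_int k * \<theta> - of_int h\<bar> < 1 / real N"
      using Dirichlet_approx[OF N, of \<theta>] by metis
    have N1: "1 / real N \<le> 1" using N by simp
    define a where "a = real_of_int k * \<theta>"
    have "a > 0" using hk(1) \<theta>(1) by (simp add: a_def)
    moreover have "\<bar>a - of_int h\<bar> < 1" using hk(3) N1 by (simp add: a_def)
    ultimately have "\<bar>a + of_int h\<bar> \<le> 2 * a + 1" by linarith
    then have h: "\<bar>of_int k * \<theta> + of_int h\<bar> \<le> 2 * (of_int k * \<theta>) + 1" by (simp add: a_def)
    have "real_of_int (h\<^sup>2 - m * k\<^sup>2) = - ((of_int k * \<theta> - of_int h) * (of_int k * \<theta> + of_int h))"
      using \<theta>(2) by (simp add: algebra_simps power2_eq_square)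
    then have eq: "\<bar>real_of_int (h\<^sup>2 - m * k\<^sup>2)\<bar> = \<bar>of_int k * \<theta> - of_int h\<bar> * \<bar>of_int k * \<theta> + of_int h\<bar>"
      by (simp only: abs_minus_cancel abs_mult)
    note eq
    also have "\<dots> \<le> (1 / real N) * (2 * (of_int k * \<theta>) + 1)"
      using hk(3) h by (intro mult_mono) auto
    also have "\<dots> = 2 * \<theta> * (of_int k / real N) + 1 / real N"
      by (simp add: distrib_left mult_ac)
    also have "\<dots> \<le> 2 * \<theta> * 1 + 1"
      using hk(2) N N1 \<theta>(1) by (intro add_mono mult_left_mono) (auto simp: divide_le_eq_1)
    also have "\<dots> \<le> of_int C" by (simp add: C_def)
    finally have "\<bar>h\<^sup>2 - m * k\<^sup>2\<bar> \<le> C" by linarith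
    then show ?thesis using hk by (auto simp: P_def)
  qed
  have inf: "infinite P"
  proof
    assume fin: "finite P"
    have "P \<noteq> {}" using step[of 1] by auto
    define \<delta> where "\<delta> = Min ((\<lambda>(h, k). \<bar>of_int k * \<theta> - of_int h\<bar>) ` P)"
    have "\<delta> \<in> (\<lambda>(h, k). \<bar>of_int k * \<theta> - of_int h\<bar>) ` P"
      unfolding \<delta>_def using fin \<open>P \<noteq> {}\<close> by (intro Min_in) auto
    then have "\<delta> > 0" using irr by (force simp: P_def)
    then obtain N where N: "N > 0" "1 / real N < \<delta>"
      by (metis inverse_eq_divide reals_Archimedean of_nat_0_less_iff zero_less_Suc)
    obtain h k where hk: "(h, k) \<in> P" "\<bar>of_int k * \<theta> - of_int h\<bar> < 1 / real N"
      using step[OF N(1)] by auto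
    have "\<delta> \<le> \<bar>of_int k * \<theta> - of_int h\<bar>"
      unfolding \<delta>_def using fin hk(1) by (intro Min_le) (auto intro!: image_eqI[of _ _ "(h, k)"])
    then show False using hk(2) N by simp
  qed
  define g where "g = (\<lambda>(h, k). (h\<^sup>2 - m * k\<^sup>2, h mod (h\<^sup>2 - m * k\<^sup>2), k mod (h\<^sup>2 - m * k\<^sup>2)))"
  have n0: "h\<^sup>2 - m * k\<^sup>2 \<noteq> 0" if "k > 0" for h k
  proof
    assume "h\<^sup>2 - m * k\<^sup>2 = 0"
    then have "real_of_int (h\<^sup>2) = real_of_int (m * k\<^sup>2)" by simp
    then have "(of_int k * \<theta>)\<^sup>2 = (of_int h)\<^sup>2"
      using \<theta>(2) by (simp add: power2_eq_square algebra_simps)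
    then have "of_int k * \<theta> = of_int h \<or> of_int k * \<theta> = of_int (- h)" by (simp add: power2_eq_iff)
    then show False using irr[of k] that by blast
  qed
  have "g ` P \<subseteq> {-C..C} \<times> {-C..C} \<times> {-C..C}"
  proof -
    have "- C \<le> h mod n \<and> h mod n \<le> C" if "\<bar>n\<bar> \<le> C" "n \<noteq> 0" for h n :: int
      using that abs_mod_less[of n h] by linarith
    then have "g (h, k) \<in> {-C..C} \<times> {-C..C} \<times> {-C..C}" if "(h, k) \<in> P" for h k
      using that n0[of k h] unfolding g_def P_def by (simp add: abs_le_iff minus_le_iff)
    then show ?thesis by (intro image_subsetI) (metis surj_pair)
  qed
  then have "finite (g ` P)" by (rule finite_subset) auto
  from pigeonhole_infinite[OF inf this]
  obtain p where p: "p \<in> P" "infinite {q \<in> P. g q = g p}" by blast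
  then have "infinite ({q \<in> P. g q = g p} - {p})" by simp
  from infinite_imp_nonempty[OF this] obtain q where q: "q \<in> P" "g q = g p" "q \<noteq> p" by blast
  obtain h1 k1 h2 k2 where pq: "p = (h1, k1)" "q = (h2, k2)" by (metis surj_pair)
  define n where "n = h1\<^sup>2 - m * k1\<^sup>2"
  have eqs: "k1 > 0" "k2 > 0" "n \<noteq> 0" "h2\<^sup>2 - m * k2\<^sup>2 = n" "h2 mod n = h1 mod n" "k2 mod n = k1 mod n"
    using p q n0 unfolding pq by (auto simp: g_def P_def n_def)
  have c: "[h2 = h1] (mod n)" "[k2 = k1] (mod n)" using eqs(5,6) by (simp_all only: unique_euclidean_semiring_class.cong_def)
  \<comment> \<open>The coordinates of (h1 + k1 theta)(h2 - k2 theta), up to the sign of the second,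
    are divisible by \<open>n\<close> because the two pairs agree modulo \<open>n\<close>;
    \<open>x\<close> and \<open>y\<close> are the quotients.\<close>
  have "[h1 * h2 - m * k1 * k2 = h1 * h1 - m * k1 * k1] (mod n)"
    by (intro cong_diff cong_mult c cong_refl)
  moreover have "h1 * h1 - m * k1 * k1 = n" by (simp add: n_def power2_eq_square)
  ultimately have "n dvd h1 * h2 - m * k1 * k2" by (simp add: cong_dvd_iff)
  then obtain x where x: "h1 * h2 - m * k1 * k2 = n * x" by (elim dvdE)
  have "[h1 * k2 - h2 * k1 = h1 * k1 - h1 * k1] (mod n)"
    by (intro cong_diff cong_mult c cong_refl)
  then have "n dvd h1 * k2 - h2 * k1" by (simp add: cong_0_iff)
  then obtain y where y: "h1 * k2 - h2 * k1 = n * y" by (elim dvdE)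
  have "n\<^sup>2 * (x\<^sup>2 - m * y\<^sup>2) = (n * x)\<^sup>2 - m * (n * y)\<^sup>2" by (simp add: algebra_simps)
  also have "\<dots> = (h1\<^sup>2 - m * k1\<^sup>2) * (h2\<^sup>2 - m * k2\<^sup>2)"
    unfolding x[symmetric] y[symmetric] by (simp add: algebra_simps power2_eq_square)
  also have "\<dots> = n\<^sup>2 * 1" using eqs by (simp add: n_def power2_eq_square)
  finally have 1: "x\<^sup>2 - m * y\<^sup>2 = 1" using eqs(3) by (simp only: mult_cancel_left) simp
  \<comment> \<open>If \<open>y\<close> vanished, the two pairs would be proportional with equal
    norms and positive \<open>k\<close>, hence equal.\<close>
  have "y \<noteq> 0"
  proof
    assume "y = 0"
    then have e: "h1 * k2 = h2 * k1" using y by simp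
    have "n * k2\<^sup>2 = (h1 * k2)\<^sup>2 - m * (k1 * k2)\<^sup>2" by (simp add: n_def algebra_simps power2_eq_square)
    also have "\<dots> = n * k1\<^sup>2" unfolding e eqs(4)[symmetric] by (simp add: algebra_simps power2_eq_square)
    finally have "k2\<^sup>2 = k1\<^sup>2" using eqs(3) by simp
    then have "k2 = k1" using eqs(1,2) by (simp add: power2_eq_iff)
    with e eqs have "h1 = h2" by simp
    then show False using q(3) pq \<open>k2 = k1\<close> by simp
  qed
  with 1 show ?thesis by blast
qed

section \<open>Integers and units of a real quadratic field\<close>

definition csqrt_int :: "int \<Rightarrow> complex" where
  "csqrt_int m = complex_of_real (sqrt (real_of_int m))"

lemma csqrt_int_square: "m \<ge> 0 \<Longrightarrow> csqrt_int m * csqrt_int m = of_int m"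
  by (simp add: csqrt_int_def flip: of_real_mult)

lemma csqrt_int_mult: "csqrt_int (a * b) = csqrt_int a * csqrt_int b"
  by (simp add: csqrt_int_def real_sqrt_mult)

lemma csqrt_int_Reals [simp]: "csqrt_int m \<in> \<real>"
  by (simp add: csqrt_int_def)

lemma cnj_csqrt_int [simp]: "cnj (csqrt_int m) = csqrt_int m"
  by (simp add: csqrt_int_def)

lemma csqrt_int_nonzero [simp]: "m > 0 \<Longrightarrow> csqrt_int m \<noteq> 0"
  by (simp add: csqrt_int_def)

lemma algebraic_int_csqrt_int: "algebraic_int (csqrt_int m)"
  unfolding csqrt_int_def by (intro algebraic_int_of_real algebraic_int_sqrt) simp

lemma csqrt_int_irrational:
  assumes "m > 1" "squarefree m"
  shows "csqrt_int m \<notin> \<rat>"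
proof
  assume "csqrt_int m \<in> \<rat>"
  then obtain n where n: "csqrt_int m = of_int n"
    using rational_algebraic_int_is_int[OF algebraic_int_csqrt_int] by (auto elim: Ints_cases)
  have "of_int (n\<^sup>2) = (of_int m :: complex)"
    using csqrt_int_square[of m] assms n by (simp add: power2_eq_square)
  then have "n\<^sup>2 = m" by (simp only: of_int_eq_iff)
  then have "n dvd 1" using assms(2) squarefreeD[of m n] by simp
  then have "\<bar>n\<bar> = 1" by simp
  then have "n\<^sup>2 = 1" by (metis one_power2 power2_abs)
  then show False using \<open>n\<^sup>2 = m\<close> assms by simp
qed

locale real_quadratic =
  fixes m :: int
  assumes m_gt_1: "m > 1" and squarefree_m: "squarefree m"
begin

abbreviation "rt \<equiv> csqrt_int m"
abbreviation "F \<equiv> field_gen {csqrt_int m}"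
abbreviation "\<tau> \<equiv> qconj \<rat> (csqrt_int m)"

lemma rt_square: "rt * rt = of_int m"
  using m_gt_1 by (simp add: csqrt_int_square)

sublocale Q: quad_ext \<rat> rt
  by unfold_locales
    (use is_subfield_Rats csqrt_int_irrational[OF m_gt_1 squarefree_m] rt_square in auto)

lemma rt_square_left: "rt * (rt * c) = of_int m * c"
  using rt_square by (simp flip: mult.assoc)

lemma F_eq: "F = qext \<rat> rt"
  using Q.field_gen_insert[of "{}"] field_gen_empty by simp

sublocale hom_on F \<tau>
  unfolding F_eq by (rule Q.hom_on_qconj)

lemma F_E:
  assumes "z \<in> F"
  obtains x y where "x \<in> \<rat>" "y \<in> \<rat>" "z = x + y * rt"
  using assms unfolding F_eq by (rule Q.qextE)

lemma rt_F: "rt \<in> F"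
  using field_gen_superset[of "{rt}"] by simp

lemma F_Reals: "z \<in> F \<Longrightarrow> z \<in> \<real>"
  using subfield.Rats[OF subfield.intro[OF is_subfield_Reals]] by (elim F_E) auto

lemma \<tau>_eq: "x \<in> \<rat> \<Longrightarrow> y \<in> \<rat> \<Longrightarrow> \<tau> (x + y * rt) = x - y * rt"
  by (rule Q.qconj_eq)

lemma \<tau>_\<tau>: "z \<in> F \<Longrightarrow> \<tau> (\<tau> z) = z"
  unfolding F_eq by (rule Q.qconj_qconj)

lemma \<tau>_fixed: "z \<in> F \<Longrightarrow> \<tau> z = z \<Longrightarrow> z \<in> \<rat>"
  unfolding F_eq by (rule Q.qconj_fixed)

lemma trace_int: "y \<in> ring_of_integers F \<Longrightarrow> y + \<tau> y \<in> \<int>"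
  by (rule rational_algebraic_int_is_int)
    (use \<tau>_fixed[of "y + \<tau> y"] \<tau>_\<tau>[of y] in
      \<open>simp_all add: mem_ring_of_integers algebraic_int_add algebraic_int_hom add.commute\<close>)

lemma norm_int: "y \<in> ring_of_integers F \<Longrightarrow> y * \<tau> y \<in> \<int>"
  by (rule rational_algebraic_int_is_int)
    (use \<tau>_fixed[of "y * \<tau> y"] \<tau>_\<tau>[of y] in
      \<open>simp_all add: mem_ring_of_integers algebraic_int_mult algebraic_int_hom mult.commute\<close>)

lemma norm_unit:
  assumes "u \<in> unit_group F"
  shows "u * \<tau> u = 1 \<or> u * \<tau> u = -1"
proof (rule rational_unit)
  show "u * \<tau> u \<in> unit_group F" using assms by (intro unit_mult unit_hom)
  show "u * \<tau> u \<in> \<rat>" using norm_int[OF unitD(5)[OF assms]] Ints_subset_Rats by blast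
qed

text \<open>Trace and norm are rational integers, which makes the first doubled coordinate integral;
  for the second, \<open>m\<close> times its square is an integer and \<open>m\<close> is
  squarefree.\<close>

lemma integer_form:
  assumes "y \<in> ring_of_integers F"
  obtains s z n where "y = (of_int s + of_int z * rt) / 2" "s\<^sup>2 - m * z\<^sup>2 = 4 * n"
    "y * \<tau> y = of_int n" "y + \<tau> y = of_int s"
proof -
  have yF: "y \<in> F" using assms by (simp add: mem_ring_of_integers)
  obtain a b where ab: "a \<in> \<rat>" "b \<in> \<rat>" "y = a + b * rt" using F_E[OF yF] .
  obtain s where s: "y + \<tau> y = of_int s" using trace_int[OF assms] by (auto elim: Ints_cases)
  obtain n where n: "y * \<tau> y = of_int n" using norm_int[OF assms] by (auto elim: Ints_cases)
  have \<tau>y: "\<tau> y = a - b * rt" using ab \<tau>_eq by simp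
  have a: "a = of_int s / 2" using s ab \<tau>y by (simp add: mult.commute)
  have "(2 * b)\<^sup>2 * of_int m = (of_int s)\<^sup>2 - 4 * of_int n"
    unfolding n[symmetric] s[symmetric] unfolding \<tau>y unfolding ab(3) rt_square[symmetric]
    by (simp add: algebra_simps power2_eq_square)
  also have "\<dots> = of_int (s\<^sup>2 - 4 * n)" by simp
  finally have eq: "(2 * b)\<^sup>2 * of_int m = (of_int (s\<^sup>2 - 4 * n) :: complex)" .
  have "2 * b \<in> \<int>"
    by (rule rational_square_times_squarefree[OF _ squarefree_m]) (use ab(2) eq in auto)
  then obtain z where z: "2 * b = of_int z" by (auto elim: Ints_cases)
  then have "of_int (z\<^sup>2 * m) = (of_int (s\<^sup>2 - 4 * n) :: complex)" using eq by simp
  then have "z\<^sup>2 * m = s\<^sup>2 - 4 * n" by (simp only: of_int_eq_iff)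
  moreover have "y = (of_int s + of_int z * rt) / 2"
    unfolding z[symmetric] ab(3) a by (simp add: field_simps)
  ultimately show thesis using that[of s z n] n s by (simp add: mult.commute)
qed

text \<open>A squarefree even \<open>m\<close> is 2 modulo 4, so s^2 - m z^2 = 4 n forces first
  \<open>s\<close> and then \<open>z\<close> to be even.\<close>

lemma integer_form_even:
  assumes "y \<in> ring_of_integers F" "even m"
  obtains x z n where "y = of_int x + of_int z * rt" "x\<^sup>2 - m * z\<^sup>2 = n"
    "y * \<tau> y = of_int n" "y + \<tau> y = of_int (2 * x)"
proof -
  obtain s z n where szn: "y = (of_int s + of_int z * rt) / 2" "s\<^sup>2 - m * z\<^sup>2 = 4 * n"
    "y * \<tau> y = of_int n" "y + \<tau> y = of_int s" using integer_form[OF assms(1)] .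
  have "s\<^sup>2 = m * z\<^sup>2 + 4 * n" using szn(2) by simp
  then have "even (s\<^sup>2)" using assms(2) by simp
  then obtain x where x: "s = 2 * x" by (auto elim: evenE)
  have m4: "\<not> 4 dvd m"
    using squarefree_m squarefreeD[of m 2] by auto
  have mz: "m * z\<^sup>2 = 4 * (x\<^sup>2 - n)" using szn(2) x by (simp add: power2_eq_square)
  obtain m' where m': "m = 2 * m'" using assms(2) by (auto elim: evenE)
  have "odd m'" using m4 m' by (auto elim!: evenE)
  moreover have "m' * z\<^sup>2 = 2 * (x\<^sup>2 - n)" using mz m' by simp
  ultimately have "even (z\<^sup>2)" by (metis dvd_triv_left even_mult_iff)
  then obtain z' where z': "z = 2 * z'" by (auto elim: evenE)
  have "y = of_int x + of_int z' * rt"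
    unfolding szn(1) x z' by (simp add: add_divide_distrib)
  moreover have "4 * (x\<^sup>2 - m * z'\<^sup>2) = 4 * n"
    using szn(2) unfolding x z' by (simp add: algebra_simps power2_eq_square)
  then have "x\<^sup>2 - m * z'\<^sup>2 = n" by simp
  ultimately show thesis
    using that szn(3,4) unfolding x by blast
qed

text \<open>Norms give n^2 = r^2 N(epsilon), where -1 is impossible for integers. The trace identity
  shows that every prime dividing \<open>r\<close> divides the square of the trace of
  \<open>y\<close>.\<close>

lemma square_times_unit:
  assumes y: "y \<in> ring_of_integers F" "y\<^sup>2 = of_int r * \<epsilon>" and \<epsilon>: "\<epsilon> \<in> unit_group F" and r: "r \<noteq> 0"
  shows "\<exists>n t. y * \<tau> y = of_int n \<and> (n = r \<or> n = - r) \<and> \<epsilon> * \<tau> \<epsilon> = 1 \<and>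
           (y + \<tau> y)\<^sup>2 = of_int (r * t + 2 * n)"
proof -
  have yF: "y \<in> F" and \<epsilon>F: "\<epsilon> \<in> F" using y unitD(1)[OF \<epsilon>] by (auto simp: mem_ring_of_integers)
  obtain n where n: "y * \<tau> y = of_int n" using norm_int[OF y(1)] by (auto elim: Ints_cases)
  obtain t where t: "\<epsilon> + \<tau> \<epsilon> = of_int t" using trace_int[OF unitD(5)[OF \<epsilon>]] by (auto elim: Ints_cases)
  have ty: "(\<tau> y)\<^sup>2 = of_int r * \<tau> \<epsilon>" using arg_cong[OF y(2), of \<tau>] yF \<epsilon>F by simp
  have nn: "of_int (n\<^sup>2) = of_int (r\<^sup>2) * (\<epsilon> * \<tau> \<epsilon>)"
  proof -
    have "of_int (n\<^sup>2) = y\<^sup>2 * (\<tau> y)\<^sup>2" unfolding power_mult_distrib[symmetric] n by simp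
    also have "\<dots> = of_int (r\<^sup>2) * (\<epsilon> * \<tau> \<epsilon>)" unfolding y(2) ty by (simp add: power2_eq_square)
    finally show ?thesis .
  qed
  have one: "\<epsilon> * \<tau> \<epsilon> = 1"
  proof (rule ccontr)
    assume "\<epsilon> * \<tau> \<epsilon> \<noteq> 1"
    then have "of_int (n\<^sup>2) = (of_int (- (r\<^sup>2)) :: complex)" using nn norm_unit[OF \<epsilon>] by auto
    then have "n\<^sup>2 = - (r\<^sup>2)" by (simp only: of_int_eq_iff)
    moreover have "r\<^sup>2 > 0" "n\<^sup>2 \<ge> 0" using r by simp_all
    ultimately show False by linarith
  qed
  then have "of_int (n\<^sup>2) = (of_int (r\<^sup>2) :: complex)" using nn by simp
  then have "n\<^sup>2 = r\<^sup>2" by (simp only: of_int_eq_iff)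
  then have "n = r \<or> n = - r" by (simp add: power2_eq_iff)
  moreover have "(y + \<tau> y)\<^sup>2 = of_int r * (\<epsilon> + \<tau> \<epsilon>) + 2 * (y * \<tau> y)"
    using y(2) ty by (simp add: power2_sum distrib_left)
  then have "(y + \<tau> y)\<^sup>2 = of_int (r * t + 2 * n)" unfolding t n by simp
  ultimately show ?thesis using n one by blast
qed

text \<open>As ideals (r) = (y)^2, so \<open>l\<close> must ramify. Concretely, if \<open>l\<close>
  did not divide \<open>m\<close> it would divide both coordinates of \<open>y\<close>, and its
  square would divide the norm, which is \<open>r\<close> up to sign.\<close>

lemma odd_prime_dvd_of_square_times_unit:
  assumes y: "y \<in> ring_of_integers F" "y\<^sup>2 = of_int r * \<epsilon>" and \<epsilon>: "\<epsilon> \<in> unit_group F"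
    and r: "squarefree r" and l: "prime l" "l dvd r" "l \<noteq> 2"
  shows "l dvd m"
proof (rule ccontr)
  assume nd: "\<not> l dvd m"
  have r0: "r \<noteq> 0" using r by auto
  obtain n t where nt: "y * \<tau> y = of_int n" "n = r \<or> n = - r"
    "(y + \<tau> y)\<^sup>2 = of_int (r * t + 2 * n)" using square_times_unit[OF y \<epsilon> r0] by blast
  obtain s z n' where szn: "s\<^sup>2 - m * z\<^sup>2 = 4 * n'"
    "y * \<tau> y = of_int n'" "y + \<tau> y = of_int s" using integer_form[OF y(1)] by metis
  have n': "n' = n" using szn(2) nt(1) by simp
  have ln: "l dvd n" using l nt(2) by auto
  have "of_int (s\<^sup>2) = (of_int (r * t + 2 * n) :: complex)" using nt(3) szn(3) by simp
  then have "s\<^sup>2 = r * t + 2 * n" by (simp only: of_int_eq_iff)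
  then have "l dvd s\<^sup>2" using l ln by simp
  then have ls: "l dvd s" using l prime_dvd_power by blast
  have "m * z\<^sup>2 = s\<^sup>2 - 4 * n" using szn(1) n' by simp
  then have "l dvd m * z\<^sup>2" using \<open>l dvd s\<^sup>2\<close> ln by simp
  then have "l dvd z" using nd l by (meson prime_dvd_mult_iff prime_dvd_power)
  then have "l\<^sup>2 dvd z\<^sup>2" "l\<^sup>2 dvd s\<^sup>2" using ls by (auto simp: dvd_power_same)
  then have "l\<^sup>2 dvd 4 * n" using szn(1) n' by (metis dvd_diff dvd_mult)
  moreover have "coprime l 2"
    using l by (metis primes_coprime two_is_prime_nat primes_coprime_int prime_int_numeral_eq)
  have four: "(2::int)\<^sup>2 = 4" by simp
  from \<open>coprime l 2\<close> have "coprime (l\<^sup>2) (2\<^sup>2)"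
    by (simp only: coprime_power_left_iff coprime_power_right_iff) simp
  then have "coprime (l\<^sup>2) 4" unfolding four .
  ultimately have "l\<^sup>2 dvd n" by (simp add: coprime_dvd_mult_right_iff)
  then have "l\<^sup>2 dvd r" using nt(2) by auto
  then have "l dvd 1" using r squarefreeD by blast
  then show False using l by (simp add: not_prime_unit)
qed

text \<open>The same ramification argument at 2, which is unramified for \<open>m\<close> congruent
  to 1 modulo 4: an even norm of \<open>y\<close> forces coordinates of equal parity after halving,
  and then 4 divides \<open>r\<close>.\<close>

lemma odd_of_square_times_unit:
  assumes y: "y \<in> ring_of_integers F" "y\<^sup>2 = of_int r * \<epsilon>" and \<epsilon>: "\<epsilon> \<in> unit_group F"
    and r: "squarefree r" and m: "m mod 4 = 1"
  shows "odd r"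
proof
  assume ev: "even r"
  have r0: "r \<noteq> 0" using r by auto
  obtain n t where nt: "y * \<tau> y = of_int n" "n = r \<or> n = - r"
    "(y + \<tau> y)\<^sup>2 = of_int (r * t + 2 * n)" using square_times_unit[OF y \<epsilon> r0] by blast
  obtain s z n' where szn: "s\<^sup>2 - m * z\<^sup>2 = 4 * n'"
    "y * \<tau> y = of_int n'" "y + \<tau> y = of_int s" using integer_form[OF y(1)] by metis
  have n': "n' = n" using szn(2) nt(1) by simp
  have "of_int (s\<^sup>2) = (of_int (r * t + 2 * n) :: complex)" using nt(3) szn(3) by simp
  then have s2: "s\<^sup>2 = r * t + 2 * n" by (simp only: of_int_eq_iff)
  then have "even (s\<^sup>2)" using ev by simp
  then obtain x where x: "s = 2 * x" by (auto elim: evenE)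
  have "odd m" using m by presburger
  moreover have "m * z\<^sup>2 = s\<^sup>2 - 4 * n" using szn(1) n' by simp
  then have "even (m * z\<^sup>2)" using \<open>even (s\<^sup>2)\<close> by simp
  ultimately obtain w where w: "z = 2 * w" by (auto elim: evenE)
  have xw: "x\<^sup>2 - m * w\<^sup>2 = n" using szn(1) x w n' by (simp add: power2_eq_square)
  have "\<not> 2\<^sup>2 dvd r" using r squarefreeD[of r 2] by auto
  then have n4: "even n" "\<not> 4 dvd n" using ev nt(2) by auto
  obtain k where k: "m = 4 * k + 1" using m by (metis mult_div_mod_eq)
  have "even (x\<^sup>2 - m * w\<^sup>2)" using xw n4 by simp
  then have p: "even x \<longleftrightarrow> even w" using \<open>odd m\<close> by simp
  have "4 dvd x\<^sup>2 - w\<^sup>2"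
  proof -
    have "2 dvd x - w" "2 dvd x + w" using p by auto
    then have "2 * 2 dvd (x - w) * (x + w)" by (rule mult_dvd_mono)
    then show ?thesis by (simp add: power2_eq_square algebra_simps)
  qed
  moreover have "n = (x\<^sup>2 - w\<^sup>2) - 4 * (k * w\<^sup>2)" using xw k by (simp add: algebra_simps)
  ultimately have "4 dvd n" by simp
  then show False using n4 by simp
qed

text \<open>With \<open>t\<close> the trace of \<open>\<epsilon>\<close>, \<open>(1 + \<epsilon>)\<^sup>2 = (t + 2) \<epsilon>\<close>; take \<open>r\<close> to be the squarefree part of \<open>t + 2\<close>.\<close>
lemma norm_one_unit_square_class:
  assumes \<epsilon>: "\<epsilon> \<in> unit_group F" "\<epsilon> * \<tau> \<epsilon> = 1" "Re \<epsilon> > 0"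
  shows "\<exists>r y. r > 0 \<and> squarefree r \<and> y \<in> ring_of_integers F \<and> y\<^sup>2 = of_int r * \<epsilon>"
proof -
  obtain t where t: "\<epsilon> + \<tau> \<epsilon> = of_int t" using trace_int[OF unitD(5)[OF \<epsilon>(1)]] by (auto elim: Ints_cases)
  have \<epsilon>F: "\<epsilon> \<in> F" by (rule unitD[OF \<epsilon>(1)])
  have sq: "(1 + \<epsilon>)\<^sup>2 = of_int (t + 2) * \<epsilon>"
  proof -
    have "of_int (t + 2) * \<epsilon> = (\<epsilon> + \<tau> \<epsilon>) * \<epsilon> + 2 * \<epsilon>" by (simp add: t algebra_simps)
    also have "\<dots> = \<epsilon>\<^sup>2 + \<epsilon> * \<tau> \<epsilon> + 2 * \<epsilon>" by (simp add: algebra_simps power2_eq_square)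
    finally show ?thesis by (simp add: \<epsilon>(2) power2_eq_square algebra_simps)
  qed
  have "Im \<epsilon> = 0" using F_Reals[OF \<epsilon>F] by (simp add: complex_is_Real_iff)
  then have "(1 + Re \<epsilon>)\<^sup>2 = of_int (t + 2) * Re \<epsilon>"
    using arg_cong[OF sq, of Re] by (simp add: power2_eq_square)
  moreover have "(1 + Re \<epsilon>)\<^sup>2 > 0" using \<epsilon>(3) by simp
  ultimately have "real_of_int (t + 2) > 0" using \<epsilon>(3) by (simp add: zero_less_mult_iff)
  then have t2: "t + 2 > 0" by linarith
  define r k where "r = squarefree_part (t + 2)" and "k = square_part (t + 2)"
  have rk: "t + 2 = r * k\<^sup>2" unfolding r_def k_def by (rule squarefree_decompose)
  have k0: "k \<noteq> 0" using rk t2 by auto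
  have "r * k\<^sup>2 > 0" using rk t2 by simp
  then have r: "r > 0" by (auto simp: zero_less_mult_iff)
  have sr: "squarefree r" by (simp add: r_def)
  define y where "y = (1 + \<epsilon>) / of_int k"
  have y2: "y\<^sup>2 = of_int r * \<epsilon>"
    unfolding y_def power_divide sq rk using k0 by simp
  have "algebraic_int (y\<^sup>2)" unfolding y2 using unitD(3)[OF \<epsilon>(1)] by (intro algebraic_int_mult) auto
  then have "algebraic_int y" by (rule algebraic_int_of_power) simp
  then have "y \<in> ring_of_integers F" using \<epsilon>F by (simp add: mem_ring_of_integers y_def)
  then show ?thesis using r sr y2 by blast
qed

lemma exists_unit_gt_1: "\<exists>u\<in>unit_group F. Re u > 1"
proof -
  have "sqrt (real_of_int m) \<notin> \<rat>"
    using csqrt_int_irrational[OF m_gt_1 squarefree_m] by (auto simp: csqrt_int_def elim!: Rats_cases')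
  then obtain x y where xy: "x\<^sup>2 - m * y\<^sup>2 = 1" "y \<noteq> 0" using Pell_exists[of m] m_gt_1 by auto
  define u where "u = of_int \<bar>x\<bar> + of_int \<bar>y\<bar> * rt"
  have uF: "u \<in> F" using rt_F by (simp add: u_def)
  have "(of_int a + of_int b * rt) * (of_int a - of_int b * rt) = of_int (a\<^sup>2 - m * b\<^sup>2)" for a b
    using rt_square_left rt_square by (simp add: algebra_simps power2_eq_square)
  then have "u * (of_int \<bar>x\<bar> - of_int \<bar>y\<bar> * rt) = of_int (\<bar>x\<bar>\<^sup>2 - m * \<bar>y\<bar>\<^sup>2)"
    unfolding u_def .
  also have "\<dots> = 1" using xy by simp
  finally have 1: "u * (of_int \<bar>x\<bar> - of_int \<bar>y\<bar> * rt) = 1" .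
  have "algebraic_int u" "algebraic_int (of_int \<bar>x\<bar> - of_int \<bar>y\<bar> * rt)"
    unfolding u_def by (intro algebraic_int_add algebraic_int_diff algebraic_int_mult algebraic_int_csqrt_int; simp)+
  moreover have "inverse u = of_int \<bar>x\<bar> - of_int \<bar>y\<bar> * rt" using 1 by (rule inverse_unique)
  ultimately have "u \<in> unit_group F" using uF 1 by (auto simp: mem_unit_group)
  moreover have "Re u > 1"
  proof -
    have "\<bar>x\<bar> \<ge> 1" using xy m_gt_1 
    proof (cases "x = 0")
      case True
      have "m * y\<^sup>2 \<ge> 0" using m_gt_1 by simp
      then show ?thesis using xy True by simp
    qed simp
    moreover have "real_of_int \<bar>y\<bar> * sqrt (real_of_int m) > 0" using xy m_gt_1 by simp
    ultimately show ?thesis unfolding u_def csqrt_int_def by simp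
  qed
  ultimately show ?thesis by blast
qed

text \<open>Such a unit has a conjugate of absolute value at most 1, hence a bounded trace and norm
  1 or -1; only finitely many quadratic polynomials can occur.\<close>

lemma finite_units_bounded: "finite {u \<in> unit_group F. 1 < Re u \<and> Re u \<le> B}"
proof -
  define K where "K = \<lceil>B + 1\<rceil>"
  have "{u \<in> unit_group F. 1 < Re u \<and> Re u \<le> B} \<subseteq>
      (\<Union>t\<in>{-K..K}. \<Union>n\<in>{1, -1}. {u. poly [:of_int n, - of_int t, 1:] u = 0})" (is "_ \<subseteq> ?U")
  proof
    fix u assume "u \<in> {u \<in> unit_group F. 1 < Re u \<and> Re u \<le> B}"
    then have u: "u \<in> unit_group F" "1 < Re u" "Re u \<le> B" by auto
    have uF: "u \<in> F" by (rule unitD[OF u(1)])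
    obtain t where t: "u + \<tau> u = of_int t" using trace_int[OF unitD(5)[OF u(1)]] by (auto elim: Ints_cases)
    have "\<exists>n::int. u * \<tau> u = of_int n \<and> n \<in> {1, -1}"
      using norm_unit[OF u(1)] by (auto intro: exI[of _ 1] exI[of _ "-1"])
    then obtain n :: int where n: "u * \<tau> u = of_int n" "n \<in> {1, -1}" by blast
    have "Im u = 0" using F_Reals[OF uF] by (simp add: complex_is_Real_iff)
    then have "Re u * Re (\<tau> u) = of_int n" using arg_cong[OF n(1), of Re] by simp
    then have "\<bar>Re u\<bar> * \<bar>Re (\<tau> u)\<bar> = 1" using n(2) by (auto simp flip: abs_mult)
    moreover have "\<bar>Re u\<bar> * \<bar>Re (\<tau> u)\<bar> \<ge> 1 * \<bar>Re (\<tau> u)\<bar>" using u by (intro mult_right_mono) auto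
    ultimately have "\<bar>Re (\<tau> u)\<bar> \<le> 1" by simp
    moreover have "real_of_int t = Re u + Re (\<tau> u)" using arg_cong[OF t, of Re] by simp
    ultimately have "\<bar>real_of_int t\<bar> \<le> B + 1" using u by linarith
    then have "t \<in> {-K..K}" unfolding K_def by simp linarith
    moreover have "poly [:of_int n, - of_int t, 1:] u = 0"
      using n(1) t[symmetric] by (simp add: algebra_simps)
    ultimately show "u \<in> ?U" using n(2) by blast
  qed
  moreover have "finite ?U" by (intro finite_UN_I finite_atLeastAtMost_int poly_roots_finite) auto
  ultimately show ?thesis by (rule finite_subset)
qed

text \<open>Take the least unit above 1. Dividing a positive unit by a suitable power of it lands in
  the interval from 1 to \<open>b\<close>, right end excluded, where minimality leaves only
  1.\<close>

lemma fundamental_unit: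
  "\<exists>b\<in>unit_group F. Re b > 1 \<and> (\<forall>u\<in>unit_group F. \<exists>n::int. u = b powi n \<or> u = - (b powi n))"
proof -
  obtain u0 where u0: "u0 \<in> unit_group F" "Re u0 > 1" using exists_unit_gt_1 by blast
  define A where "A = {u \<in> unit_group F. 1 < Re u \<and> Re u \<le> Re u0}"
  have A: "finite A" "A \<noteq> {}" using finite_units_bounded u0 by (auto simp: A_def)
  define b where "b = arg_min_on Re A"
  have bA: "b \<in> A" and bmin: "\<And>u. u \<in> A \<Longrightarrow> Re b \<le> Re u"
    using arg_min_if_finite(1)[OF A, of Re] arg_min_least[OF A, of _ Re] by (auto simp: b_def)
  have b: "b \<in> unit_group F" "Re b > 1" using bA by (auto simp: A_def)
  obtain \<beta> where \<beta>: "b = of_real \<beta>" using F_Reals[OF unitD(1)[OF b(1)]] by (elim Reals_cases)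
  have \<beta>1: "\<beta> > 1" using b(2) \<beta> by simp
  have pos: "\<exists>n::int. u = b powi n" if u: "u \<in> unit_group F" "Re u > 0" for u
  proof -
    obtain \<upsilon> where \<upsilon>: "u = of_real \<upsilon>" using F_Reals[OF unitD(1)[OF u(1)]] by (elim Reals_cases)
    have \<upsilon>0: "\<upsilon> > 0" using u(2) \<upsilon> by simp
    define n where "n = \<lfloor>log \<beta> \<upsilon>\<rfloor>"
    define v where "v = u * b powi (- n)"
    have v: "v \<in> unit_group F" unfolding v_def using u b by (intro unit_mult unit_power_int)
    have v_re: "v = of_real (\<upsilon> / \<beta> powi n)"
      unfolding v_def \<beta> \<upsilon> by (simp add: power_int_minus divide_inverse)
    have e: "\<beta> powi n = \<beta> powr real_of_int n"
      using \<beta>1 by (simp add: powr_real_of_int')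
    have lu: "\<upsilon> = \<beta> powr log \<beta> \<upsilon>" using \<beta>1 \<upsilon>0 by simp
    have "\<beta> powr real_of_int n \<le> \<beta> powr log \<beta> \<upsilon>"
      by (rule powr_mono) (use \<beta>1 in \<open>auto simp: n_def\<close>)
    then have lo: "\<beta> powi n \<le> \<upsilon>" using e lu by simp
    have "\<beta> powr log \<beta> \<upsilon> < \<beta> powr (real_of_int n + 1)"
      by (rule powr_less_mono) (use \<beta>1 in \<open>auto simp: n_def\<close>)
    then have hi: "\<upsilon> < \<beta> * \<beta> powi n" using e lu \<beta>1 by (simp add: powr_add mult.commute)
    have p0: "\<beta> powi n > 0" using \<beta>1 by simp
    have rv: "Re v = \<upsilon> / \<beta> powi n" "Re b = \<beta>" by (simp_all only: v_re \<beta> Re_complex_of_real)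
    have v1: "1 \<le> Re v" "Re v < Re b" unfolding rv using lo hi p0 by (auto simp: field_simps)
    have "Re v = 1"
    proof (rule ccontr)
      assume "Re v \<noteq> 1"
      then have "v \<in> A" using v v1 bA by (auto simp: A_def)
      then show False using bmin[of v] v1 by simp
    qed
    then have "\<upsilon> / \<beta> powi n = 1" by (simp only: rv(1))
    then have "v = 1" by (simp only: v_re of_real_1)
    then have "u = b powi n"
      using unitD(2)[OF b(1)] by (simp add: v_def power_int_minus field_simps)
    then show ?thesis by blast
  qed
  have "\<exists>n::int. u = b powi n \<or> u = - (b powi n)" if u: "u \<in> unit_group F" for u
  proof (cases "Re u > 0")
    case False
    have "Re u \<noteq> 0" using F_Reals[OF unitD(1)[OF u]] unitD(2)[OF u] by (metis of_real_0 of_real_Re)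
    then have "\<exists>n::int. - u = b powi n" using False pos[OF unit_uminus[OF u]] by simp
    then show ?thesis by (metis minus_minus)
  qed (use pos[OF u] in blast)
  then show ?thesis using b by blast
qed

end

section \<open>Units after adjoining \<open>\<i>\<close> to a real quadratic field\<close>

lemma Reals_of_square_pos:
  fixes z :: complex
  assumes "z\<^sup>2 = of_real e" "e \<ge> 0"
  shows "z \<in> \<real>"
proof -
  have "(z - of_real (sqrt e)) * (z + of_real (sqrt e)) = z\<^sup>2 - of_real (sqrt e) * of_real (sqrt e)"
    by (simp add: algebra_simps power2_eq_square)
  also have "\<dots> = 0" using assms by (simp flip: of_real_mult)
  finally have "z = of_real (sqrt e) \<or> z = - of_real (sqrt e)" by (simp add: eq_neg_iff_add_eq_0)
  then show ?thesis by auto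
qed

lemma mult_cnj_neq_minus_one: "z * cnj z \<noteq> -1"
proof
  assume "z * cnj z = -1"
  then have "Re (z * cnj z) = Re (-1)" by (rule arg_cong)
  then have "Re z * Re z + Im z * Im z = -1" by simp
  then show False by (smt (verit) zero_le_square)
qed

lemma Q_i_quad_ext: "quad_ext \<rat> \<i>"
proof
  have "\<rat> \<subseteq> (\<real> :: complex set)"
    using subfield.Rats[OF subfield.intro[OF is_subfield_Reals]] by blast
  then show "\<i> \<notin> \<rat>" by (auto simp: complex_is_Real_iff)
qed (simp_all add: is_subfield_Rats)

context real_quadratic
begin

abbreviation "Fi \<equiv> field_gen {csqrt_int m, \<i>}"
text \<open>The automorphism that fixes \<open>\<i>\<close> and extends \<open>\<tau>\<close>; it
  commutes with complex conjugation.\<close>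

abbreviation "\<rho> \<equiv> qconj (field_gen {\<i>}) (csqrt_int m)"

sublocale Qi: quad_ext \<rat> \<i>
  by (rule Q_i_quad_ext)

lemma field_gen_i: "field_gen {\<i>} = qext \<rat> \<i>"
  using Qi.field_gen_insert[of "{}"] field_gen_empty by simp

lemma Rats_Re: "x \<in> \<rat> \<Longrightarrow> x \<in> \<real>" for x :: complex
  using subfield.Rats[OF subfield.intro[OF is_subfield_Reals]] .

sublocale Fi: quad_ext F \<i>
proof
  show "\<i> \<notin> F" using F_Reals[of \<i>] by (auto simp: complex_is_Real_iff)
qed simp

lemma Fi_eq: "Fi = qext F \<i>"
  using Fi.field_gen_insert[of "{rt}"] by (simp add: insert_commute)

sublocale Fi: subfield Fi
  by unfold_locales (rule is_subfield_field_gen)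

lemma F_subset_Fi: "F \<subseteq> Fi"
  by (auto simp: Fi_eq intro: Fi.base_qext)

lemma i_Fi: "\<i> \<in> Fi"
  using field_gen_superset[of "{rt, \<i>}"] by simp

lemma Fi_E:
  assumes "z \<in> Fi"
  obtains x y where "x \<in> F" "y \<in> F" "z = x + y * \<i>"
  using assms unfolding Fi_eq by (rule Fi.qextE)

lemma Fi_Reals:
  assumes "z \<in> Fi" "z \<in> \<real>"
  shows "z \<in> F"
proof -
  obtain x y where xy: "x \<in> F" "y \<in> F" "z = x + y * \<i>" using Fi_E[OF assms(1)] .
  have "Im x = 0" "Im y = 0" using F_Reals xy by (auto simp: complex_is_Real_iff)
  moreover have "Im z = 0" using assms(2) by (simp add: complex_is_Real_iff)
  ultimately have "y = 0" using xy(3) by (simp add: complex_eq_iff)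
  then show ?thesis using xy by simp
qed

sublocale R: quad_ext "field_gen {\<i>}" rt
proof
  show "is_subfield (field_gen {\<i>})" by (rule is_subfield_field_gen)
  show "rt * rt \<in> field_gen {\<i>}"
    unfolding rt_square field_gen_i by (rule Qi.base_qext) simp
  show "rt \<notin> field_gen {\<i>}"
  proof
    assume "rt \<in> field_gen {\<i>}"
    then obtain x y where xy: "x \<in> \<rat>" "y \<in> \<rat>" "rt = x + y * \<i>"
      unfolding field_gen_i by (rule Qi.qextE)
    have "Im x = 0" "Im y = 0" using Rats_Re xy by (auto simp: complex_is_Real_iff)
    then have "y = 0" using arg_cong[OF xy(3), of Im] by (simp add: csqrt_int_def complex_eq_iff)
    then show False using xy csqrt_int_irrational[OF m_gt_1 squarefree_m] by simp
  qed
qed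

lemma Fi_eq': "Fi = qext (field_gen {\<i>}) rt"
  using R.field_gen_insert[of "{\<i>}"] by simp

sublocale \<rho>: hom_on Fi \<rho>
  unfolding Fi_eq' by (rule R.hom_on_qconj)

lemma \<rho>_i: "\<rho> \<i> = \<i>"
  using field_gen_superset[of "{\<i>}"] by (intro R.qconj_base) simp

lemma cnj_Fi: "x \<in> Fi \<Longrightarrow> cnj x \<in> Fi"
  by (rule cnj_field_gen) (use field_gen_superset[of "{rt, \<i>}"] in auto)

sublocale cnj: hom_on Fi cnj
  by (rule hom_on_cnj[OF is_subfield_field_gen cnj_Fi])

lemma \<rho>_F: "x \<in> F \<Longrightarrow> \<rho> x = \<tau> x"
proof (elim F_E)
  fix a b assume ab: "a \<in> \<rat>" "b \<in> \<rat>" "x = a + b * rt"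
  then have "a \<in> field_gen {\<i>}" "b \<in> field_gen {\<i>}"
    unfolding field_gen_i by (auto intro: Qi.base_qext)
  then show ?thesis using ab R.qconj_eq \<tau>_eq by simp
qed

lemma \<rho>_cnj: "x \<in> Fi \<Longrightarrow> \<rho> (cnj x) = cnj (\<rho> x)"
  by (rule hom_on.hom_eq_on_gen[OF \<rho>.hom_comp[OF cnj.hom_on_axioms] cnj.hom_comp[OF \<rho>.hom_on_axioms] refl])
    (use i_Fi in \<open>auto simp: \<rho>_i\<close>)

lemma \<rho>_\<rho>: "x \<in> Fi \<Longrightarrow> \<rho> (\<rho> x) = x"
  unfolding Fi_eq' by (rule R.qconj_qconj)

text \<open>The traces of \<open>g\<close> and \<open>- \<i> * g\<close> make the doubled
  coordinates integers X and Y, and g times its conjugate is a positive rational unit. So X^2 + Y^2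
  = 4, which has only the four axis solutions.\<close>

lemma Gaussian_unit:
  assumes g: "g \<in> field_gen {\<i>}" "g \<in> unit_group Fi"
  shows "g = 1 \<or> g = -1 \<or> g = \<i> \<or> g = - \<i>"
proof -
  obtain x y where xy: "x \<in> \<rat>" "y \<in> \<rat>" "g = x + y * \<i>"
    using g(1) unfolding field_gen_i by (rule Qi.qextE)
  have im: "Im x = 0" "Im y = 0" using Rats_Re xy by (auto simp: complex_is_Real_iff)
  then have cx: "cnj x = x" "cnj y = y" by (simp_all add: complex_eq_iff)
  have ai: "algebraic_int g" "algebraic_int (cnj g)" using Fi.unitD(3)[OF g(2)] by auto
  have "g + cnj g = 2 * x" using xy cx by simp
  then have "algebraic_int (2 * x)" using algebraic_int_add[OF ai] by simp
  then obtain X where X: "2 * x = of_int X"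
    using rational_algebraic_int_is_int[of "2 * x"] xy(1) by (auto elim: Ints_cases)
  have "- \<i> * (g - cnj g) = 2 * y" using xy cx by (simp add: algebra_simps)
  then have "algebraic_int (2 * y)"
    using algebraic_int_mult[of "- \<i>", OF _ algebraic_int_diff[OF ai]] by simp
  then obtain Y where Y: "2 * y = of_int Y"
    using rational_algebraic_int_is_int[of "2 * y"] xy(2) by (auto elim: Ints_cases)
  have gg: "g * cnj g = x * x + y * y" using xy cx by (simp add: algebra_simps)
  have "g * cnj g \<in> \<rat>" unfolding gg using xy by simp
  moreover have "g * cnj g \<in> unit_group Fi" using g(2) cnj.unit_hom by (intro Fi.unit_mult)
  ultimately have "g * cnj g = 1 \<or> g * cnj g = -1" by (intro Fi.rational_unit)
  then have "x * x + y * y = 1" using gg mult_cnj_neq_minus_one by metis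
  moreover have "(2 * x) * (2 * x) + (2 * y) * (2 * y) = 4 * (x * x + y * y)"
    by (simp add: algebra_simps)
  ultimately have "(2 * x) * (2 * x) + (2 * y) * (2 * y) = 4" by simp
  then have "of_int (X * X + Y * Y) = (of_int 4 :: complex)" unfolding X Y by simp
  then have XY: "X * X + Y * Y = 4" by (simp only: of_int_eq_iff)
  have "X\<^sup>2 \<le> 2\<^sup>2" "Y\<^sup>2 \<le> 2\<^sup>2" using XY by (auto simp: power2_eq_square) (smt (verit) zero_le_square)+
  then have "\<bar>X\<bar> \<le> 2" "\<bar>Y\<bar> \<le> 2"
    using abs_le_square_iff[of X 2] abs_le_square_iff[of Y 2] by simp_all
  then have "X \<in> {-2, -1, 0, 1, 2}" "Y \<in> {-2, -1, 0, 1, 2}" by auto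
  with XY have "(X, Y) \<in> {(2, 0), (-2, 0), (0, 2), (0, -2)}" by auto
  then show ?thesis using X Y xy(3) by (auto simp: complex_eq_iff)
qed

text \<open>The product is the norm of \<open>\<eta>\<close> to the subfield fixed by
  \<open>cnj\<close> after \<open>\<rho>\<close>, the imaginary quadratic field of radicand -m. Its
  only units are 1 and -1, except for the sixth roots of unity at m = 3.\<close>

lemma unit_Fi_norm_tau_cnj:
  assumes "m \<noteq> 3" and \<eta>: "\<eta> \<in> unit_group Fi"
  shows "\<eta> * cnj (\<rho> \<eta>) = 1 \<or> \<eta> * cnj (\<rho> \<eta>) = -1"
proof -
  define v where "v = \<eta> * cnj (\<rho> \<eta>)"
  have \<eta>F: "\<eta> \<in> Fi" by (rule Fi.unitD[OF \<eta>])
  have v: "v \<in> unit_group Fi"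
    unfolding v_def using \<eta> by (intro Fi.unit_mult cnj.unit_hom \<rho>.unit_hom)
  have vF: "v \<in> Fi" by (rule Fi.unitD[OF v])
  have fix_v: "cnj (\<rho> v) = v"
    unfolding v_def using \<eta>F \<rho>_cnj \<rho>_\<rho> cnj_Fi by (simp add: mult.commute)
  obtain a b where ab: "a \<in> F" "b \<in> F" "v = a + b * \<i>" using Fi_E[OF vF] .
  have im: "Im a = 0" "Im b = 0" "Im (\<tau> a) = 0" "Im (\<tau> b) = 0"
    using F_Reals[OF ab(1)] F_Reals[OF ab(2)] F_Reals[OF hom_closed[OF ab(1)]]
      F_Reals[OF hom_closed[OF ab(2)]] by (auto simp: complex_is_Real_iff)
  have "\<rho> v = \<tau> a + \<tau> b * \<i>"
    using ab \<rho>_F \<rho>_i F_subset_Fi i_Fi by (simp add: subset_iff)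
  then have "a + b * \<i> = cnj (\<tau> a) - cnj (\<tau> b) * \<i>" using fix_v ab(3) by simp
  then have \<tau>ab: "\<tau> a = a" "\<tau> b = - b" using im by (simp_all add: complex_eq_iff)
  have aQ: "a \<in> \<rat>" using \<tau>_fixed ab(1) \<tau>ab(1) by simp
  obtain x y where xy: "x \<in> \<rat>" "y \<in> \<rat>" "b = x + y * rt" using F_E[OF ab(2)] .
  have "x - y * rt = - (x + y * rt)" using \<tau>ab(2) \<tau>_eq xy by simp
  then have "x = 0" by (simp add: eq_neg_iff_add_eq_0)
  then have b: "b = y * rt" using xy by simp
  have cab: "cnj a = a" "cnj b = b" using im by (simp_all add: complex_eq_iff)
  have vv: "v * cnj v = a * a + y * y * of_int m"
  proof -
    have "v * cnj v = a * a + b * b" using ab(3) cab by (simp add: algebra_simps)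
    then show ?thesis unfolding b by (simp add: algebra_simps rt_square_left rt_square)
  qed
  have "v * cnj v \<in> \<rat>" unfolding vv using aQ xy by simp
  moreover have "v * cnj v \<in> unit_group Fi" using v by (intro Fi.unit_mult cnj.unit_hom)
  ultimately have "v * cnj v = 1 \<or> v * cnj v = -1" by (intro Fi.rational_unit)
  then have eq1: "a * a + y * y * of_int m = 1" using vv mult_cnj_neq_minus_one by metis
  have "v + cnj v = 2 * a" using ab(3) cab by simp
  moreover have "algebraic_int v" by (rule Fi.unitD[OF v])
  ultimately have "algebraic_int (2 * a)" by (metis algebraic_int_add algebraic_int_cnj_iff)
  then obtain T where T: "2 * a = of_int T"
    using rational_algebraic_int_is_int[of "2 * a"] aQ by (auto elim: Ints_cases)
  have "(2 * y)\<^sup>2 * of_int m = 4 * (a * a + y * y * of_int m) - (2 * a)\<^sup>2"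
    by (simp add: power2_eq_square algebra_simps)
  also have "\<dots> = of_int (4 - T\<^sup>2)" unfolding eq1 T by simp
  finally have ym: "(2 * y)\<^sup>2 * of_int m = of_int (4 - T\<^sup>2)" .
  have "2 * y \<in> \<int>"
    by (rule rational_square_times_squarefree[OF _ squarefree_m]) (use xy(2) ym in auto)
  then obtain z where z: "2 * y = of_int z" by (auto elim: Ints_cases)
  have "of_int (z\<^sup>2 * m) = (of_int (4 - T\<^sup>2) :: complex)" using ym z by simp
  then have zm: "z\<^sup>2 * m = 4 - T\<^sup>2" by (simp only: of_int_eq_iff)
  moreover have "z\<^sup>2 * m \<ge> 0" using m_gt_1 by simp
  ultimately have "T\<^sup>2 \<le> 2\<^sup>2" by simp
  then have "\<bar>T\<bar> \<le> 2" using abs_le_square_iff[of T 2] by simp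
  then have "T \<in> {-2, -1, 0, 1, 2}" by auto
  \<comment> \<open>In T^2 + m z^2 = 4, the value T = 0 would make \<open>rt\<close> rational and
    T^2 = 1 would make \<open>m\<close> divide 3.\<close>
  then consider "T\<^sup>2 = 0" | "T\<^sup>2 = 1" | "T\<^sup>2 = 4" by auto
  then have "T\<^sup>2 = 4"
  proof cases
    case 1
    then have "z\<^sup>2 * m = 4" using zm by simp
    then have "(z * z) * m = 4" by (simp add: power2_eq_square)
    then have "of_int ((z * z) * m) = (4 :: complex)" by simp
    then have "(of_int z * rt) * (of_int z * rt) = 2 * 2"
      using rt_square by (simp add: mult_ac)
    then have "of_int z * rt = 2 \<or> of_int z * rt = -2"
      unfolding square_eq_iff by simp
    then have "rt = 2 / of_int z \<or> rt = - 2 / of_int z" by (cases "z = 0") (auto simp: field_simps)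
    then have "rt \<in> \<rat>" by auto
    then show ?thesis using csqrt_int_irrational[OF m_gt_1 squarefree_m] by simp
  next
    case 2
    then have "m dvd 3" using dvd_triv_right[of m "z\<^sup>2"] zm by simp
    then have "m \<le> 3" by (simp add: zdvd_imp_le)
    then have "m = 2 \<or> m = 3" using m_gt_1 by auto
    then show ?thesis using \<open>m dvd 3\<close> assms(1) by auto
  qed
  then have "z\<^sup>2 * m = 0" using zm by simp
  then have "y = 0" using m_gt_1 z by simp
  then have "v * v = 1" using ab(3) b eq1 by simp
  then have "v = 1 \<or> v = -1" by (simp add: square_eq_1_iff)
  then show ?thesis by (simp add: v_def)
qed

text \<open>eta^2 times the norm of its conjugate to the imaginary quadratic subfield equals the
  product of its norms to \<open>F\<close> and to the Gaussian field. So eta^2 is the positive real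
  unit \<open>\<epsilon>\<close> times a fourth root of unity. For 1 and -1 a power of
  \<open>\<i>\<close> makes \<open>\<eta>\<close> real; for \<open>\<i>\<close> and
  \<open>- \<i>\<close> one needs 1 + i, whose square is 2 i, and this makes 2 epsilon a square in
  \<open>F\<close>.\<close>

lemma unit_Fi:
  assumes "m \<noteq> 3" and \<eta>: "\<eta> \<in> unit_group Fi"
  shows "(\<exists>l \<epsilon>. \<epsilon> \<in> unit_group F \<and> \<eta> = \<i> ^ l * \<epsilon>) \<or>
    (\<exists>l y \<epsilon>. y \<in> F \<and> \<epsilon> \<in> unit_group F \<and> y\<^sup>2 = 2 * \<epsilon> \<and> (1 + \<i>) * \<eta> = \<i> ^ l * y)"
proof -
  have \<eta>F: "\<eta> \<in> Fi" by (rule Fi.unitD[OF \<eta>])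
  define \<epsilon> where "\<epsilon> = \<eta> * cnj \<eta>"
  have \<epsilon>Fi: "\<epsilon> \<in> unit_group Fi" unfolding \<epsilon>_def using \<eta> by (intro Fi.unit_mult cnj.unit_hom)
  define e where "e = (cmod \<eta>)\<^sup>2"
  have e: "\<epsilon> = of_real e" "e \<ge> 0" unfolding \<epsilon>_def e_def using complex_norm_square[of \<eta>] by simp_all
  then have \<epsilon>: "\<epsilon> \<in> unit_group F"
    using \<epsilon>Fi Fi_Reals[of \<epsilon>] Fi.unitD(1)[OF \<epsilon>Fi] Fi.unit_sub[OF is_subfield_field_gen] by simp
  define g where "g = \<eta> * \<rho> \<eta>"
  have g: "g \<in> unit_group Fi" unfolding g_def using \<eta> by (intro Fi.unit_mult \<rho>.unit_hom)
  have "\<rho> g = g" unfolding g_def using \<eta>F \<rho>_\<rho> by (simp add: mult.commute)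
  then have "g \<in> field_gen {\<i>}" using R.qconj_fixed[of g] Fi.unitD(1)[OF g] Fi_eq' by simp
  then have g4: "g = 1 \<or> g = -1 \<or> g = \<i> \<or> g = - \<i>" using g by (rule Gaussian_unit)
  have v: "cnj \<eta> * \<rho> \<eta> = 1 \<or> cnj \<eta> * \<rho> \<eta> = -1"
    using unit_Fi_norm_tau_cnj[OF assms] by (auto dest: arg_cong[of _ _ cnj])
  have "\<eta>\<^sup>2 * (cnj \<eta> * \<rho> \<eta>) = \<epsilon> * g" by (simp add: \<epsilon>_def g_def power2_eq_square)
  then have "\<eta>\<^sup>2 = \<epsilon> * g \<or> \<eta>\<^sup>2 = - (\<epsilon> * g)" using v by (auto simp: minus_equation_iff)
  then consider "\<eta>\<^sup>2 = \<epsilon>" | "\<eta>\<^sup>2 = - \<epsilon>" | "\<eta>\<^sup>2 = \<i> * \<epsilon>" | "\<eta>\<^sup>2 = - (\<i> * \<epsilon>)"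
    using g4 by (auto simp: mult.commute)
  then show ?thesis
  proof cases
    case 1
    then have "\<eta> \<in> \<real>" using e Reals_of_square_pos by auto
    then have "\<eta> \<in> unit_group F" using Fi_Reals[OF \<eta>F] Fi.unit_sub[OF is_subfield_field_gen \<eta>] by simp
    then show ?thesis by (intro disjI1 exI[of _ 0] exI[of _ \<eta>]) simp
  next
    case 2
    then have "(\<i> * \<eta>)\<^sup>2 = of_real e" using e by (simp add: power_mult_distrib)
    then have "\<i> * \<eta> \<in> \<real>" using e Reals_of_square_pos by auto
    then have iF: "\<i> * \<eta> \<in> F" using Fi_Reals[of "\<i> * \<eta>"] \<eta>F i_Fi by simp
    have "\<i> * \<eta> \<in> unit_group F"
      by (rule unit_of_power[OF iF, of 2]) (use 2 \<epsilon> in \<open>simp_all add: power_mult_distrib\<close>)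
    moreover have "\<eta> = \<i> ^ 3 * (\<i> * \<eta>)" by (simp add: power3_eq_cube)
    ultimately show ?thesis by blast
  next
    case 3
    have sq: "(\<i> * ((1 + \<i>) * \<eta>))\<^sup>2 = 2 * \<epsilon>"
    proof -
      have "(\<i> * ((1 + \<i>) * \<eta>))\<^sup>2 = (\<i> * (1 + \<i>))\<^sup>2 * \<eta>\<^sup>2" by (simp add: power_mult_distrib)
      also have "(\<i> * (1 + \<i>))\<^sup>2 = - 2 * \<i>" by (simp add: power2_eq_square algebra_simps)
      finally show ?thesis using 3 by simp
    qed
    then have "\<i> * ((1 + \<i>) * \<eta>) \<in> \<real>" using e by (intro Reals_of_square_pos[of _ "2 * e"]) simp_all
    then have "\<i> * ((1 + \<i>) * \<eta>) \<in> F" using \<eta>F i_Fi by (intro Fi_Reals) simp_all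
    moreover have "(1 + \<i>) * \<eta> = \<i> ^ 3 * (\<i> * ((1 + \<i>) * \<eta>))" by (simp add: power3_eq_cube)
    ultimately show ?thesis using sq \<epsilon> by blast
  next
    case 4
    have sq: "((1 + \<i>) * \<eta>)\<^sup>2 = 2 * \<epsilon>"
    proof -
      have "((1 + \<i>) * \<eta>)\<^sup>2 = (1 + \<i>)\<^sup>2 * \<eta>\<^sup>2" by (simp add: power_mult_distrib)
      also have "(1 + \<i>)\<^sup>2 = 2 * \<i>" by (simp add: power2_eq_square algebra_simps)
      finally show ?thesis using 4 by simp
    qed
    then have "(1 + \<i>) * \<eta> \<in> \<real>" using e by (intro Reals_of_square_pos[of _ "2 * e"]) simp_all
    then have "(1 + \<i>) * \<eta> \<in> F" using \<eta>F i_Fi by (intro Fi_Reals) simp_all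
    moreover have "(1 + \<i>) * \<eta> = \<i> ^ 0 * ((1 + \<i>) * \<eta>)" by simp
    ultimately show ?thesis using sq \<epsilon> by blast
  qed
qed

end

section \<open>The Legendre conditions\<close>

lemma Legendre_cong: "[a = b] (mod p) \<Longrightarrow> Legendre a p = Legendre b p"
  unfolding Legendre_def QuadRes_def by (simp only: unique_euclidean_semiring_class.cong_def)

lemma Legendre_values: "Legendre a p \<in> {-1, 0, 1}"
  by (simp add: Legendre_def)

lemma euler_criterion_int:
  fixes p :: int
  assumes "prime p" "p > 2"
  shows "[Legendre a p = a ^ ((nat p - 1) div 2)] (mod p)"
proof -
  have "prime (nat p)" "2 < nat p"
    using prime_int_nat_transfer[THEN iffD1, OF assms(1)] assms(2) by auto
  from euler_criterion[OF this, of a] show ?thesis using assms by simp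
qed

lemma Legendre_mult:
  assumes p: "prime p" "p > 2"
  shows "Legendre (a * b) p = Legendre a p * Legendre b p"
proof -
  have "[Legendre (a * b) p = (a * b) ^ ((nat p - 1) div 2)] (mod p)"
    by (rule euler_criterion_int[OF p])
  moreover have "[Legendre a p * Legendre b p = a ^ ((nat p - 1) div 2) * b ^ ((nat p - 1) div 2)] (mod p)"
    by (intro cong_mult euler_criterion_int[OF p])
  ultimately have "[Legendre (a * b) p = Legendre a p * Legendre b p] (mod p)"
    unfolding power_mult_distrib by (metis cong_sym cong_trans)
  then have "p dvd Legendre (a * b) p - Legendre a p * Legendre b p" by (simp add: cong_iff_dvd_diff)
  \<comment> \<open>Both sides lie between -1 and 1, so they differ by at most 2, less than
    \<open>p\<close>; congruence is then equality.\<close>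
  moreover have "\<bar>Legendre (a * b) p - Legendre a p * Legendre b p\<bar> < p"
    using Legendre_values[of a p] Legendre_values[of b p] Legendre_values[of "a * b" p] p by auto
  ultimately have "Legendre (a * b) p - Legendre a p * Legendre b p = 0"
    using dvd_imp_le_int[of "Legendre (a * b) p - Legendre a p * Legendre b p" p] p by fastforce
  then show ?thesis by simp
qed

lemma Legendre_minus_one:
  assumes p: "prime p" "p mod 4 = 1"
  shows "Legendre (-1) p = 1"
proof -
  have p2: "p > 2" using p prime_gt_1_int[OF p(1)] by (cases "p = 2") auto
  have "even ((nat p - 1) div 2)"
  proof -
    obtain k where k: "p = 4 * k + 1" using p(2) by (metis mult_div_mod_eq)
    then have "nat p - 1 = 4 * nat k" using p2 by simp
    then show ?thesis by simp
  qed
  then have "[Legendre (-1) p = 1] (mod p)" using euler_criterion_int[OF p(1) p2, of "-1"] by simp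
  then have "p dvd Legendre (-1) p - 1" by (simp add: cong_iff_dvd_diff)
  moreover have "\<bar>Legendre (-1) p - 1\<bar> \<le> 2" using Legendre_values[of "-1" p] by auto
  ultimately show ?thesis using dvd_imp_le_int[of "Legendre (-1) p - 1" p] p2 by fastforce
qed

text \<open>Modulo \<open>p\<close> the form says that \<open>a\<close> times a nonzero square is 1
  or -1, and -1 is a residue since \<open>p\<close> is 1 modulo 4.\<close>

lemma Legendre_eq_1_of_form:
  assumes p: "prime p" "p mod 4 = 1" and eq: "a * x\<^sup>2 = s + p * t" "s = 1 \<or> s = -1"
  shows "Legendre a p = 1"
proof -
  have p2: "p > 2" using p prime_gt_1_int[OF p(1)] by (cases "p = 2") auto
  have nx: "\<not> p dvd x"
  proof
    assume "p dvd x"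
    then have "p dvd a * x\<^sup>2 - p * t" by (simp add: power2_eq_square)
    then have "p dvd s" unfolding eq(1) by simp
    then show False using eq(2) p(1) by (auto simp: not_prime_unit)
  qed
  have "[a * x\<^sup>2 = s] (mod p)" unfolding eq(1) by (simp add: cong_iff_dvd_diff)
  then have "Legendre (a * x\<^sup>2) p = Legendre s p" by (rule Legendre_cong)
  also have "\<dots> = 1"
  proof -
    have "\<not> p dvd 1" using p(1) by (auto simp: not_prime_unit)
    then have "Legendre 1 p = 1"
      unfolding Legendre_def QuadRes_def by (auto simp: cong_0_iff intro!: exI[of _ 1])
    then show ?thesis using Legendre_minus_one[OF p] eq(2) by auto
  qed
  finally have "Legendre a p * Legendre (x\<^sup>2) p = 1" using Legendre_mult[OF p(1) p2] by simp
  moreover have "Legendre (x\<^sup>2) p = 1"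
  proof -
    have "\<not> p dvd x\<^sup>2" using nx p(1) prime_dvd_power by blast
    then show ?thesis unfolding Legendre_def QuadRes_def by (auto simp: cong_0_iff intro!: exI[of _ x])
  qed
  ultimately show ?thesis by simp
qed

lemma int_dvd_prime:
  fixes a p :: int
  assumes "prime p" "a dvd p"
  shows "\<bar>a\<bar> = 1 \<or> \<bar>a\<bar> = p"
proof -
  have "\<bar>a\<bar> dvd p" "\<bar>a\<bar> \<ge> 0" using assms by auto
  then show ?thesis using assms(1) by (auto simp: prime_int_iff)
qed

text \<open>Comparing exponents of the real number \<open>c > 1\<close> would give 2 n = 1. Hence a
  fundamental unit is not a square in its own field.\<close>

lemma power_int_square_neq:
  fixes n :: int
  assumes "Re c > 1" "c \<in> \<real>" "v = c powi n \<or> v = - (c powi n)"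
  shows "v\<^sup>2 \<noteq> c"
proof
  assume v: "v\<^sup>2 = c"
  obtain \<gamma> where \<gamma>: "c = of_real \<gamma>" using assms(2) by (elim Reals_cases)
  have g1: "\<gamma> > 1" using assms(1) \<gamma> by simp
  have "v * v = c powi n * c powi n" using assms(3) by auto
  then have "c powi n * c powi n = c powi 1" using v by (simp add: power2_eq_square)
  moreover have "c \<noteq> 0" using g1 \<gamma> by simp
  ultimately have "c powi (n + n) = c powi 1" by (subst power_int_add) auto
  then have "complex_of_real (\<gamma> powi (n + n)) = of_real (\<gamma> powi 1)" unfolding \<gamma> by (simp only: of_real_power_int)
  then have "\<gamma> powi (n + n) = \<gamma> powi 1" by (simp only: of_real_eq_iff)
  then have "\<gamma> powr real_of_int (n + n) = \<gamma> powr real_of_int 1"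
    using g1 powr_real_of_int'[of \<gamma> "n + n"] powr_real_of_int'[of \<gamma> 1] by simp
  then have "real_of_int (n + n) = real_of_int 1"
    using g1 powr_inj[of \<gamma> "real_of_int (n + n)" "real_of_int 1"] by simp
  then have "n + n = 1" by (simp only: of_int_eq_iff)
  then show False by presburger
qed

text \<open>Here \<open>q = p1 p2\<close> and \<open>d = 2 p1 p2\<close>; the sublocales \<open>A\<close>, \<open>B\<close>, \<open>D\<close> below are the real
  quadratic fields of radicand \<open>2\<close>, \<open>q\<close>, \<open>d\<close>, and \<open>A.F\<close>, \<open>A.Fi\<close> etc. denote such a field
  and its extension by \<open>\<i>\<close>. In particular \<open>k = D.Fi\<close>, and \<open>L\<close> is the field \<open>K3\<close>.\<close>
locale capitulation =
  fixes p1 p2 :: int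
  assumes prime: "prime p1" "prime p2" and neq: "p1 \<noteq> p2"
    and mod4: "p1 mod 4 = 1" "p2 mod 4 = 1"
    and Legendre_cond: "(Legendre p1 p2 = -1 \<and> Legendre 2 p1 = -1) \<or>
         (Legendre p1 p2 = -1 \<and> Legendre 2 p2 = -1) \<or>
         (Legendre 2 p1 = -1 \<and> Legendre 2 p2 = -1)"
begin

lemma gt2: "p1 > 2" "p2 > 2"
  using mod4 prime_gt_1_int[OF prime(1)] prime_gt_1_int[OF prime(2)]
  by (cases "p1 = 2"; cases "p2 = 2"; simp)+

definition q :: int where "q = p1 * p2"
definition d :: int where "d = 2 * q"

lemma q_mod4: "q mod 4 = 1"
  unfolding q_def using mod4 mod_mult_eq[of p1 4 p2] by simp

lemma coprime: "coprime p1 p2" "coprime 2 p1" "coprime 2 p2" "coprime 2 q"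
proof -
  show "coprime p1 p2" using prime neq by (simp add: primes_coprime)
  have "odd p1" "odd p2" "odd q" using mod4 q_mod4 by presburger+
  then show "coprime 2 p1" "coprime 2 p2" "coprime 2 q" by (simp_all)
qed

lemma squarefree_q: "squarefree q"
  unfolding q_def using prime coprime
  by (intro squarefree_mult_coprime squarefree_prime_elem) (auto intro: prime_imp_prime_elem)

lemma squarefree_d: "squarefree d"
  unfolding d_def
  by (rule squarefree_mult_coprime[OF coprime(4) _ squarefree_q])
    (auto intro: squarefree_prime_elem prime_imp_prime_elem)

lemma q_gt: "q > 4"
proof -
  have "p1 * p2 \<ge> 3 * 3" using gt2 by (intro mult_mono) auto
  then show ?thesis by (simp add: q_def)
qed

sublocale A: real_quadratic 2
  by unfold_locales (auto intro: squarefree_prime_elem prime_imp_prime_elem)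

sublocale B: real_quadratic q
  by unfold_locales (use q_gt squarefree_q in auto)

sublocale D: real_quadratic d
  by unfold_locales (use q_gt squarefree_d in \<open>auto simp: d_def\<close>)

lemma Legendre_reciprocity: "Legendre p1 p2 = 1 \<longleftrightarrow> Legendre p2 p1 = 1"
proof -
  have n: "prime (nat p1)" "prime (nat p2)" using prime[THEN prime_int_nat_transfer[THEN iffD1]] by auto
  obtain k l where kl: "p1 = 4 * k + 1" "p2 = 4 * l + 1" using mod4 by (metis mult_div_mod_eq)
  have kl0: "k \<ge> 0" "l \<ge> 0" using kl gt2 by auto
  have "(p1 - 1) div 2 * ((p2 - 1) div 2) = 4 * (k * l)" using kl by simp
  then have "nat ((p1 - 1) div 2 * ((p2 - 1) div 2)) = 4 * nat (k * l)" using kl0 by (simp add: nat_mult_distrib)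
  then have "Legendre p1 p2 * Legendre p2 p1 = 1"
    using Quadratic_Reciprocity_int[OF n(1) gt2(1) n(2) gt2(2) neq] by simp
  then show ?thesis by auto
qed

lemma divisor_cases:
  assumes "r dvd d" "r > 0"
  shows "r \<in> {1, d, 2, q, p1, 2 * p2, p2, 2 * p1}"
proof -
  obtain a b where ab: "r = a * b" "a dvd 2" "b dvd q"
    using assms(1) unfolding d_def by (metis division_decomp)
  obtain b1 b2 where b: "b = b1 * b2" "b1 dvd p1" "b2 dvd p2"
    using ab(3) unfolding q_def by (metis division_decomp)
  have "r = \<bar>a\<bar> * (\<bar>b1\<bar> * \<bar>b2\<bar>)" using assms(2) ab b by (simp add: abs_mult[symmetric])
  moreover have "\<bar>a\<bar> = 1 \<or> \<bar>a\<bar> = 2" "\<bar>b1\<bar> = 1 \<or> \<bar>b1\<bar> = p1" "\<bar>b2\<bar> = 1 \<or> \<bar>b2\<bar> = p2"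
    using int_dvd_prime[of 2 a] int_dvd_prime[OF prime(1) b(2)] int_dvd_prime[OF prime(2) b(3)] ab(2) by auto
  ultimately show ?thesis by (auto simp: d_def q_def)
qed

text \<open>Modulo a prime dividing one of \<open>r\<close>, \<open>r'\<close>, the other has
  Legendre symbol 1. For each of the six nontrivial divisors this, with reciprocity and
  multiplicativity, makes two of the three symbols equal to 1, leaving at most one to be -1.\<close>

lemma form_divisor:
  assumes rd: "r * r' = d" "r > 0" and form: "r * x\<^sup>2 - r' * z\<^sup>2 = s" and s: "s = 1 \<or> s = -1"
  shows "r = 1 \<or> r = d"
proof (rule ccontr)
  assume neg: "\<not> (r = 1 \<or> r = d)"
  have A: "Legendre r p = 1" if pp: "prime p" "p mod 4 = 1" "p dvd r'" for p
  proof -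
    obtain c where "r' = p * c" using pp(3) by (elim dvdE)
    then have "r * x\<^sup>2 = s + p * (c * z\<^sup>2)" using form by (simp add: algebra_simps)
    then show ?thesis using Legendre_eq_1_of_form[OF pp(1,2) _ s] by simp
  qed
  have B: "Legendre r' p = 1" if pp: "prime p" "p mod 4 = 1" "p dvd r" for p
  proof -
    obtain c where "r = p * c" using pp(3) by (elim dvdE)
    then have "r' * z\<^sup>2 = - s + p * (c * x\<^sup>2)" using form by (simp add: algebra_simps)
    then show ?thesis using Legendre_eq_1_of_form[OF pp(1,2), of r' z "- s"] s by auto
  qed
  note M1 = Legendre_mult[OF prime(1) gt2(1)] and M2 = Legendre_mult[OF prime(2) gt2(2)]
  have r'_eq: "r' = c" if "r * c = d" for c
    using rd that by (metis mult_cancel_left less_irrefl)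
  have "r dvd d" using rd(1) by (metis dvd_triv_left)
  then consider "r = 2" | "r = q" | "r = p1" | "r = 2 * p2" | "r = p2" | "r = 2 * p1"
    using divisor_cases[of r] rd(2) neg by auto
  then show False
  proof cases
    case 1
    then have "r' = q" by (intro r'_eq) (simp add: d_def)
    then have "Legendre 2 p1 = 1" "Legendre 2 p2 = 1"
      using A[OF prime(1) mod4(1)] A[OF prime(2) mod4(2)] 1 by (auto simp: q_def)
    then show False using Legendre_cond by auto
  next
    case 2
    then have "r' = 2" by (intro r'_eq) (simp add: d_def)
    then have "Legendre 2 p1 = 1" "Legendre 2 p2 = 1"
      using B[OF prime(1) mod4(1)] B[OF prime(2) mod4(2)] 2 by (auto simp: q_def)
    then show False using Legendre_cond by auto
  next
    case 3
    then have r': "r' = 2 * p2" by (intro r'_eq) (simp add: d_def q_def)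
    have "Legendre p1 p2 = 1" "Legendre (2 * p2) p1 = 1"
      using A[OF prime(2) mod4(2)] B[OF prime(1) mod4(1)] 3 r' by auto
    then show False using Legendre_cond Legendre_reciprocity M1 by auto
  next
    case 4
    then have r': "r' = p1" by (intro r'_eq) (simp add: d_def q_def)
    have "Legendre p1 p2 = 1" "Legendre (2 * p2) p1 = 1"
      using B[OF prime(2) mod4(2)] A[OF prime(1) mod4(1)] 4 r' by auto
    then show False using Legendre_cond Legendre_reciprocity M1 by auto
  next
    case 5
    then have r': "r' = 2 * p1" by (intro r'_eq) (simp add: d_def q_def)
    have "Legendre p2 p1 = 1" "Legendre (2 * p1) p2 = 1"
      using A[OF prime(1) mod4(1)] B[OF prime(2) mod4(2)] 5 r' by auto
    then show False using Legendre_cond Legendre_reciprocity M2 by auto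
  next
    case 6
    then have r': "r' = p2" by (intro r'_eq) (simp add: d_def q_def)
    have "Legendre p2 p1 = 1" "Legendre (2 * p1) p2 = 1"
      using B[OF prime(1) mod4(1)] A[OF prime(2) mod4(2)] 6 r' by auto
    then show False using Legendre_cond Legendre_reciprocity M2 by auto
  qed
qed

text \<open>Ramification makes \<open>r\<close> a divisor of \<open>d\<close>. The norm equation x^2
  - d z^2 = r or -r then forces \<open>r\<close> to divide \<open>x\<close>, and division by
  \<open>r\<close> produces the form excluded by \<open>form_divisor\<close>.\<close>

lemma D_square_times_unit:
  assumes y: "y \<in> ring_of_integers D.F" "y\<^sup>2 = of_int r * \<epsilon>" and \<epsilon>: "\<epsilon> \<in> unit_group D.F"
    and r: "squarefree r" "r > 0"
  shows "r = 1 \<or> r = d"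
proof -
  have ev: "even d" by (simp add: d_def)
  have "r dvd d"
  proof (rule squarefree_dvd[OF r(1)])
    show "p dvd d" if "prime p" "p dvd r" for p
      using D.odd_prime_dvd_of_square_times_unit[OF y \<epsilon> r(1) that] ev by (cases "p = 2") auto
  qed (use D.m_gt_1 in simp)
  then obtain r' where r': "d = r * r'" by (elim dvdE)
  obtain n t where nt: "y * D.\<tau> y = of_int n" "n = r \<or> n = - r"
    using D.square_times_unit[OF y \<epsilon>] r by blast
  obtain x z n' where xz: "x\<^sup>2 - d * z\<^sup>2 = n'" "y * D.\<tau> y = of_int n'"
    using D.integer_form_even[OF y(1) ev] by metis
  have n': "n' = n" using xz nt by simp
  have "x\<^sup>2 = n + r * (r' * z\<^sup>2)" using xz n' r' by (simp add: algebra_simps)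
  then have "r dvd x\<^sup>2" using nt(2) by auto
  then have "r dvd x" by (rule squarefree_dvd_square[OF r(1)])
  then obtain x' where x': "x = r * x'" by (elim dvdE)
  have eq: "r * (r * x'\<^sup>2 - r' * z\<^sup>2) = n" using xz n' r' x' by (simp add: power2_eq_square algebra_simps)
  define s where "s = r * x'\<^sup>2 - r' * z\<^sup>2"
  have "r * s = r * 1 \<or> r * s = r * (-1)" using eq nt(2) by (simp add: s_def)
  then have "s = 1 \<or> s = -1" using r(2) by (simp only: mult_cancel_left) auto
  then show ?thesis using form_divisor[of r r' x' z s] r' r(2) by (simp add: s_def)
qed

lemma D_norm_one_square:
  assumes "\<epsilon> \<in> unit_group D.F" "\<epsilon> * D.\<tau> \<epsilon> = 1" "Re \<epsilon> > 0"
  shows "\<exists>v\<in>unit_group D.F. v\<^sup>2 = \<epsilon>"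
proof -
  obtain r y where ry: "r > 0" "squarefree r" "y \<in> ring_of_integers D.F" "y\<^sup>2 = of_int r * \<epsilon>"
    using D.norm_one_unit_square_class[OF assms] by blast
  have yF: "y \<in> D.F" using ry(3) by (simp add: D.mem_ring_of_integers)
  have "\<exists>v\<in>D.F. v\<^sup>2 = \<epsilon>"
  proof (cases "r = 1")
    case True
    then show ?thesis using ry yF by (intro bexI[of _ y]) auto
  next
    case False
    then have "r = d" using D_square_times_unit[OF ry(3,4) assms(1) ry(2,1)] by simp
    then have "(y / D.rt)\<^sup>2 = \<epsilon>"
      using ry(4) D.rt_square D.m_gt_1 by (simp add: power_divide power2_eq_square)
    then show ?thesis using yF D.rt_F by (intro bexI[of _ "y / D.rt"]) auto
  qed
  then show ?thesis using D.unit_of_power[of _ 2] assms(1) by fastforce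
qed

text \<open>A fundamental unit of norm one would be a square by
  \<open>D_norm_one_square\<close>.\<close>

lemma D_norm_minus_one: "\<exists>c\<in>unit_group D.F. Re c > 1 \<and> c * D.\<tau> c = -1"
proof -
  obtain c where c: "c \<in> unit_group D.F" "Re c > 1"
    "\<And>u. u \<in> unit_group D.F \<Longrightarrow> \<exists>n::int. u = c powi n \<or> u = - (c powi n)"
    using D.fundamental_unit by blast
  have "c * D.\<tau> c \<noteq> 1"
  proof
    assume "c * D.\<tau> c = 1"
    then obtain v where v: "v \<in> unit_group D.F" "v\<^sup>2 = c" using D_norm_one_square[OF c(1)] c(2) by auto
    obtain n :: int where n: "v = c powi n \<or> v = - (c powi n)" using c(3)[OF v(1)] by blast
    then show False
      using power_int_square_neq[OF c(2) D.F_Reals[OF D.unitD(1)[OF c(1)]] n] v(2) by blast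
  qed
  then show ?thesis using c D.norm_unit[OF c(1)] by blast
qed

end

section \<open>The octic field and its automorphisms\<close>

context capitulation
begin

abbreviation "L \<equiv> field_gen {csqrt_int 2, csqrt_int q, \<i>}"
abbreviation "k \<equiv> D.Fi"

lemma rt_d: "D.rt = A.rt * B.rt"
  unfolding d_def by (rule csqrt_int_mult)

lemma rt_simps: "A.rt * A.rt = 2" "B.rt * B.rt = of_int q" "A.rt \<noteq> 0" "B.rt \<noteq> 0" "D.rt \<noteq> 0"
  using A.rt_square B.rt_square q_gt by (auto simp: d_def)

lemma irrational: "A.rt \<notin> \<rat>" "B.rt \<notin> \<rat>" "D.rt \<notin> \<rat>"
  by (rule csqrt_int_irrational; use A.m_gt_1 A.squarefree_m B.m_gt_1 B.squarefree_m D.m_gt_1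
      D.squarefree_m in simp)+

lemma A_notin_k: "A.rt \<notin> k"
proof
  assume "A.rt \<in> k"
  then have "A.rt \<in> qext \<rat> D.rt" using D.Fi_Reals D.F_eq by simp
  then have "A.rt \<in> \<rat> \<or> A.rt * D.rt \<in> \<rat>" by (rule D.Q.sqrt_in_qext) (simp add: rt_simps)
  moreover have "A.rt * D.rt = 2 * B.rt" unfolding rt_d using rt_simps by (simp flip: mult.assoc)
  ultimately have "2 * B.rt \<in> \<rat>" using irrational by simp
  then have "(2 * B.rt) / 2 \<in> \<rat>" by (intro Rats_divide) auto
  then show False using irrational by simp
qed

lemma A_notin_W: "A.rt \<notin> B.Fi"
proof
  assume "A.rt \<in> B.Fi"
  then have "A.rt \<in> qext \<rat> B.rt" using B.Fi_Reals B.F_eq by simp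
  then have "A.rt \<in> \<rat> \<or> A.rt * B.rt \<in> \<rat>" by (rule B.Q.sqrt_in_qext) (simp add: rt_simps)
  then show False using irrational rt_d by simp
qed

lemma B_notin_Z: "B.rt \<notin> A.Fi"
proof
  assume "B.rt \<in> A.Fi"
  then have "B.rt \<in> qext \<rat> A.rt" using A.Fi_Reals A.F_eq by simp
  then have "B.rt \<in> \<rat> \<or> B.rt * A.rt \<in> \<rat>" by (rule A.Q.sqrt_in_qext) (simp add: rt_simps)
  then show False using irrational rt_d by (simp add: mult.commute)
qed

sublocale L: subfield L
  by unfold_locales (rule is_subfield_field_gen)

lemma gens_L [simp]: "A.rt \<in> L" "B.rt \<in> L" "\<i> \<in> L" "D.rt \<in> L"
proof -
  show *: "A.rt \<in> L" "B.rt \<in> L" "\<i> \<in> L"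
    using field_gen_superset[of "{A.rt, B.rt, \<i>}"] by auto
  then show "D.rt \<in> L" by (simp add: rt_d)
qed

lemma subsets_L: "k \<subseteq> L" "A.Fi \<subseteq> L" "B.Fi \<subseteq> L" "A.F \<subseteq> L" "B.F \<subseteq> L" "D.F \<subseteq> L"
  by (rule field_gen_least[OF is_subfield_field_gen]; simp)+

sublocale S: quad_ext k A.rt
  by unfold_locales (use A_notin_k rt_simps is_subfield_field_gen in auto)

sublocale T1: quad_ext A.Fi B.rt
  by unfold_locales (use B_notin_Z rt_simps is_subfield_field_gen in auto)

sublocale T2: quad_ext B.Fi A.rt
  by unfold_locales (use A_notin_W rt_simps is_subfield_field_gen in auto)

abbreviation "\<sigma> \<equiv> qconj k A.rt"
abbreviation "\<tau>1 \<equiv> qconj A.Fi B.rt"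
abbreviation "\<tau>2 \<equiv> qconj B.Fi A.rt"

text \<open>The three quadratic subextensions over which \<open>\<sigma>\<close>,
  \<open>\<tau>1\<close> and \<open>\<tau>2\<close> are the conjugations; all three fix
  \<open>\<i>\<close>, and each is the product of the other two.\<close>

lemma L_eq: "L = qext k A.rt" "L = qext A.Fi B.rt" "L = qext B.Fi A.rt"
proof -
  let ?G = "field_gen {A.rt, D.rt, \<i>}"
  interpret G: subfield ?G by unfold_locales (rule is_subfield_field_gen)
  have g: "A.rt \<in> ?G" "D.rt \<in> ?G" "\<i> \<in> ?G" using field_gen_superset[of "{A.rt, D.rt, \<i>}"] by auto
  have "B.rt = D.rt / A.rt" using rt_simps by (simp add: rt_d)
  then have "B.rt \<in> ?G" using g by simp
  then have "L = ?G" by (intro field_gen_eqI) (use g in auto)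
  also have "\<dots> = qext k A.rt" by (rule S.field_gen_insert[OF refl])
  finally show "L = qext k A.rt" .
  have "L = field_gen {B.rt, A.rt, \<i>}" by (simp add: insert_commute)
  also have "\<dots> = qext A.Fi B.rt" by (rule T1.field_gen_insert[OF refl])
  finally show "L = qext A.Fi B.rt" .
  show "L = qext B.Fi A.rt" by (rule T2.field_gen_insert[OF refl])
qed

sublocale \<sigma>: quadratic_pair L k \<sigma>
proof unfold_locales
  show "k \<subseteq> L" by (rule subsets_L)
  show "is_hom_on L \<sigma>" by (rule hom_on.hom[OF S.hom_on_qconj, folded L_eq(1)])
  show "\<sigma> x = x \<longleftrightarrow> x \<in> k" if "x \<in> L" for x
    using S.qconj_fixed[of x] S.qconj_base[of x] that[unfolded L_eq(1)] by blast
  show "\<sigma> (\<sigma> x) = x" if "x \<in> L" for x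
    by (rule S.qconj_qconj[OF that[unfolded L_eq(1)]])
qed

sublocale \<tau>1: quadratic_pair L A.Fi \<tau>1
proof unfold_locales
  show "A.Fi \<subseteq> L" by (rule subsets_L)
  show "is_hom_on L \<tau>1" by (rule hom_on.hom[OF T1.hom_on_qconj, folded L_eq(2)])
  show "\<tau>1 x = x \<longleftrightarrow> x \<in> A.Fi" if "x \<in> L" for x
    using T1.qconj_fixed[of x] T1.qconj_base[of x] that[unfolded L_eq(2)] by blast
  show "\<tau>1 (\<tau>1 x) = x" if "x \<in> L" for x
    by (rule T1.qconj_qconj[OF that[unfolded L_eq(2)]])
qed

sublocale \<tau>2: quadratic_pair L B.Fi \<tau>2
proof unfold_locales
  show "B.Fi \<subseteq> L" by (rule subsets_L)
  show "is_hom_on L \<tau>2" by (rule hom_on.hom[OF T2.hom_on_qconj, folded L_eq(3)])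
  show "\<tau>2 x = x \<longleftrightarrow> x \<in> B.Fi" if "x \<in> L" for x
    using T2.qconj_fixed[of x] T2.qconj_base[of x] that[unfolded L_eq(3)] by blast
  show "\<tau>2 (\<tau>2 x) = x" if "x \<in> L" for x
    by (rule T2.qconj_qconj[OF that[unfolded L_eq(3)]])
qed

lemma cnj_L: "x \<in> L \<Longrightarrow> cnj x \<in> L"
  by (rule cnj_field_gen) auto

sublocale cj: hom_on L cnj
  by (rule hom_on_cnj[OF is_subfield_field_gen cnj_L])

lemma gens_sub: "D.rt \<in> k" "\<i> \<in> k" "A.rt \<in> A.Fi" "\<i> \<in> A.Fi" "B.rt \<in> B.Fi" "\<i> \<in> B.Fi"
  using field_gen_superset[of "{D.rt, \<i>}"] field_gen_superset[of "{A.rt, \<i>}"]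
    field_gen_superset[of "{B.rt, \<i>}"] by auto

lemma images [simp]:
  "\<sigma> A.rt = - A.rt" "\<sigma> B.rt = - B.rt" "\<sigma> D.rt = D.rt" "\<sigma> \<i> = \<i>"
  "\<tau>1 A.rt = A.rt" "\<tau>1 B.rt = - B.rt" "\<tau>1 D.rt = - D.rt" "\<tau>1 \<i> = \<i>"
  "\<tau>2 A.rt = - A.rt" "\<tau>2 B.rt = B.rt" "\<tau>2 D.rt = - D.rt" "\<tau>2 \<i> = \<i>"
proof -
  have B: "B.rt = D.rt / A.rt" using rt_simps by (simp add: rt_d)
  show s: "\<sigma> A.rt = - A.rt" "\<sigma> D.rt = D.rt" "\<sigma> \<i> = \<i>" by (simp_all add: gens_sub)
  show "\<sigma> B.rt = - B.rt" unfolding B by (simp add: s)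
  show t1: "\<tau>1 A.rt = A.rt" "\<tau>1 B.rt = - B.rt" "\<tau>1 \<i> = \<i>" by (simp_all add: gens_sub)
  show "\<tau>1 D.rt = - D.rt" unfolding rt_d by (simp add: t1)
  show t2: "\<tau>2 A.rt = - A.rt" "\<tau>2 B.rt = B.rt" "\<tau>2 \<i> = \<i>" by (simp_all add: gens_sub)
  show "\<tau>2 D.rt = - D.rt" unfolding rt_d by (simp add: t2)
qed

lemma hom_eq_L:
  assumes "hom_on L \<phi>" "hom_on L \<psi>" "\<phi> A.rt = \<psi> A.rt" "\<phi> B.rt = \<psi> B.rt" "\<phi> \<i> = \<psi> \<i>" "x \<in> L"
  shows "\<phi> x = \<psi> x"
  by (rule hom_on.hom_eq_on_gen[OF assms(1,2) refl _ assms(6)]) (use assms in auto)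

lemma \<tau>1_\<sigma>: "x \<in> L \<Longrightarrow> \<tau>1 (\<sigma> x) = \<tau>2 x"
  and \<sigma>_\<tau>1: "x \<in> L \<Longrightarrow> \<sigma> (\<tau>1 x) = \<tau>2 x"
  and \<tau>2_\<sigma>: "x \<in> L \<Longrightarrow> \<tau>2 (\<sigma> x) = \<tau>1 x"
  and \<sigma>_\<tau>2: "x \<in> L \<Longrightarrow> \<sigma> (\<tau>2 x) = \<tau>1 x"
  by (rule hom_eq_L; (intro \<sigma>.hom_comp \<tau>1.hom_comp \<tau>2.hom_comp \<sigma>.hom_on_axioms \<tau>1.hom_on_axioms \<tau>2.hom_on_axioms)?; simp)+

lemma cnj_comm: "x \<in> L \<Longrightarrow> \<sigma> (cnj x) = cnj (\<sigma> x)" "x \<in> L \<Longrightarrow> \<tau>1 (cnj x) = cnj (\<tau>1 x)"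
    "x \<in> L \<Longrightarrow> \<tau>2 (cnj x) = cnj (\<tau>2 x)"
  by (rule hom_eq_L; (intro cj.hom_comp \<sigma>.hom_comp \<tau>1.hom_comp \<tau>2.hom_comp \<sigma>.hom_on_axioms \<tau>1.hom_on_axioms \<tau>2.hom_on_axioms cj.hom_on_axioms)?; simp)+

lemma hom_Reals:
  assumes "x \<in> L" "x \<in> \<real>"
  shows "\<sigma> x \<in> \<real>" "\<tau>1 x \<in> \<real>" "\<tau>2 x \<in> \<real>"
  using cnj_comm[OF assms(1)] assms(2) by (simp_all add: Reals_cnj_iff)

lemma restrict_A:
  assumes "x \<in> A.F"
  shows "\<sigma> x = A.\<tau> x" "\<tau>1 x = x" "\<tau>2 x = A.\<tau> x"
proof -
  obtain y z where yz: "y \<in> \<rat>" "z \<in> \<rat>" "x = y + z * A.rt" using A.F_E[OF assms] .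
  then have yzL: "y \<in> L" "z \<in> L" by (auto intro: L.Rats)
  show "\<sigma> x = A.\<tau> x" "\<tau>1 x = x" "\<tau>2 x = A.\<tau> x"
    unfolding yz(3) using yz yzL by (simp_all add: A.\<tau>_eq \<sigma>.hom_Rats \<tau>1.hom_Rats \<tau>2.hom_Rats)
qed

lemma restrict_B:
  assumes "x \<in> B.F"
  shows "\<sigma> x = B.\<tau> x" "\<tau>1 x = B.\<tau> x" "\<tau>2 x = x"
proof -
  obtain y z where yz: "y \<in> \<rat>" "z \<in> \<rat>" "x = y + z * B.rt" using B.F_E[OF assms] .
  then have yzL: "y \<in> L" "z \<in> L" by (auto intro: L.Rats)
  show "\<sigma> x = B.\<tau> x" "\<tau>1 x = B.\<tau> x" "\<tau>2 x = x"
    unfolding yz(3) using yz yzL by (simp_all add: B.\<tau>_eq \<sigma>.hom_Rats \<tau>1.hom_Rats \<tau>2.hom_Rats)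
qed

lemma restrict_D:
  assumes "x \<in> D.F"
  shows "\<sigma> x = x" "\<tau>1 x = D.\<tau> x" "\<tau>2 x = D.\<tau> x"
proof -
  obtain y z where yz: "y \<in> \<rat>" "z \<in> \<rat>" "x = y + z * D.rt" using D.F_E[OF assms] .
  then have yzL: "y \<in> L" "z \<in> L" by (auto intro: L.Rats)
  show "\<sigma> x = x" "\<tau>1 x = D.\<tau> x" "\<tau>2 x = D.\<tau> x"
    unfolding yz(3) using yz yzL by (simp_all add: D.\<tau>_eq \<sigma>.hom_Rats \<tau>1.hom_Rats \<tau>2.hom_Rats)
qed

lemma sqrt_prime_notin_A:
  assumes "prime p" "odd p"
  shows "csqrt_int p \<notin> A.Fi"
proof
  assume "csqrt_int p \<in> A.Fi"
  then have "csqrt_int p \<in> qext \<rat> A.rt" using A.Fi_Reals A.F_eq by simp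
  moreover have p: "p > 1" using assms prime_gt_1_int by simp
  ultimately have "csqrt_int p \<in> \<rat> \<or> csqrt_int p * A.rt \<in> \<rat>"
    by (intro A.Q.sqrt_in_qext) (simp_all add: csqrt_int_square)
  moreover have sp: "squarefree p" using assms by (auto intro: squarefree_prime_elem prime_imp_prime_elem)
  moreover have "squarefree (p * 2)"
    using assms by (intro squarefree_mult_coprime sp) (auto intro: squarefree_prime_elem prime_imp_prime_elem)
  ultimately show False
    using csqrt_int_irrational[of p] csqrt_int_irrational[of "p * 2"] p by (simp add: csqrt_int_mult)
qed

text \<open>Otherwise the root of p1 or that of p2 would lie in \<open>A.Fi\<close>, because
  \<open>\<surd>p1 \<cdot> \<surd>q\<close> is p1 times the root of p2. This separates the square
  classes of 1 and p1 in \<open>L\<close>.\<close>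

lemma sqrt_p1_notin_L: "csqrt_int p1 \<notin> L"
proof
  assume "csqrt_int p1 \<in> L"
  then have "csqrt_int p1 \<in> qext A.Fi B.rt" by (simp add: L_eq(2))
  then have *: "csqrt_int p1 \<in> A.Fi \<or> csqrt_int p1 * B.rt \<in> A.Fi"
    by (rule T1.sqrt_in_qext) (use gt2 in \<open>simp add: csqrt_int_square\<close>)
  have odd: "odd p1" "odd p2" using mod4 by presburger+
  have "csqrt_int p1 * B.rt = csqrt_int p1 * csqrt_int p1 * csqrt_int p2"
    by (simp add: q_def csqrt_int_mult)
  also have "\<dots> = of_int p1 * csqrt_int p2" using gt2 by (simp add: csqrt_int_square)
  finally have "csqrt_int p1 \<in> A.Fi \<or> of_int p1 * csqrt_int p2 \<in> A.Fi" using * by simp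
  moreover have "csqrt_int p2 \<in> A.Fi" if h: "of_int p1 * csqrt_int p2 \<in> A.Fi"
  proof -
    note sf = subfield.intro[OF is_subfield_field_gen]
    have "(of_int p1 * csqrt_int p2) / of_int p1 \<in> A.Fi"
      by (rule subfield.divide[OF sf h subfield.of_int[OF sf]])
    then show ?thesis using gt2 by simp
  qed
  ultimately show False using sqrt_prime_notin_A[OF prime(1) odd(1)] sqrt_prime_notin_A[OF prime(2) odd(2)] gt2
    by simp
qed

lemma rational_if_fixed:
  assumes "x \<in> L" "x \<in> \<real>" "\<sigma> x = x" "\<tau>1 x = x"
  shows "x \<in> \<rat>"
proof -
  have "x \<in> k" using assms \<sigma>.fixed_iff by simp
  then have xF: "x \<in> D.F" using assms(2) D.Fi_Reals by simp
  show ?thesis by (rule D.\<tau>_fixed[OF xF]) (use restrict_D(2)[OF xF] assms(4) in argo)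
qed

end

section \<open>The eighth root of unity and the units of the subfields of \<open>L\<close>\<close>

context capitulation
begin

lemma sf_L: "is_subfield L"
  by (rule is_subfield_field_gen)

definition \<zeta> :: complex where "\<zeta> = (1 + \<i>) / A.rt"

lemma \<zeta>_square: "\<zeta>\<^sup>2 = \<i>"
proof -
  have "\<zeta>\<^sup>2 = (1 + \<i>)\<^sup>2 / (A.rt * A.rt)" by (simp add: \<zeta>_def power_divide power2_eq_square)
  also have "(1 + \<i>)\<^sup>2 = 2 * \<i>" by (simp add: power2_eq_square algebra_simps)
  finally show ?thesis by (simp add: rt_simps)
qed

lemma \<zeta>_pow8: "\<zeta> ^ 8 = 1"
proof -
  have "\<zeta> ^ 8 = (\<zeta>\<^sup>2) ^ 4" by (simp flip: power_mult)
  then show ?thesis by (simp add: \<zeta>_square)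
qed

lemma one_plus_i: "1 + \<i> = \<zeta> * A.rt"
  by (simp add: \<zeta>_def rt_simps)

lemma \<zeta>_L [simp]: "\<zeta> \<in> L"
  by (simp add: \<zeta>_def)

lemma \<sigma>_\<zeta> [simp]: "\<sigma> \<zeta> = - \<zeta>"
  by (simp add: \<zeta>_def)

lemma \<zeta>_unit: "\<zeta> \<in> unit_group L"
  by (rule L.unit_of_power[of _ 8]) (simp_all add: \<zeta>_pow8 L.unit_one)

lemma \<zeta>_cnj: "\<zeta> * cnj \<zeta> = 1"
proof -
  have "(1 + \<i>) * (1 - \<i>) = 2" by (simp add: algebra_simps)
  then have "((1 + \<i>) * (1 - \<i>)) / (A.rt * A.rt) = 1" by (simp add: rt_simps)
  then show ?thesis by (simp add: \<zeta>_def)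
qed

text \<open>Here 2 is a square in the real subfield, so the exceptional alternative of
  \<open>unit_Fi\<close> merely contributes an odd power of \<open>\<zeta>\<close>.\<close>

lemma unit_Z:
  assumes "\<eta> \<in> unit_group A.Fi"
  shows "\<exists>j \<epsilon>. \<epsilon> \<in> unit_group A.F \<and> \<eta> = \<zeta> ^ j * \<epsilon>"
proof -
  consider (1) l \<epsilon> where "\<epsilon> \<in> unit_group A.F" "\<eta> = \<i> ^ l * \<epsilon>"
    | (2) l y \<epsilon> where "y \<in> A.F" "\<epsilon> \<in> unit_group A.F" "y\<^sup>2 = 2 * \<epsilon>" "(1 + \<i>) * \<eta> = \<i> ^ l * y"
    using A.unit_Fi[OF _ assms, simplified] by blast
  then show ?thesis
  proof cases
    case 1
    then have "\<eta> = \<zeta> ^ (2 * l) * \<epsilon>" by (simp add: power_mult \<zeta>_square)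
    then show ?thesis using 1 by blast
  next
    case 2
    define \<epsilon>' where "\<epsilon>' = y / A.rt"
    have "\<epsilon>'\<^sup>2 = \<epsilon>" using 2(3) rt_simps by (simp add: \<epsilon>'_def power_divide power2_eq_square)
    moreover have "\<epsilon>' \<in> A.F" using 2(1) A.rt_F by (simp add: \<epsilon>'_def)
    ultimately have \<epsilon>': "\<epsilon>' \<in> unit_group A.F" using A.unit_of_power[of \<epsilon>' 2] 2(2) by simp
    have "\<zeta> * A.rt * \<eta> = \<i> ^ l * \<epsilon>' * A.rt" using 2(4) rt_simps by (simp add: one_plus_i \<epsilon>'_def)
    then have z: "\<zeta> * \<eta> = \<i> ^ l * \<epsilon>'" using rt_simps by simp
    have "\<eta> = \<zeta> ^ 8 * \<eta>" by (simp add: \<zeta>_pow8)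
    also have "\<dots> = \<zeta> ^ 7 * (\<zeta> * \<eta>)" by (simp add: eval_nat_numeral)
    also have "\<dots> = \<zeta> ^ (7 + 2 * l) * \<epsilon>'" unfolding z by (simp add: power_add power_mult \<zeta>_square)
    finally show ?thesis using \<epsilon>' by blast
  qed
qed

lemma two_not_square_times_unit_B:
  assumes "y \<in> B.F" "\<epsilon> \<in> unit_group B.F" "y\<^sup>2 = 2 * \<epsilon>"
  shows False
proof -
  have "algebraic_int (y\<^sup>2)" unfolding assms(3) using B.unitD(3)[OF assms(2)] by (intro algebraic_int_mult) auto
  then have "algebraic_int y" by (rule algebraic_int_of_power) simp
  then have "y \<in> ring_of_integers B.F" using assms(1) by (simp add: B.mem_ring_of_integers)
  moreover have "squarefree (2::int)" by (rule A.squarefree_m)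
  ultimately show False using B.odd_of_square_times_unit[of y 2 \<epsilon>] assms q_mod4 by simp
qed

lemma unit_W:
  assumes "\<eta> \<in> unit_group B.Fi"
  shows "\<exists>l \<epsilon>. \<epsilon> \<in> unit_group B.F \<and> \<eta> = \<i> ^ l * \<epsilon>"
proof -
  have "q \<noteq> 3" using q_mod4 by auto
  from B.unit_Fi[OF this assms] show ?thesis using two_not_square_times_unit_B by blast
qed

lemma D_square_times_unit':
  assumes "y \<in> D.F" "\<epsilon> \<in> unit_group D.F" "y\<^sup>2 = of_int r * \<epsilon>" "squarefree r" "r > 0"
  shows "r = 1 \<or> r = d"
proof -
  have "algebraic_int (y\<^sup>2)" unfolding assms(3) using D.unitD(3)[OF assms(2)] by (intro algebraic_int_mult) auto
  then have "algebraic_int y" by (rule algebraic_int_of_power) simp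
  then have "y \<in> ring_of_integers D.F" using assms(1) by (simp add: D.mem_ring_of_integers)
  then show ?thesis using D_square_times_unit assms by blast
qed

lemma unit_k:
  assumes "\<eta> \<in> unit_group k"
  shows "\<exists>l \<epsilon>. \<epsilon> \<in> unit_group D.F \<and> \<eta> = \<i> ^ l * \<epsilon>"
proof -
  have "d \<noteq> 3" "d \<noteq> 2" using q_gt by (auto simp: d_def)
  moreover have False if "y \<in> D.F" "\<epsilon> \<in> unit_group D.F" "y\<^sup>2 = 2 * \<epsilon>" for y \<epsilon>
    using D_square_times_unit'[of y \<epsilon> 2] that A.squarefree_m \<open>d \<noteq> 2\<close> by simp
  ultimately show ?thesis using D.unit_Fi[OF _ assms] by blast
qed

text \<open>For the four-group of \<open>L\<close> over \<open>\<rat>(\<i>)\<close> one has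
  \<open>u\<^sup>2 = (u \<cdot> \<sigma> u) (u \<cdot> \<tau>1 u) / \<sigma> (u \<cdot> \<tau>2 u)\<close>.\<close>
lemma unit_square_decomposition:
  assumes u: "u \<in> unit_group L" "u * \<sigma> u = 1"
  shows "\<exists>j \<epsilon> \<delta>. \<epsilon> \<in> unit_group A.F \<and> \<delta> \<in> unit_group B.F \<and> u\<^sup>2 = \<zeta> ^ j * \<epsilon> * \<delta>"
proof -
  have uL: "u \<in> L" "u \<noteq> 0" by (rule L.unitD[OF u(1)])+
  have "u * \<tau>1 u \<in> unit_group L" using u(1) by (intro L.unit_mult \<tau>1.unit_hom)
  then have "u * \<tau>1 u \<in> unit_group A.Fi"
    using L.unit_sub[OF is_subfield_field_gen] \<tau>1.norm_in_k[OF uL(1)] by blast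
  then obtain j \<epsilon> where A: "\<epsilon> \<in> unit_group A.F" "u * \<tau>1 u = \<zeta> ^ j * \<epsilon>" using unit_Z by blast
  \<comment> \<open>sigma u times tau1 u is the norm of sigma u to \<open>B.Fi\<close>, because
    \<open>\<tau>2\<close> carries sigma u to tau1 u.\<close>
  define w where "w = inverse (\<sigma> u * \<tau>1 u)"
  have "w \<in> unit_group L" unfolding w_def using u(1)
    by (intro L.unit_inverse L.unit_mult \<tau>1.unit_hom \<sigma>.unit_hom)
  moreover have "\<tau>2 w = w" unfolding w_def using uL by (simp add: \<tau>2_\<sigma> mult.commute) 
      (metis \<sigma>_\<tau>1 \<tau>1.involution \<tau>1.hom_closed \<tau>2_\<sigma> \<tau>1_\<sigma> \<sigma>.involution \<sigma>.hom_closed)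
  ultimately have "w \<in> unit_group B.Fi"
    using L.unit_sub[OF is_subfield_field_gen] \<tau>2.fixed_iff[of w] L.unitD(1)[of w] by blast
  then obtain l \<delta> where B: "\<delta> \<in> unit_group B.F" "w = \<i> ^ l * \<delta>" using unit_W by blast
  have nz: "\<sigma> u \<noteq> 0" "\<tau>1 u \<noteq> 0" using uL by simp_all
  have "u\<^sup>2 = (u * \<sigma> u) * (u * \<tau>1 u) * w" unfolding w_def using nz by (simp add: power2_eq_square field_simps)
  also have "\<dots> = \<zeta> ^ (j + 2 * l) * \<epsilon> * \<delta>"
    unfolding u(2) A(2) B(2) by (simp add: power_add power_mult \<zeta>_square)
  finally show ?thesis using A(1) B(1) by blast
qed

lemma A_unit_norm_minus_one: "1 + A.rt \<in> unit_group A.F" "(1 + A.rt) * A.\<tau> (1 + A.rt) = -1"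
proof -
  let ?u = "1 + A.rt"
  have \<tau>: "A.\<tau> ?u = 1 - A.rt" using A.\<tau>_eq[of 1 1] by simp
  have n: "?u * (1 - A.rt) = -1" using rt_simps by (simp add: algebra_simps)
  show "?u * A.\<tau> ?u = -1" unfolding \<tau> by (rule n)
  have "?u * (- (1 - A.rt)) = 1" by (simp only: mult_minus_right n) simp
  then have "inverse ?u = - (1 - A.rt)" by (rule inverse_unique)
  moreover have "algebraic_int ?u" "algebraic_int (- (1 - A.rt))"
    by (intro algebraic_int_add algebraic_int_minus algebraic_int_diff algebraic_int_csqrt_int; simp)+
  moreover have "?u \<noteq> 0" using n by auto
  ultimately show "?u \<in> unit_group A.F" using A.rt_F by (simp add: A.mem_unit_group)
qed

end

section \<open>Units of \<open>L\<close> of relative norm one over \<open>k\<close>\<close>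

lemma power_int_minus_one_cases: "(- 1 :: complex) powi n = (if even n then 1 else - 1)"
  by (simp add: power_int_minus_left)

text \<open>The norm of \<open>a\<close> can be fixed since 1 + sqrt 2 has norm -1; that of
  \<open>b\<close> stays open and drives the later case distinctions.\<close>

locale capitulation_units = capitulation +
  fixes a b :: complex
  assumes a_unit: "a \<in> unit_group A.F" and a_gt: "Re a > 1" and a_norm: "a * A.\<tau> a = -1"
    and a_gen: "u \<in> unit_group A.F \<Longrightarrow> \<exists>n::int. u = a powi n \<or> u = - (a powi n)"
    and b_unit: "b \<in> unit_group B.F" and b_gt: "Re b > 1"
    and b_gen: "u \<in> unit_group B.F \<Longrightarrow> \<exists>n::int. u = b powi n \<or> u = - (b powi n)"
begin

lemma a_F: "a \<in> A.F" and b_F: "b \<in> B.F"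
  by (rule A.unitD[OF a_unit], rule B.unitD[OF b_unit])

lemma ab_L [simp]: "a \<in> L" "b \<in> L"
  using subsets_L a_F b_F by auto

lemma ab_nonzero [simp]: "a \<noteq> 0" "b \<noteq> 0"
  by (rule A.unitD[OF a_unit], rule B.unitD[OF b_unit])

lemma ab_unit_L: "a \<in> unit_group L" "b \<in> unit_group L"
  using A.unit_mono[OF sf_L subsets_L(4) a_unit] B.unit_mono[OF sf_L subsets_L(5) b_unit] by auto

lemma ab_Reals: "a \<in> \<real>" "b \<in> \<real>"
  using A.F_Reals[OF a_F] B.F_Reals[OF b_F] by auto

lemma a_images: "a * \<sigma> a = -1" "\<tau>1 a = a" "a * \<tau>2 a = -1"
  using restrict_A[OF a_F] a_norm by simp_all

lemma b_images: "\<sigma> b = B.\<tau> b" "\<tau>1 b = B.\<tau> b" "\<tau>2 b = b"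
  using restrict_B[OF b_F] by simp_all

lemma b_norm: "b * B.\<tau> b = 1 \<or> b * B.\<tau> b = -1"
  by (rule B.norm_unit[OF b_unit])

text \<open>Ramification makes \<open>r\<close> a divisor of q. The values 1 and q would make the
  fundamental unit a square, and p2 is equivalent to p1 because q is a square in
  \<open>B.F\<close>.\<close>

lemma p1_b_square:
  assumes "b * B.\<tau> b = 1"
  shows "\<exists>y\<in>B.F. y\<^sup>2 = of_int p1 * b"
proof -
  obtain r y where ry: "r > 0" "squarefree r" "y \<in> ring_of_integers B.F" "y\<^sup>2 = of_int r * b"
    using B.norm_one_unit_square_class[OF b_unit assms] b_gt by auto
  have yF: "y \<in> B.F" using ry(3) by (simp add: B.mem_ring_of_integers)
  have nsq: "v\<^sup>2 \<noteq> b" if "v \<in> B.F" for v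
  proof
    assume v: "v\<^sup>2 = b"
    then have "v \<in> unit_group B.F" using B.unit_of_power[OF that, of 2] b_unit by simp
    then show False using b_gen power_int_square_neq[OF b_gt ab_Reals(2)] v by blast
  qed
  have "r dvd q"
  proof (rule squarefree_dvd[OF ry(2)])
    fix p :: int assume p: "prime p" "p dvd r"
    have "odd r" by (rule B.odd_of_square_times_unit[OF ry(3,4) b_unit ry(2) q_mod4])
    then have "p \<noteq> 2" using p(2) by auto
    then show "p dvd q" using B.odd_prime_dvd_of_square_times_unit[OF ry(3,4) b_unit ry(2) p] by simp
  qed (use q_gt in simp)
  then obtain b1 b2 where b12: "r = b1 * b2" "b1 dvd p1" "b2 dvd p2"
    unfolding q_def by (metis division_decomp)
  have "r = \<bar>b1\<bar> * \<bar>b2\<bar>" using ry(1) b12 by (simp flip: abs_mult)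
  moreover have "\<bar>b1\<bar> = 1 \<or> \<bar>b1\<bar> = p1" "\<bar>b2\<bar> = 1 \<or> \<bar>b2\<bar> = p2"
    using int_dvd_prime[OF prime(1) b12(2)] int_dvd_prime[OF prime(2) b12(3)] by auto
  ultimately consider "r = 1" | "r = p1" | "r = p2" | "r = q" by (auto simp: q_def)
  then show ?thesis
  proof cases
    case 1
    then show ?thesis using ry(4) nsq[OF yF] by simp
  next
    case 2
    then show ?thesis using ry(4) yF by blast
  next
    case 3
    have "(y * B.rt / of_int p2)\<^sup>2 = y\<^sup>2 * (B.rt * B.rt) / (of_int p2)\<^sup>2"
      by (simp add: power_mult_distrib power_divide power2_eq_square)
    also have "\<dots> = of_int p1 * b"
      unfolding ry(4) 3 rt_simps unfolding q_def using gt2 by (simp add: power2_eq_square field_simps)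
    finally show ?thesis using yF B.rt_F by (intro bexI[of _ "y * B.rt / of_int p2"]) simp_all
  next
    case 4
    have "(y / B.rt)\<^sup>2 = y\<^sup>2 / (B.rt * B.rt)" by (simp add: power_divide power2_eq_square)
    also have "\<dots> = b" unfolding ry(4) 4 rt_simps using q_gt by simp
    finally show ?thesis using nsq[of "y / B.rt"] yF B.rt_F by simp
  qed
qed

text \<open>A root of \<open>b\<close>, compared with the root of p1 b, would put the root of p1
  into \<open>L\<close>.\<close>

lemma b_not_square_in_L:
  assumes "b * B.\<tau> b = 1" "v \<in> L"
  shows "v\<^sup>2 \<noteq> b"
proof
  assume v: "v\<^sup>2 = b"
  obtain y where y: "y \<in> B.F" "y\<^sup>2 = of_int p1 * b" using p1_b_square[OF assms(1)] by blast
  have "(y / v)\<^sup>2 = csqrt_int p1 * csqrt_int p1"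
    using y(2) v gt2 by (simp add: power_divide csqrt_int_square)
  then have or: "y / v = csqrt_int p1 \<or> y / v = - csqrt_int p1"
    unfolding power2_eq_square square_eq_iff .
  have "y \<in> L" using y(1) subsets_L(5) by (rule rev_subsetD)
  then have "y / v \<in> L" using assms(2) by (rule L.divide)
  with or have "csqrt_int p1 \<in> L" using L.uminus_iff[of "csqrt_int p1"] by metis
  then show False using sqrt_p1_notin_L by contradiction
qed

text \<open>Over \<open>k\<close> the unit \<open>a\<close> has norm -1, so whichever of
  \<open>a b\<close> and \<open>b\<close> is chosen here has relative norm one.\<close>

definition w :: complex where "w = (if b * B.\<tau> b = -1 then a * b else b)"

text \<open>Write u^2 as a root of unity times c = a^n b^m. Relative norm one reduces that root to a
  sign, so \<open>c\<close> is a square in \<open>L\<close>, which forces \<open>n\<close> and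
  \<open>m\<close> to be even. Dividing \<open>u\<close> by the resulting powers leaves a fourth
  root of unity, itself determined up to sign by its relative norm.\<close>

lemma relative_norm_one_unit:
  assumes u: "u \<in> unit_group L" "u * \<sigma> u = 1"
  shows "\<exists>s t :: int. u = (\<i> * a) powi s * w powi t \<or> u = - ((\<i> * a) powi s * w powi t)"
proof -
  have uL: "u \<in> L" "u \<noteq> 0" by (rule L.unitD[OF u(1)])+
  obtain \<alpha> \<beta> where re: "a = of_real \<alpha>" "b = of_real \<beta>" using ab_Reals by (auto elim!: Reals_cases)
  have pos: "\<alpha> > 0" "\<beta> > 0" using a_gt b_gt re by auto
  have m1: "- z = \<zeta> ^ 4 * z" for z
  proof -
    have "\<zeta> ^ 4 = (\<zeta>\<^sup>2)\<^sup>2" by (simp flip: power_mult)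
    then show ?thesis by (simp add: \<zeta>_square)
  qed
  obtain j \<epsilon> \<delta> where jed: "\<epsilon> \<in> unit_group A.F" "\<delta> \<in> unit_group B.F" "u\<^sup>2 = \<zeta> ^ j * \<epsilon> * \<delta>"
    using unit_square_decomposition[OF u] by blast
  obtain n :: int where n: "\<epsilon> = a powi n \<or> \<epsilon> = - (a powi n)" using a_gen[OF jed(1)] by blast
  obtain m :: int where m: "\<delta> = b powi m \<or> \<delta> = - (b powi m)" using b_gen[OF jed(2)] by blast
  define c where "c = a powi n * b powi m"
  have "\<exists>j. u\<^sup>2 = \<zeta> ^ j * c"
  proof -
    have "u\<^sup>2 = \<zeta> ^ j * c \<or> u\<^sup>2 = - (\<zeta> ^ j * c)" using n m jed(3) by (auto simp: c_def)
    then show ?thesis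
    proof
      assume "u\<^sup>2 = - (\<zeta> ^ j * c)"
      then have "u\<^sup>2 = \<zeta> ^ (4 + j) * c" unfolding m1[of "\<zeta> ^ j * c"] by (simp add: power_add)
      then show ?thesis by blast
    qed blast
  qed
  then obtain j where u2: "u\<^sup>2 = \<zeta> ^ j * c" by blast
  define \<gamma> where "\<gamma> = \<alpha> powi n * \<beta> powi m"
  have c: "c = of_real \<gamma>" "\<gamma> > 0" using pos by (simp_all add: c_def \<gamma>_def re)
  have cL: "c \<in> L" "c \<noteq> 0" by (simp_all add: c_def)
  \<comment> \<open>The root of unity disappears in absolute values, and both sides are positive.
    This transfers relative norm one from \<open>u\<close> to \<open>c\<close>.\<close>
  have uu: "u * cnj u = c"
  proof -
    have "(u * cnj u)\<^sup>2 = u\<^sup>2 * cnj (u\<^sup>2)" by (simp add: power_mult_distrib)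
    also have "\<dots> = (\<zeta> * cnj \<zeta>) ^ j * (c * c)" unfolding u2 by (simp add: power_mult_distrib c)
    finally have "(u * cnj u)\<^sup>2 = c * c" by (simp add: \<zeta>_cnj)
    moreover have U: "u * cnj u = of_real ((cmod u)\<^sup>2)" using complex_norm_square[of u] by simp
    ultimately have "complex_of_real (((cmod u)\<^sup>2)\<^sup>2) = of_real (\<gamma>\<^sup>2)"
      by (simp add: c power2_eq_square)
    then have "((cmod u)\<^sup>2)\<^sup>2 = \<gamma>\<^sup>2" by (simp only: of_real_eq_iff)
    from power_eq_imp_eq_base[OF this] have "(cmod u)\<^sup>2 = \<gamma>" using c(2) by simp
    then show ?thesis using U c by simp
  qed
  have cc: "c * \<sigma> c = 1"
  proof -
    have "c * \<sigma> c = (u * \<sigma> u) * cnj (u * \<sigma> u)"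
      unfolding uu[symmetric] using uL cnj_L cnj_comm(1) by (simp add: mult_ac)
    then show ?thesis by (simp add: u(2))
  qed
  have ccnm: "c * \<sigma> c = (-1) powi n * (b * B.\<tau> b) powi m"
  proof -
    have "c * \<sigma> c = (a * \<sigma> a) powi n * (b * \<sigma> b) powi m"
      by (simp add: c_def power_int_mult_distrib mult_ac)
    then show ?thesis by (simp add: a_images b_images)
  qed
  \<comment> \<open>Relative norms give (- i)^j = 1, as zeta times its conjugate under
    \<open>\<sigma>\<close> is - i. So 4 divides \<open>j\<close>, and zeta^4 = -1.\<close>
  have zj: "\<zeta> ^ j = 1 \<or> \<zeta> ^ j = -1"
  proof -
    have "(u * \<sigma> u)\<^sup>2 = u\<^sup>2 * \<sigma> (u\<^sup>2)" using uL by (simp add: power_mult_distrib)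
    also have "\<dots> = \<zeta> ^ j * (- \<zeta>) ^ j * (c * \<sigma> c)" unfolding u2 using cL by (simp add: mult_ac)
    also have "\<dots> = (\<zeta> * (- \<zeta>)) ^ j * (c * \<sigma> c)" by (simp only: power_mult_distrib)
    finally have e: "(u * \<sigma> u)\<^sup>2 = (\<zeta> * (- \<zeta>)) ^ j * (c * \<sigma> c)" .
    have zz: "\<zeta> * (- \<zeta>) = - \<i>" using \<zeta>_square by (simp add: power2_eq_square)
    have ij: "(- \<i>) ^ j = 1" using e unfolding u(2) cc zz by simp
    have "(- \<i>) ^ j = (- \<i>) ^ (4 * (j div 4) + j mod 4)" by simp
    also have "\<dots> = ((- \<i>) ^ 4) ^ (j div 4) * (- \<i>) ^ (j mod 4)"
      by (simp only: power_add power_mult)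
    finally have "(- \<i>) ^ (j mod 4) = 1" using ij by simp
    moreover have "j mod 4 = 0 \<or> j mod 4 = 1 \<or> j mod 4 = 2 \<or> j mod 4 = 3" by presburger
    moreover have "(- \<i>) ^ 1 \<noteq> 1" "(- \<i>) ^ 2 \<noteq> 1" "(- \<i>) ^ 3 \<noteq> 1"
      by (simp_all add: complex_eq_iff power2_eq_square power3_eq_cube)
    ultimately have "j mod 4 = 0" by metis
    then obtain l where "j = 4 * l" by auto
    then have "\<zeta> ^ j = (- 1) ^ l" using m1[of 1] by (simp add: power_mult)
    then show ?thesis by (simp add: minus_one_power_iff)
  qed
  have "\<exists>v\<in>L. v\<^sup>2 = c"
    using zj u2 uL by (auto intro: bexI[of _ u] bexI[of _ "\<i> * u"] simp: power_mult_distrib)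
  then obtain v where v: "v \<in> L" "v\<^sup>2 = c" by blast
  have vR: "v \<in> \<real>" using Reals_of_square_pos[of v \<gamma>] v c by simp
  \<comment> \<open>If \<open>b\<close> has norm 1, then n is even by \<open>cc\<close>, and an odd
    m would make \<open>b\<close> a square in \<open>L\<close>. If \<open>b\<close> has norm -1,
    \<open>n\<close> and \<open>m\<close> have equal parity, and for odd m the real number v times
    tau1 v would have a negative square.\<close>
  have even: "even n \<and> even m"
    using b_norm
  proof
    assume b1: "b * B.\<tau> b = 1"
    then have ev: "even n" using cc ccnm by (simp add: power_int_minus_one_cases split: if_splits)
    have "even m"
    proof (rule ccontr)
      assume "odd m"
      obtain n' where n': "n = n' + n'" using ev by (metis evenE mult_2)
      obtain m' where m': "m = m' + m' + 1" using \<open>odd m\<close> by (metis oddE mult_2)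
      have "a powi n = a powi n' * a powi n'" unfolding n' by (rule power_int_add) simp
      moreover have "b powi m = b powi (m' + m') * b" unfolding m' by (rule power_int_add_1) simp
      moreover have "b powi (m' + m') = b powi m' * b powi m'" by (rule power_int_add) simp
      ultimately have "v\<^sup>2 = (a powi n' * b powi m')\<^sup>2 * b"
        using v(2) by (simp add: c_def power2_eq_square mult_ac)
      then have "(v * inverse (a powi n') * inverse (b powi m'))\<^sup>2 = b"
        by (simp add: power_mult_distrib power_inverse field_simps)
      then show False using b_not_square_in_L[OF b1] v(1) by simp
    qed
    then show ?thesis using ev by simp
  next
    assume b1: "b * B.\<tau> b = -1"
    have nm: "even n = even m"
      using cc ccnm by (simp add: b1 power_int_minus_one_cases split: if_splits)
    have "even m"
    proof (rule ccontr)
      assume odd: "odd m"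
      have "v * \<tau>1 v \<in> \<real>" using vR hom_Reals(2)[OF v(1) vR] by (rule Reals_mult)
      then obtain \<rho> where \<rho>: "v * \<tau>1 v = of_real \<rho>" by (elim Reals_cases)
      have "(v * \<tau>1 v)\<^sup>2 = c * \<tau>1 c" using v by (simp add: power_mult_distrib flip: v(2))
      also have "\<dots> = (a powi n)\<^sup>2 * (b * B.\<tau> b) powi m"
        by (simp add: c_def a_images b_images power_int_mult_distrib power2_eq_square mult_ac)
      also have "\<dots> = - of_real ((\<alpha> powi n)\<^sup>2)"
        unfolding b1 using odd by (simp add: re(1) power_int_minus_one_cases)
      finally have "complex_of_real (\<rho>\<^sup>2) = of_real (- ((\<alpha> powi n)\<^sup>2))" unfolding \<rho> by simp
      then have "\<rho>\<^sup>2 = - ((\<alpha> powi n)\<^sup>2)" by (simp only: of_real_eq_iff)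
      moreover have "\<rho>\<^sup>2 \<ge> 0" "(\<alpha> powi n)\<^sup>2 > 0" using pos by simp_all
      ultimately show False by linarith
    qed
    then show ?thesis using nm by simp
  qed
  obtain n' where n': "n = n' + n'" using even by (metis evenE mult_2)
  obtain m' where m': "m = m' + m'" using even by (metis evenE mult_2)
  define x where "x = u * inverse (a powi n') * inverse (b powi m')"
  have ux: "u = x * (a powi n' * b powi m')" by (simp add: x_def field_simps)
  have xL: "x \<in> L" using uL by (simp add: x_def)
  have "a powi n = a powi n' * a powi n'" "b powi m = b powi m' * b powi m'"
    unfolding n' m' by (rule power_int_add; simp)+
  then have "x\<^sup>2 = u\<^sup>2 * inverse c"
    by (simp add: x_def c_def power2_eq_square mult_ac)
  then have "x\<^sup>2 = \<zeta> ^ j" using cL by (simp add: u2)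
  then have "x\<^sup>2 = 1\<^sup>2 \<or> x\<^sup>2 = \<i>\<^sup>2" using zj by simp
  then have "x \<in> {1, -1, \<i>, - \<i>}" unfolding power2_eq_iff by blast
  \<comment> \<open>\<open>x\<close> lies in \<open>k\<close>, so its square is its relative norm,
    which can be computed from those of \<open>u\<close>, \<open>a\<close> and
    \<open>b\<close>.\<close>
  then have "\<sigma> x = x" by auto
  then have "x\<^sup>2 = x * \<sigma> x" by (simp add: power2_eq_square)
  also have "\<dots> = (u * \<sigma> u) * inverse ((a * \<sigma> a) powi n') * inverse ((b * \<sigma> b) powi m')"
    using uL by (simp add: x_def power_int_mult_distrib mult_ac)
  also have "\<dots> = (-1) powi n' * (b * B.\<tau> b) powi m'"
    using b_norm by (auto simp: u(2) a_images b_images power_int_minus_one_cases)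
  finally have x2: "x\<^sup>2 = (-1) powi n' * (b * B.\<tau> b) powi m'" .
  have isq: "(\<i> powi s)\<^sup>2 = (-1) powi s" for s :: int
  proof -
    have "(\<i> powi s)\<^sup>2 = (\<i> * \<i>) powi s" by (simp only: power2_eq_square power_int_mult_distrib)
    then show ?thesis by simp
  qed
  show ?thesis
    using b_norm
  proof
    assume b1: "b * B.\<tau> b = 1"
    then have w: "w = b" by (simp add: w_def)
    have "x\<^sup>2 = (\<i> powi n')\<^sup>2" using x2 by (simp add: isq b1)
    then have "x = \<i> powi n' \<or> x = - (\<i> powi n')" by (simp add: power2_eq_iff)
    then have "u = (\<i> * a) powi n' * w powi m' \<or> u = - ((\<i> * a) powi n' * w powi m')"
      unfolding ux w by (auto simp: power_int_mult_distrib)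
    then show ?thesis by blast
  next
    assume b1: "b * B.\<tau> b = -1"
    then have w: "w = a * b" by (simp add: w_def)
    \<comment> \<open>The factor (a b)^m' already contains a^m', so i a must enter with exponent n'
      - m'; the powers of i then match because x^2 = (-1)^(n' - m').\<close>
    have "x\<^sup>2 = (\<i> powi (n' - m'))\<^sup>2" using x2 by (auto simp: isq b1 power_int_minus_one_cases)
    then have "x = \<i> powi (n' - m') \<or> x = - (\<i> powi (n' - m'))" by (simp add: power2_eq_iff)
    moreover have "(\<i> * a) powi (n' - m') * w powi m' = \<i> powi (n' - m') * (a powi n' * b powi m')"
      unfolding w by (simp add: power_int_mult_distrib power_int_diff)
    ultimately have "u = (\<i> * a) powi (n' - m') * w powi m' \<or> u = - ((\<i> * a) powi (n' - m') * w powi m')"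
      unfolding ux by auto
    then show ?thesis by blast
  qed
qed

end

section \<open>The real subfield of \<open>L\<close> and its unit index\<close>

context capitulation
begin

text \<open>The traces of \<open>M\<close> against the basis \<open>1\<close>, \<open>A.rt\<close>, \<open>B.rt\<close>, \<open>D.rt\<close> of the real subfield are all
  divisible by \<open>l\<close>, so \<open>4 d M / l\<close> is integral and \<open>l\<^sup>2\<close> divides \<open>16 d\<^sup>2 r\<close>.\<close>
lemma prime_dvd_d_of_square:
  assumes M: "M \<in> L" "M \<in> \<real>" "algebraic_int M" "M\<^sup>2 = of_int r * \<eta>"
    and \<eta>: "\<eta> \<in> unit_group L" and r: "squarefree r" and l: "prime l" "l dvd r"
  shows "l dvd d"
proof (rule ccontr)
  assume nd: "\<not> l dvd d"
  obtain r' where r': "r = l * r'" using l(2) by (elim dvdE)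
  have l0: "(of_int l :: complex) \<noteq> 0" using l(1) by auto
  have \<eta>L: "\<eta> \<in> L" by (rule L.unitD[OF \<eta>])
  define T where "T x = x + \<sigma> x + \<tau>1 x + \<tau>2 x" for x
  have T: "\<exists>t. T (M * g) = of_int (l * t)"
    if g: "g \<in> L" "g \<in> \<real>" "algebraic_int g" "g\<^sup>2 = of_int n" for g n
  proof -
    define x where "x = M * g"
    have x: "x \<in> L" "x \<in> \<real>" "algebraic_int x"
      using M(1-3) g(1-3) by (auto simp: x_def intro: Reals_mult algebraic_int_mult)
    have x2: "x\<^sup>2 = of_int l * (of_int (r' * n) * \<eta>)"
      unfolding x_def power_mult_distrib M(4) g(4) r' by simp
    have int_sq: "algebraic_int ((\<phi> x)\<^sup>2 / of_int l)" if "hom_on L \<phi>" for \<phi>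
    proof -
      interpret h: hom_on L \<phi> by fact
      have "(\<phi> x)\<^sup>2 = \<phi> (x\<^sup>2)" using x by simp
      also have "\<dots> = of_int l * (of_int (r' * n) * \<phi> \<eta>)" unfolding x2 using \<eta>L by simp
      finally have "(\<phi> x)\<^sup>2 / of_int l = of_int (r' * n) * \<phi> \<eta>" using l0 by simp
      moreover have "algebraic_int (\<phi> \<eta>)" using L.unitD(3)[OF h.unit_hom[OF \<eta>]] .
      ultimately show ?thesis by (simp only: algebraic_int_mult algebraic_int_of_int)
    qed
    have int_prod: "algebraic_int (\<phi> x * \<psi> x / of_int l)" if "hom_on L \<phi>" "hom_on L \<psi>" for \<phi> \<psi>
    proof (rule algebraic_int_of_power)
      have "(\<phi> x * \<psi> x / of_int l)\<^sup>2 = ((\<phi> x)\<^sup>2 / of_int l) * ((\<psi> x)\<^sup>2 / of_int l)"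
        by (simp add: power2_eq_square)
      then show "algebraic_int ((\<phi> x * \<psi> x / of_int l)\<^sup>2)"
        using algebraic_int_mult int_sq that by metis
    qed simp
    let ?id = "\<lambda>x. x"
    have homs: "hom_on L ?id" "hom_on L \<sigma>" "hom_on L \<tau>1" "hom_on L \<tau>2"
      by (rule hom_on_id[OF sf_L], rule \<sigma>.hom_on_axioms, rule \<tau>1.hom_on_axioms, rule \<tau>2.hom_on_axioms)
    have "(T x)\<^sup>2 / of_int l =
        (x * x / of_int l + x * \<sigma> x / of_int l + x * \<tau>1 x / of_int l + x * \<tau>2 x / of_int l) +
        (\<sigma> x * x / of_int l + \<sigma> x * \<sigma> x / of_int l + \<sigma> x * \<tau>1 x / of_int l + \<sigma> x * \<tau>2 x / of_int l) +
        (\<tau>1 x * x / of_int l + \<tau>1 x * \<sigma> x / of_int l + \<tau>1 x * \<tau>1 x / of_int l + \<tau>1 x * \<tau>2 x / of_int l) +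
        (\<tau>2 x * x / of_int l + \<tau>2 x * \<sigma> x / of_int l + \<tau>2 x * \<tau>1 x / of_int l + \<tau>2 x * \<tau>2 x / of_int l)"
      unfolding T_def add_divide_distrib[symmetric] by (simp add: power2_eq_square algebra_simps)
    moreover have "algebraic_int \<dots>"
      using int_prod[OF homs(1) homs(1)] int_prod[OF homs(1) homs(2)] int_prod[OF homs(1) homs(3)]
        int_prod[OF homs(1) homs(4)] int_prod[OF homs(2) homs(1)] int_prod[OF homs(2) homs(2)]
        int_prod[OF homs(2) homs(3)] int_prod[OF homs(2) homs(4)] int_prod[OF homs(3) homs(1)]
        int_prod[OF homs(3) homs(2)] int_prod[OF homs(3) homs(3)] int_prod[OF homs(3) homs(4)]
        int_prod[OF homs(4) homs(1)] int_prod[OF homs(4) homs(2)] int_prod[OF homs(4) homs(3)]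
        int_prod[OF homs(4) homs(4)]
      by (intro algebraic_int_add)
    ultimately have ai: "algebraic_int ((T x)\<^sup>2 / of_int l)" by simp
    have TL: "T x \<in> L" using x by (simp add: T_def)
    have TR: "T x \<in> \<real>" unfolding T_def using x hom_Reals[OF x(1,2)] by (intro Reals_add)
    have T\<sigma>: "\<sigma> (T x) = T x" using x \<sigma>.involution \<sigma>_\<tau>1 \<sigma>_\<tau>2 by (simp add: T_def)
    have T\<tau>: "\<tau>1 (T x) = T x"
    proof -
      have "\<tau>1 (\<tau>2 x) = \<sigma> x"
        using \<tau>1_\<sigma>[OF x(1)] \<tau>1.involution[of "\<sigma> x"] x by simp
      then show ?thesis using x \<tau>1.involution \<tau>1_\<sigma> by (simp add: T_def)
    qed
    have TQ: "T x \<in> \<rat>" by (rule rational_if_fixed[OF TL TR T\<sigma> T\<tau>])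
    have "algebraic_int (T x)"
      unfolding T_def using x by (intro algebraic_int_add \<sigma>.algebraic_int_hom \<tau>1.algebraic_int_hom \<tau>2.algebraic_int_hom)
    then obtain t where t: "T x = of_int t"
      using rational_algebraic_int_is_int TQ by (auto elim: Ints_cases)
    have "(T x)\<^sup>2 / of_int l \<in> \<rat>" using TQ by simp
    then obtain t' where "(T x)\<^sup>2 / of_int l = of_int t'"
      using rational_algebraic_int_is_int ai by (auto elim: Ints_cases)
    then have "(of_int (t\<^sup>2) :: complex) = of_int (l * t')" using l0 t by (simp add: field_simps)
    then have "t\<^sup>2 = l * t'" by (simp only: of_int_eq_iff)
    then have "l dvd t\<^sup>2" by simp
    then have "l dvd t" using l(1) prime_dvd_power by blast
    then show ?thesis using t by (auto simp: x_def elim!: dvdE)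
  qed
  have rd: "D.rt * D.rt = of_int d" by (rule D.rt_square)
  obtain t1 where t1: "T (M * 1) = of_int (l * t1)" using T[of 1 1] by auto
  obtain t2 where t2: "T (M * A.rt) = of_int (l * t2)"
    using T[of A.rt 2] rt_simps algebraic_int_csqrt_int by (auto simp: power2_eq_square)
  obtain t3 where t3: "T (M * B.rt) = of_int (l * t3)"
    using T[of B.rt q] rt_simps algebraic_int_csqrt_int by (auto simp: power2_eq_square)
  obtain t4 where t4: "T (M * D.rt) = of_int (l * t4)"
    using T[of D.rt d] rd algebraic_int_csqrt_int by (auto simp: power2_eq_square)
  \<comment> \<open>Expansion of M in the trace-dual basis, scaled: the trace against g, divided by
    l, is multiplied by g and by d / g^2, for g^2 = 1, 2, q, d. Orthogonality of the basis gives l N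
    = 4 d M.\<close>
  define N where "N = of_int (d * t1) + of_int (q * t2) * A.rt + of_int (2 * t3) * B.rt + of_int t4 * D.rt"
  have dq: "(of_int d :: complex) = 2 * of_int q" by (simp add: d_def)
  have e2: "of_int (l * t2) = A.rt * (M - \<sigma> M + \<tau>1 M - \<tau>2 M)"
    and e3: "of_int (l * t3) = B.rt * (M - \<sigma> M - \<tau>1 M + \<tau>2 M)"
    and e4: "of_int (l * t4) = D.rt * (M + \<sigma> M - \<tau>1 M - \<tau>2 M)"
    and e1: "of_int (l * t1) = M + \<sigma> M + \<tau>1 M + \<tau>2 M"
    using t1 t2 t3 t4 M(1) by (simp_all add: T_def algebra_simps)
  have "of_int l * N = of_int d * of_int (l * t1) + of_int q * A.rt * of_int (l * t2)
      + 2 * B.rt * of_int (l * t3) + D.rt * of_int (l * t4)"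
    by (simp add: N_def algebra_simps)
  also have "\<dots> = of_int d * (M + \<sigma> M + \<tau>1 M + \<tau>2 M) + of_int q * (A.rt * A.rt) * (M - \<sigma> M + \<tau>1 M - \<tau>2 M)
      + 2 * (B.rt * B.rt) * (M - \<sigma> M - \<tau>1 M + \<tau>2 M) + (D.rt * D.rt) * (M + \<sigma> M - \<tau>1 M - \<tau>2 M)"
    unfolding e1 e2 e3 e4 by (simp only: mult.assoc)
  also have "\<dots> = 4 * of_int d * M" unfolding rt_simps rd dq by (simp add: algebra_simps)
  finally have lN: "of_int l * N = 4 * of_int d * M" .
  have "algebraic_int N"
    unfolding N_def by (intro algebraic_int_add algebraic_int_mult algebraic_int_csqrt_int algebraic_int_of_int)
  moreover have "algebraic_int (inverse \<eta>)" by (rule L.unitD[OF \<eta>])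
  ultimately have ai: "algebraic_int (N * N * inverse \<eta>)" by (intro algebraic_int_mult)
  have "of_int l * of_int l * (N * N * inverse \<eta>) = (of_int l * N) * (of_int l * N) * inverse \<eta>"
    by (simp add: mult_ac)
  also have "\<dots> = 16 * of_int d * of_int d * (M\<^sup>2 * inverse \<eta>)"
    unfolding lN by (simp add: power2_eq_square)
  also have "M\<^sup>2 * inverse \<eta> = of_int r" unfolding M(4) using L.unitD(2)[OF \<eta>] by simp
  finally have eq: "of_int l * of_int l * (N * N * inverse \<eta>) = of_int (16 * d * d * r)" by simp
  then have "N * N * inverse \<eta> = of_int (16 * d * d * r) / (of_int l * of_int l)"
    using l0 by (simp add: field_simps)
  then have "N * N * inverse \<eta> \<in> \<rat>" by simp
  then obtain t where "N * N * inverse \<eta> = of_int t"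
    using rational_algebraic_int_is_int ai by (auto elim: Ints_cases)
  then have "(of_int (l * l * t) :: complex) = of_int (16 * d * d * r)" using eq by simp
  then have "l * l * t = 16 * d * d * r" by (simp only: of_int_eq_iff)
  then have "l\<^sup>2 dvd (16 * (d * d)) * r" by (metis dvd_triv_left mult.assoc power2_eq_square)
  moreover have "coprime l 2"
  proof -
    have "l \<noteq> 2" using nd by (auto simp: d_def)
    then show ?thesis using l(1) by (metis primes_coprime two_is_prime_nat prime_int_numeral_eq)
  qed
  then have "coprime l (2 ^ 4)" by (simp only: coprime_power_right_iff) simp
  then have "coprime l 16" by simp
  then have "coprime (l\<^sup>2) (16 * (d * d))"
    using prime_imp_coprime[OF l(1) nd] by simp
  ultimately have "l\<^sup>2 dvd r" by (simp add: coprime_dvd_mult_right_iff)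
  then have "l dvd 1" using r squarefreeD by blast
  then show False using l(1) by (simp add: not_prime_unit)
qed

abbreviation "Kp \<equiv> field_gen {csqrt_int 2, csqrt_int q}"

lemma Kp_Reals: "x \<in> Kp \<Longrightarrow> x \<in> \<real>"
  using field_gen_least[OF is_subfield_Reals, of "{A.rt, B.rt}"] by auto

lemma Kp_L: "Kp \<subseteq> L"
  by (rule field_gen_least[OF is_subfield_field_gen]) simp

lemma real_L_Kp:
  assumes "x \<in> L" "x \<in> \<real>"
  shows "x \<in> Kp"
proof -
  interpret I: quad_ext Kp \<i>
  proof
    show "\<i> * \<i> \<in> Kp" using subfield.uminus[OF subfield.intro[OF is_subfield_field_gen] subfield.one[OF subfield.intro[OF is_subfield_field_gen]]] by simp
    show "\<i> \<notin> Kp" using Kp_Reals[of \<i>] by (auto simp: complex_is_Real_iff)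
  qed (rule is_subfield_field_gen)
  have "L = qext Kp \<i>" using I.field_gen_insert[OF refl] by (simp add: insert_commute)
  then obtain y z where yz: "y \<in> Kp" "z \<in> Kp" "x = y + z * \<i>" using assms(1) I.qextE by metis
  have "Im y = 0" "Im z = 0" "Im x = 0"
    using Kp_Reals yz assms(2) by (auto simp: complex_is_Real_iff)
  then have "z = 0" using yz(3) by (simp add: complex_eq_iff)
  then show ?thesis using yz by simp
qed

definition U :: "complex set" where
  "U = set_prod (unit_group A.F) (set_prod (unit_group B.F) (unit_group D.F))"

lemma U_I: "\<alpha> \<in> unit_group A.F \<Longrightarrow> \<beta> \<in> unit_group B.F \<Longrightarrow> \<delta> \<in> unit_group D.F \<Longrightarrow> \<alpha> * (\<beta> * \<delta>) \<in> U"
  unfolding U_def set_prod_def by blast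

lemma U_E:
  assumes "x \<in> U"
  obtains \<alpha> \<beta> \<delta> where "\<alpha> \<in> unit_group A.F" "\<beta> \<in> unit_group B.F" "\<delta> \<in> unit_group D.F" "x = \<alpha> * (\<beta> * \<delta>)"
  using assms unfolding U_def set_prod_def by blast

lemma U_mult: "x \<in> U \<Longrightarrow> y \<in> U \<Longrightarrow> x * y \<in> U"
proof (elim U_E)
  fix \<alpha> \<beta> \<delta> \<alpha>' \<beta>' \<delta>'
  assume *: "\<alpha> \<in> unit_group A.F" "\<beta> \<in> unit_group B.F" "\<delta> \<in> unit_group D.F" "x = \<alpha> * (\<beta> * \<delta>)"
    "\<alpha>' \<in> unit_group A.F" "\<beta>' \<in> unit_group B.F" "\<delta>' \<in> unit_group D.F" "y = \<alpha>' * (\<beta>' * \<delta>')"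
  have "x * y = (\<alpha> * \<alpha>') * ((\<beta> * \<beta>') * (\<delta> * \<delta>'))" unfolding * by (simp add: mult_ac)
  then show "x * y \<in> U" using * by (simp only: U_I A.unit_mult B.unit_mult D.unit_mult)
qed

lemma U_inverse: "x \<in> U \<Longrightarrow> inverse x \<in> U"
proof (elim U_E)
  fix \<alpha> \<beta> \<delta>
  assume *: "\<alpha> \<in> unit_group A.F" "\<beta> \<in> unit_group B.F" "\<delta> \<in> unit_group D.F" "x = \<alpha> * (\<beta> * \<delta>)"
  have "inverse x = inverse \<alpha> * (inverse \<beta> * inverse \<delta>)" unfolding * by simp
  then show "inverse x \<in> U" using * by (simp only: U_I A.unit_inverse B.unit_inverse D.unit_inverse)
qed

lemma U_one: "1 \<in> U"
  using U_I[OF A.unit_one B.unit_one D.unit_one] by simp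

lemma U_nonzero: "x \<in> U \<Longrightarrow> x \<noteq> 0"
  using A.unitD(2) B.unitD(2) D.unitD(2) by (elim U_E) simp

lemma unit_index_eq: "unit_index_q 2 (p1 * p2) = group_index (unit_group Kp) U"
  unfolding unit_index_q_def Let_def U_def d_def q_def csqrt_int_def ..

lemma index_1:
  assumes "unit_index_q 2 (p1 * p2) = 1" "x \<in> unit_group Kp"
  shows "x \<in> U"
proof -
  have "card ((\<lambda>x. (\<lambda>u. x * u) ` U) ` unit_group Kp) = 1"
    using assms(1) unfolding unit_index_eq group_index_def .
  then obtain C where C: "(\<lambda>x. (\<lambda>u. x * u) ` U) ` unit_group Kp = {C}" by (rule card_1_singletonE)
  have one: "1 \<in> unit_group Kp" by (rule subfield.unit_one[OF subfield.intro[OF is_subfield_field_gen]])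
  have "(\<lambda>u. x * u) ` U = C" "(\<lambda>u. 1 * u) ` U = C"
    using imageI[OF assms(2), of "\<lambda>x. (\<lambda>u. x * u) ` U"] imageI[OF one, of "\<lambda>x. (\<lambda>u. x * u) ` U"]
    unfolding C by simp_all
  then have "(\<lambda>u. x * u) ` U = (\<lambda>u. 1 * u) ` U" by simp
  moreover have "x \<in> (\<lambda>u. x * u) ` U" using U_one by (intro image_eqI[of _ _ 1]) simp_all
  ultimately show ?thesis by simp
qed

lemma index_2:
  assumes "unit_index_q 2 (p1 * p2) = 2"
  shows "\<exists>x\<in>unit_group Kp. x \<notin> U"
proof (rule ccontr)
  assume neg: "\<not> ?thesis"
  have "(\<lambda>u. x * u) ` U = U" if x: "x \<in> unit_group Kp" for x
  proof
    have xU: "x \<in> U" using neg x by blast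
    then show "(\<lambda>u. x * u) ` U \<subseteq> U" by (intro image_subsetI U_mult)
    show "U \<subseteq> (\<lambda>u. x * u) ` U"
    proof
      fix u assume "u \<in> U"
      then have "inverse x * u \<in> U" using xU by (intro U_mult U_inverse)
      moreover have "u = x * (inverse x * u)" using U_nonzero[OF xU] by simp
      ultimately show "u \<in> (\<lambda>u. x * u) ` U" by (rule rev_image_eqI)
    qed
  qed
  then have "(\<lambda>x. (\<lambda>u. x * u) ` U) ` unit_group Kp \<subseteq> {U}" by auto
  then have "card ((\<lambda>x. (\<lambda>u. x * u) ` U) ` unit_group Kp) \<le> card {U}" by (intro card_mono) auto
  then show False using assms unfolding unit_index_eq group_index_def by simp
qed

text \<open>The four-group identity of \<open>unit_square_decomposition\<close> once more; for real
  \<open>x\<close> the three norms are units of the three real quadratic subfields.\<close>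

lemma real_unit_square:
  assumes x: "x \<in> unit_group L" "x \<in> \<real>"
  shows "\<exists>\<alpha> \<beta> \<delta>. \<alpha> \<in> unit_group A.F \<and> \<beta> \<in> unit_group B.F \<and> \<delta> \<in> unit_group D.F \<and> x\<^sup>2 = \<alpha> * (\<beta> * \<delta>)"
proof -
  have xL: "x \<in> L" "x \<noteq> 0" by (rule L.unitD[OF x(1)])+
  note R = hom_Reals[OF xL(1) x(2)]
  have u: "\<sigma> x \<in> unit_group L" "\<tau>1 x \<in> unit_group L"
    using x by (auto intro: \<sigma>.unit_hom \<tau>1.unit_hom)
  have \<alpha>: "x * \<tau>1 x \<in> unit_group A.F"
    using L.unit_sub[OF is_subfield_field_gen L.unit_mult[OF x(1) u(2)]]
      A.Fi_Reals[OF \<tau>1.norm_in_k[OF xL(1)] Reals_mult[OF x(2) R(2)]] by blast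
  have \<delta>: "x * \<sigma> x \<in> unit_group D.F"
    using L.unit_sub[OF is_subfield_field_gen L.unit_mult[OF x(1) u(1)]]
      D.Fi_Reals[OF \<sigma>.norm_in_k[OF xL(1)] Reals_mult[OF x(2) R(1)]] by blast
  define v where "v = \<sigma> x * \<tau>1 x"
  have v: "v \<in> unit_group L" "v \<in> \<real>" unfolding v_def using u R by (auto intro: L.unit_mult)
  have "\<tau>2 v = v"
    unfolding v_def using xL \<tau>2_\<sigma>[OF xL(1)] \<tau>2_\<sigma>[of "\<tau>2 x"] \<sigma>_\<tau>2[OF xL(1)] \<tau>2.involution[OF xL(1)]
      \<tau>2_\<sigma>[of "\<sigma> x"] \<sigma>.involution[OF xL(1)] \<tau>1_\<sigma>[of "\<sigma> x"] \<sigma>_\<tau>1[OF xL(1)] \<tau>1_\<sigma>[OF xL(1)]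
      \<tau>1.involution[of "\<sigma> x"] by (simp add: mult.commute)
  then have "v \<in> B.Fi" using \<tau>2.fixed_iff[of v] L.unitD(1)[OF v(1)] by blast
  then have "v \<in> unit_group B.F"
    using L.unit_sub[OF is_subfield_field_gen v(1)] B.Fi_Reals[OF _ v(2)] by blast
  then have \<beta>: "inverse v \<in> unit_group B.F" by (rule B.unit_inverse)
  have nz: "\<sigma> x \<noteq> 0" "\<tau>1 x \<noteq> 0" using xL by simp_all
  have "x\<^sup>2 = (x * \<tau>1 x) * (inverse v * (x * \<sigma> x))"
    unfolding v_def using nz by (simp add: power2_eq_square field_simps)
  then show ?thesis using \<alpha> \<beta> \<delta> by blast
qed

end

section \<open>What the two values of the unit index say about \<open>w\<close>\<close>

lemma real_square_neq_neg_square: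
  assumes "r \<in> \<real>" "s \<in> \<real>" "s \<noteq> (0 :: complex)"
  shows "r\<^sup>2 \<noteq> - (s\<^sup>2)"
proof
  obtain x y where xy: "r = of_real x" "s = of_real y" using assms(1,2) by (auto elim!: Reals_cases)
  assume "r\<^sup>2 = - (s\<^sup>2)"
  then have "complex_of_real (x\<^sup>2) = of_real (- (y\<^sup>2))" unfolding xy by simp
  then have "x\<^sup>2 = - (y\<^sup>2)" by (simp only: of_real_eq_iff)
  moreover have "x\<^sup>2 \<ge> 0" "y\<^sup>2 > 0" using assms(3) xy by simp_all
  ultimately show False by linarith
qed

lemma inverse_of_mult_unit:
  fixes x y :: complex
  assumes "x * y = 1 \<or> x * y = -1"
  shows "inverse y = x \<or> inverse y = - x"
  using assms
proof
  assume "x * y = 1"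
  then have "inverse y = x" by (intro inverse_unique) (simp add: mult.commute)
  then show ?thesis ..
next
  assume "x * y = -1"
  then have "inverse y = - x" by (intro inverse_unique) (simp add: mult.commute)
  then show ?thesis ..
qed

context capitulation_units
begin

lemma norm_a_power: "\<alpha> = a powi n \<or> \<alpha> = - (a powi n) \<Longrightarrow> \<alpha> * A.\<tau> \<alpha> = (- 1) powi n"
proof -
  have "a powi n * A.\<tau> (a powi n) = (a * A.\<tau> a) powi n"
    using a_F by (simp add: power_int_mult_distrib)
  then show "\<alpha> = a powi n \<or> \<alpha> = - (a powi n) \<Longrightarrow> \<alpha> * A.\<tau> \<alpha> = (- 1) powi n"
    using a_norm a_F by auto
qed

lemma norm_b_power: "\<beta> = b powi m \<or> \<beta> = - (b powi m) \<Longrightarrow> \<beta> * B.\<tau> \<beta> = (b * B.\<tau> b) powi m"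
proof -
  have "b powi m * B.\<tau> (b powi m) = (b * B.\<tau> b) powi m"
    using b_F by (simp add: power_int_mult_distrib)
  then show "\<beta> = b powi m \<or> \<beta> = - (b powi m) \<Longrightarrow> \<beta> * B.\<tau> \<beta> = (b * B.\<tau> b) powi m"
    using b_F by auto
qed

lemma w_nonzero [simp]: "w \<noteq> 0"
  by (simp add: w_def)

lemma power_int_double: "z \<noteq> 0 \<Longrightarrow> z powi (n + n) = (z powi n)\<^sup>2" for z :: complex
  by (simp only: power2_eq_square) (rule power_int_add, simp)

lemma power_int_double_Suc: "z \<noteq> 0 \<Longrightarrow> z powi (n + n + 1) = (z powi n)\<^sup>2 * z" for z :: complex
  using power_int_double[of z n] power_int_add_1[of z "n + n"] by simp

text \<open>Let \<open>x\<close> be a real unit outside \<open>U\<close> with x^2 = alpha beta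
  delta. Positivity makes the three norms equal. If they are 1, either \<open>x\<close> lies in
  \<open>U\<close> or \<open>b\<close> is a square in \<open>L\<close> up to sign, both impossible.
  If they are -1, then sigma x is x / (alpha beta) up to sign, and alpha beta is \<open>w\<close>
  times a square up to sign.\<close>

lemma index_2_unit:
  assumes "unit_index_q 2 (p1 * p2) = 2"
  shows "\<exists>y\<in>unit_group L. \<sigma> y = y * inverse w \<or> \<sigma> y = - (y * inverse w)"
proof -
  obtain x where x: "x \<in> unit_group Kp" "x \<notin> U" using index_2[OF assms] by blast
  have xu: "x \<in> unit_group L"
    by (rule subfield.unit_mono[OF subfield.intro[OF is_subfield_field_gen] sf_L Kp_L x(1)])
  have xL: "x \<in> L" "x \<noteq> 0" by (rule L.unitD[OF xu])+
  have xR: "x \<in> \<real>"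
    by (rule Kp_Reals, rule subfield.unitD(1)[OF subfield.intro[OF is_subfield_field_gen] x(1)])
  obtain \<alpha> \<beta> \<delta> where u: "\<alpha> \<in> unit_group A.F" "\<beta> \<in> unit_group B.F" "\<delta> \<in> unit_group D.F"
    and x2: "x\<^sup>2 = \<alpha> * (\<beta> * \<delta>)" using real_unit_square[OF xu xR] by blast
  have F: "\<alpha> \<in> A.F" "\<beta> \<in> B.F" "\<delta> \<in> D.F" using A.unitD(1)[OF u(1)] B.unitD(1)[OF u(2)] D.unitD(1)[OF u(3)] .
  have inL: "\<alpha> \<in> L" "\<beta> \<in> L" "\<delta> \<in> L" using F subsets_L(4-6) by blast+
  have nz: "\<alpha> \<noteq> 0" "\<beta> \<noteq> 0" "\<delta> \<noteq> 0" using A.unitD(2)[OF u(1)] B.unitD(2)[OF u(2)] D.unitD(2)[OF u(3)] .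
  have R: "\<alpha> \<in> \<real>" "\<beta> \<in> \<real>" "\<delta> \<in> \<real>" using A.F_Reals[OF F(1)] B.F_Reals[OF F(2)] D.F_Reals[OF F(3)] .
  define sA sB sD where "sA = \<alpha> * A.\<tau> \<alpha>" and "sB = \<beta> * B.\<tau> \<beta>" and "sD = \<delta> * D.\<tau> \<delta>"
  have s: "sA = 1 \<or> sA = -1" "sB = 1 \<or> sB = -1" "sD = 1 \<or> sD = -1"
    unfolding sA_def sB_def sD_def by (rule A.norm_unit[OF u(1)] B.norm_unit[OF u(2)] D.norm_unit[OF u(3)])+
  have "(x * \<sigma> x)\<^sup>2 = x\<^sup>2 * \<sigma> (x\<^sup>2)" using xL by (simp add: power_mult_distrib)
  also have "\<dots> = sA * sB * \<delta>\<^sup>2"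
    unfolding x2 sA_def sB_def using inL restrict_A(1)[OF F(1)] restrict_B(1)[OF F(2)] restrict_D(1)[OF F(3)]
    by (simp add: power2_eq_square mult_ac)
  finally have "(x * \<sigma> x)\<^sup>2 = sA * sB * \<delta>\<^sup>2" .
  \<comment> \<open>x times sigma x is real, so its square cannot be minus that of the real number
    \<open>\<delta>\<close>.\<close>
  then have "sA * sB \<noteq> -1"
    using real_square_neq_neg_square[OF Reals_mult[OF xR hom_Reals(1)[OF xL(1) xR]] R(3) nz(3)] by auto
  then have sAB: "sA = sB" using s by auto
  have "(x * \<tau>1 x)\<^sup>2 = x\<^sup>2 * \<tau>1 (x\<^sup>2)" using xL by (simp add: power_mult_distrib)
  also have "\<dots> = sB * sD * \<alpha>\<^sup>2"
    unfolding x2 sD_def sB_def using inL restrict_A(2)[OF F(1)] restrict_B(2)[OF F(2)] restrict_D(2)[OF F(3)]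
    by (simp add: power2_eq_square mult_ac)
  finally have "(x * \<tau>1 x)\<^sup>2 = sB * sD * \<alpha>\<^sup>2" .
  then have "sB * sD \<noteq> -1"
    using real_square_neq_neg_square[OF Reals_mult[OF xR hom_Reals(2)[OF xL(1) xR]] R(1) nz(1)] by auto
  then have sBD: "sB = sD" using s by auto
  obtain n :: int where n: "\<alpha> = a powi n \<or> \<alpha> = - (a powi n)" using a_gen[OF u(1)] by blast
  obtain m :: int where m: "\<beta> = b powi m \<or> \<beta> = - (b powi m)" using b_gen[OF u(2)] by blast
  have sAn: "sA = (-1) powi n" unfolding sA_def by (rule norm_a_power[OF n])
  have sBm: "sB = (b * B.\<tau> b) powi m" unfolding sB_def by (rule norm_b_power[OF m])
  show ?thesis
  proof (cases "sA = 1")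
    case True
    then have "even n" using sAn by (simp add: power_int_minus_one_cases split: if_splits)
    then obtain n' where n': "n = n' + n'" by (metis evenE mult_2)
    define \<alpha>' where "\<alpha>' = a powi n'"
    have \<alpha>'1: "\<alpha>' \<in> unit_group A.F"
      unfolding \<alpha>'_def by (intro A.unit_power_int a_unit)
    have \<alpha>'2: "\<alpha> = \<alpha>'\<^sup>2 \<or> \<alpha> = - (\<alpha>'\<^sup>2)"
      using n unfolding \<alpha>'_def n' by (simp only: power_int_double ab_nonzero not_False_eq_True)
    note \<alpha>' = \<alpha>'1 \<alpha>'2
    have sD1: "\<delta> * D.\<tau> \<delta> = 1" using True sAB sBD by (simp add: sD_def)
    have "\<exists>v\<in>unit_group D.F. v\<^sup>2 = \<delta> \<or> v\<^sup>2 = - \<delta>"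
    proof (cases "Re \<delta> > 0")
      case True
      then show ?thesis using D_norm_one_square[OF u(3) sD1] by blast
    next
      case False
      have "Re \<delta> \<noteq> 0" using R(3) nz(3) by (auto elim!: Reals_cases)
      then have "Re (- \<delta>) > 0" using False by simp
      moreover have "- \<delta> * D.\<tau> (- \<delta>) = 1" using sD1 F(3) by simp
      ultimately show ?thesis using D_norm_one_square[OF D.unit_uminus[OF u(3)]] by blast
    qed
    then obtain \<delta>' where \<delta>': "\<delta>' \<in> unit_group D.F" "\<delta>'\<^sup>2 = \<delta> \<or> \<delta>'\<^sup>2 = - \<delta>" by blast
    obtain m' where m': "m = m' + m' \<or> m = m' + m' + 1" by (metis evenE oddE mult_2)
    define z where "z = \<alpha>' * (b powi m' * \<delta>')"
    have zU: "z \<in> U" "- z \<in> U"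
      using U_I[OF \<alpha>'(1) B.unit_power_int[OF b_unit] \<delta>'(1)]
        U_I[OF A.unit_uminus[OF \<alpha>'(1)] B.unit_power_int[OF b_unit] \<delta>'(1)] by (simp_all add: z_def)
    have z0: "z \<noteq> 0" by (rule U_nonzero[OF zU(1)])
    have zR: "z \<in> \<real>" unfolding z_def
      using A.F_Reals[OF A.unitD(1)[OF \<alpha>'(1)]] D.F_Reals[OF D.unitD(1)[OF \<delta>'(1)]]
        B.F_Reals[OF B.unitD(1)[OF B.unit_power_int[OF b_unit, of m']]] by (intro Reals_mult)
    have zL: "z \<in> L" unfolding z_def
      using subsetD[OF subsets_L(4) A.unitD(1)[OF \<alpha>'(1)]] subsetD[OF subsets_L(6) D.unitD(1)[OF \<delta>'(1)]] by simp
    have z2: "z\<^sup>2 = \<alpha>'\<^sup>2 * ((b powi m')\<^sup>2 * \<delta>'\<^sup>2)" by (simp add: z_def power_mult_distrib)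
    from m' show ?thesis
    proof
      assume "m = m' + m'"
      then have "\<beta> = (b powi m')\<^sup>2 \<or> \<beta> = - ((b powi m')\<^sup>2)" using m by (simp only: power_int_double ab_nonzero not_False_eq_True)
      then have "x\<^sup>2 = z\<^sup>2 \<or> x\<^sup>2 = - (z\<^sup>2)" unfolding x2 z2 using \<alpha>'(2) \<delta>'(2) by auto
      then have "x\<^sup>2 = z\<^sup>2" using real_square_neq_neg_square[OF xR zR z0] by blast
      then have "x = z \<or> x = - z" by (simp add: power2_eq_iff)
      then show ?thesis using zU x(2) by blast
    next
      \<comment> \<open>Now \<open>x / z\<close> is a root of \<open>b\<close> or of
        \<open>- b\<close>. Since \<open>m\<close> is odd and \<open>sB\<close> is 1,
        \<open>b\<close> has norm 1 and is not a square in \<open>L\<close>; \<open>- b\<close> is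
        negative.\<close>
      assume mo: "m = m' + m' + 1"
      then have "\<beta> = (b powi m')\<^sup>2 * b \<or> \<beta> = - ((b powi m')\<^sup>2 * b)" using m by (simp only: power_int_double_Suc ab_nonzero not_False_eq_True)
      then have "x\<^sup>2 = z\<^sup>2 * b \<or> x\<^sup>2 = - (z\<^sup>2 * b)" unfolding x2 z2 using \<alpha>'(2) \<delta>'(2) by auto
      then have xz: "(x / z)\<^sup>2 = b \<or> (x / z)\<^sup>2 = - b" using z0 by (simp add: power_divide field_simps)
      have "odd m" using mo by simp
      then have b1: "b * B.\<tau> b = 1" using sBm sAB True b_norm by (auto simp: power_int_minus_one_cases)
      have "(x / z)\<^sup>2 \<noteq> b" using b_not_square_in_L[OF b1] xL zL by simp
      moreover have "(x / z)\<^sup>2 \<noteq> - b"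
      proof
        assume h: "(x / z)\<^sup>2 = - b"
        obtain \<rho> where \<rho>: "x / z = of_real \<rho>" using Reals_divide[OF xR zR] by (elim Reals_cases)
        have "Re b = - (\<rho>\<^sup>2)" using arg_cong[OF h, of Re] unfolding \<rho> by (simp add: power2_eq_square)
        then show False using b_gt zero_le_power2[of \<rho>] by linarith
      qed
      ultimately show ?thesis using xz by blast
    qed
  next
    case False
    then have s1: "sA = -1" "sB = -1" using s sAB by auto
    then have "odd n" using sAn by (auto simp: power_int_minus_one_cases split: if_splits)
    moreover have b1: "b * B.\<tau> b = -1" using sBm s1(2) b_norm by auto
    then have "odd m" using sBm s1(2) by (auto simp: power_int_minus_one_cases split: if_splits)
    ultimately obtain n' m' where nm: "n = n' + n' + 1" "m = m' + m' + 1" by (metis oddE mult_2)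
    have w: "w = a * b" using b1 by (simp add: w_def)
    define A' B' where "A' = a powi n'" and "B' = b powi m'"
    have AB: "A' \<noteq> 0" "B' \<noteq> 0" "A' \<in> L" "B' \<in> L" by (simp_all add: A'_def B'_def)
    have "A' * \<sigma> A' = (a * \<sigma> a) powi n'" "B' * \<sigma> B' = (b * \<sigma> b) powi m'"
      by (simp_all add: A'_def B'_def power_int_mult_distrib)
    then have "A' * \<sigma> A' = 1 \<or> A' * \<sigma> A' = -1" "B' * \<sigma> B' = 1 \<or> B' * \<sigma> B' = -1"
      unfolding a_images b_images b1 by (auto simp: power_int_minus_one_cases)
    then have \<sigma>AB: "inverse (\<sigma> A') = A' \<or> inverse (\<sigma> A') = - A'"
        "inverse (\<sigma> B') = B' \<or> inverse (\<sigma> B') = - B'"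
      by (simp_all only: inverse_of_mult_unit)
    have "\<alpha> = A'\<^sup>2 * a \<or> \<alpha> = - (A'\<^sup>2 * a)" "\<beta> = B'\<^sup>2 * b \<or> \<beta> = - (B'\<^sup>2 * b)"
      using n m unfolding A'_def B'_def nm by (simp_all only: power_int_double_Suc ab_nonzero not_False_eq_True)
    then have ab: "\<alpha> * \<beta> = A'\<^sup>2 * B'\<^sup>2 * w \<or> \<alpha> * \<beta> = - (A'\<^sup>2 * B'\<^sup>2 * w)" by (auto simp: w)
    have "(\<alpha> * \<beta> * \<sigma> x)\<^sup>2 = (\<alpha> * \<beta>)\<^sup>2 * \<sigma> (x\<^sup>2)" using xL by (simp add: power_mult_distrib)
    also have "\<dots> = sA * sB * (\<alpha> * (\<beta> * \<delta>))"
      unfolding x2 sA_def sB_def using inL restrict_A(1)[OF F(1)] restrict_B(1)[OF F(2)] restrict_D(1)[OF F(3)]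
      by (simp add: power2_eq_square mult_ac)
    also have "\<dots> = x\<^sup>2" unfolding s1 x2 by simp
    finally have "\<alpha> * \<beta> * \<sigma> x = x \<or> \<alpha> * \<beta> * \<sigma> x = - x" by (simp add: power2_eq_iff)
    then have xe: "x = A'\<^sup>2 * B'\<^sup>2 * w * \<sigma> x \<or> x = - (A'\<^sup>2 * B'\<^sup>2 * w * \<sigma> x)" using ab by auto
    \<comment> \<open>A' and B' are inverted by \<open>\<sigma>\<close> up to sign, so dividing by
      them cancels the square (A' B')^2 in alpha beta and leaves 1/w.\<close>
    define y where "y = x * inverse A' * inverse B'"
    have yu: "y \<in> unit_group L"
      unfolding y_def A'_def B'_def using xu ab_unit_L
      by (intro L.unit_mult L.unit_inverse L.unit_power_int)
    define X where "X = \<sigma> x"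
    have "\<sigma> y = X * inverse (\<sigma> A') * inverse (\<sigma> B')" using xL AB by (simp add: y_def X_def)
    then have 1: "\<sigma> y = X * A' * B' \<or> \<sigma> y = - (X * A' * B')" using \<sigma>AB by (elim disjE) simp_all
    from xe[folded X_def] have 2: "y * inverse w = X * A' * B' \<or> y * inverse w = - (X * A' * B')"
    proof
      assume xX: "x = A'\<^sup>2 * B'\<^sup>2 * w * X"
      have "y * inverse w = X * A' * B'" unfolding y_def xX using AB by (simp add: power2_eq_square field_simps)
      then show ?thesis ..
    next
      assume xX: "x = - (A'\<^sup>2 * B'\<^sup>2 * w * X)"
      have "y * inverse w = - (X * A' * B')" unfolding y_def xX using AB by (simp add: power2_eq_square field_simps)
      then show ?thesis ..
    qed
    have "\<sigma> y = y * inverse w \<or> \<sigma> y = - (y * inverse w)" using 1 2 by (elim disjE) simp_all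
    then show ?thesis using yu by blast
  qed
qed

lemma \<sigma>_sqrt:
  assumes "y \<in> L" "\<eta> \<in> L" "y\<^sup>2 = of_int p1 * \<eta>" "\<sigma> \<eta> * w\<^sup>2 = \<eta>"
  shows "\<sigma> y = y * inverse w \<or> \<sigma> y = - (y * inverse w)"
proof -
  have "(\<sigma> y)\<^sup>2 = \<sigma> (y\<^sup>2)" using assms(1) by simp
  also have "\<dots> = of_int p1 * \<sigma> \<eta>" unfolding assms(3) using assms(2) by simp
  also have "\<sigma> \<eta> = \<eta> * inverse (w\<^sup>2)" using assms(4) by (simp add: field_simps)
  also have "of_int p1 * (\<eta> * inverse (w\<^sup>2)) = (y * inverse w)\<^sup>2"
    unfolding power_mult_distrib assms(3) by (simp add: power_inverse)
  finally show ?thesis by (simp add: power2_eq_iff)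
qed

text \<open>If \<open>b\<close> has norm 1, take a root of p1 b. Otherwise some positive divisor
  \<open>r0\<close> of \<open>d\<close> makes r0 a b c a square in \<open>L\<close>; index one
  prevents a b c itself from being a square, and the remaining square class is that of p1.\<close>

lemma index_1_sqrt:
  assumes q1: "unit_index_q 2 (p1 * p2) = 1"
  shows "\<exists>y\<in>L. \<exists>\<eta>\<in>unit_group L. y\<^sup>2 = of_int p1 * \<eta> \<and> (\<sigma> y = y * inverse w \<or> \<sigma> y = - (y * inverse w))"
proof (cases "b * B.\<tau> b = 1")
  case True
  obtain y where y: "y \<in> B.F" "y\<^sup>2 = of_int p1 * b" using p1_b_square[OF True] by blast
  have w: "w = b" using True by (simp add: w_def)
  have "\<sigma> b * w\<^sup>2 = b" using True by (simp add: w b_images power2_eq_square mult_ac)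
  moreover have "y \<in> L" using y(1) subsets_L(5) by blast
  ultimately show ?thesis using \<sigma>_sqrt[of y b] y(2) ab_unit_L(2) by auto
next
  case False
  then have b1: "b * B.\<tau> b = -1" using b_norm by simp
  then have w: "w = a * b" by (simp add: w_def)
  obtain c where c: "c \<in> unit_group D.F" "Re c > 1" "c * D.\<tau> c = -1" using D_norm_minus_one by blast
  have cF: "c \<in> D.F" "c \<noteq> 0" by (rule D.unitD[OF c(1)])+
  have cL [simp]: "c \<in> L" using cF(1) subsets_L(6) by blast
  have cu: "c \<in> unit_group L" by (rule D.unit_mono[OF sf_L subsets_L(6) c(1)])
  have i: "\<sigma> a = - inverse a" "\<sigma> b = - inverse b" "\<sigma> c = c" "\<tau>1 a = a" "\<tau>1 b = - inverse b" "\<tau>1 c = - inverse c"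
    using a_images(1,2) b1 c(3) restrict_D(1,2)[OF cF(1)] cF(2) ab_nonzero
    by (simp_all add: b_images field_simps minus_equation_iff)
  define \<eta> where "\<eta> = a * b * c"
  have \<eta>: "\<eta> \<in> unit_group L" unfolding \<eta>_def using ab_unit_L cu by (intro L.unit_mult)
  have \<eta>L: "\<eta> \<in> L" "\<eta> \<noteq> 0" by (rule L.unitD[OF \<eta>])+
  have \<sigma>\<eta>: "\<sigma> \<eta> * w\<^sup>2 = \<eta>" by (simp add: \<eta>_def w i power2_eq_square field_simps)
  obtain ra rb rc where re: "a = of_real ra" "b = of_real rb" "c = of_real rc"
    using ab_Reals D.F_Reals[OF cF(1)] by (auto elim!: Reals_cases)
  have pos: "ra > 1" "rb > 1" "rc > 1" using a_gt b_gt c(2) re by auto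
  \<comment> \<open>a Hilbert 90 sum: \<open>M / \<surd>(a b c)\<close> is a signed sum of the conjugates of \<open>\<surd>(a b c)\<close>, with signs
    chosen so that \<open>M\<^sup>2 / (a b c)\<close> is rational and \<open>M > 0\<close>\<close>
  define M where "M = a * b * c - a + b + c"
  have MinL: "M \<in> L" by (simp add: M_def)
  have Mre: "M = of_real (ra * (rb * rc - 1) + rb + rc)" by (simp add: M_def re algebra_simps)
  have "rb * rc > 1 * 1" using pos by (intro mult_strict_mono) auto
  then have mpos: "ra * (rb * rc - 1) + rb + rc > 0" using pos by (intro add_pos_pos mult_pos_pos) auto
  have MR: "M \<in> \<real>" unfolding Mre by simp
  have M0: "M \<noteq> 0" unfolding Mre using mpos by (simp only: of_real_eq_0_iff)
  \<comment> \<open>sigma multiplies M by 1/(a b) and a b c by its square; tau1 multiplies M by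
    -1/(b c) and a b c by its square. Hence M^2 / (a b c) is fixed by both.\<close>
  have \<sigma>M: "\<sigma> M = M * inverse (a * b)"
    by (simp add: M_def i) (simp add: field_simps)
  have \<tau>M: "\<tau>1 M = - (M * inverse (b * c))"
    by (simp add: M_def i) (use cF(2) in \<open>simp add: field_simps\<close>)
  define r where "r = M\<^sup>2 * inverse \<eta>"
  have rre: "r = of_real ((ra * (rb * rc - 1) + rb + rc)\<^sup>2 / (ra * rb * rc))"
    unfolding r_def Mre \<eta>_def re by (simp add: divide_inverse)
  have "r \<in> \<rat>"
  proof (rule rational_if_fixed)
    show "r \<in> L" using MinL \<eta>L by (simp add: r_def)
    show "r \<in> \<real>" unfolding rre by simp
    have "\<sigma> r = (M * inverse (a * b))\<^sup>2 * inverse (\<sigma> \<eta>)" using MinL \<eta>L by (simp add: r_def \<sigma>M del: inverse_mult_distrib)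
    also have "\<dots> = r" by (simp add: r_def \<eta>_def i power2_eq_square field_simps)
    finally show "\<sigma> r = r" .
    have "\<tau>1 r = (- (M * inverse (b * c)))\<^sup>2 * inverse (\<tau>1 \<eta>)" using MinL \<eta>L by (simp add: r_def \<tau>M del: inverse_mult_distrib)
    also have "\<dots> = r" using cF(2) by (simp add: r_def \<eta>_def i power2_eq_square field_simps)
    finally show "\<tau>1 r = r" .
  qed
  moreover have Mai: "algebraic_int M" unfolding M_def
    using L.unitD(3)[OF ab_unit_L(1)] L.unitD(3)[OF ab_unit_L(2)] L.unitD(3)[OF cu]
    by (intro algebraic_int_add algebraic_int_diff algebraic_int_mult)
  have "algebraic_int r" unfolding r_def power2_eq_square
    using Mai L.unitD(4)[OF \<eta>] by (intro algebraic_int_mult)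
  ultimately obtain \<rho> where \<rho>: "r = of_int \<rho>" using rational_algebraic_int_is_int by (auto elim: Ints_cases)
  have "real_of_int \<rho> = (ra * (rb * rc - 1) + rb + rc)\<^sup>2 / (ra * rb * rc)"
    using arg_cong[OF trans[OF \<rho>[symmetric] rre], of Re] by (simp only: Re_complex_of_real complex_Re_of_int)
  also have "\<dots> > 0" using mpos pos by (intro divide_pos_pos mult_pos_pos zero_less_power) auto
  finally have \<rho>0: "\<rho> > 0" by simp
  define r0 l where "r0 = squarefree_part \<rho>" and "l = square_part \<rho>"
  have r0l: "\<rho> = r0 * l\<^sup>2" unfolding r0_def l_def by (rule squarefree_decompose)
  have "r0 * l\<^sup>2 > 0" using \<rho>0 r0l by simp
  then have r0: "r0 > 0" "l \<noteq> 0" by (auto simp: zero_less_mult_iff)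
  have sf: "squarefree r0" by (simp add: r0_def)
  define N where "N = M / of_int l"
  have N: "N \<in> L" "N \<in> \<real>" using MinL MR by (simp_all add: N_def)
  have "M\<^sup>2 = of_int \<rho> * \<eta>" using \<rho> \<eta>L by (simp add: r_def field_simps)
  then have N2: "N\<^sup>2 = of_int r0 * \<eta>" using r0 by (simp add: N_def power_divide r0l)
  have "algebraic_int (N\<^sup>2)" unfolding N2 using L.unitD(3)[OF \<eta>] by (intro algebraic_int_mult) auto
  then have Nai: "algebraic_int N" by (rule algebraic_int_of_power) simp
  have "r0 dvd d"
    by (rule squarefree_dvd[OF sf]) (use D.m_gt_1 prime_dvd_d_of_square[OF N Nai N2 \<eta> sf] in auto)
  then have cases: "r0 \<in> {1, d, 2, q, p1, 2 * p2, p2, 2 * p1}" by (rule divisor_cases[OF _ r0(1)])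
  \<comment> \<open>By index one a root would be alpha beta delta with units of the quadratic
    subfields. Multiplying its square by the conjugate under \<open>\<tau>1\<close> leaves alpha^4 =
    a^2, so alpha^2 is \<open>a\<close> or \<open>- a\<close>, whose relative norm is -1, while that
    of a square of such a unit is 1.\<close>
  have nsq: "v\<^sup>2 \<noteq> \<eta>" if v: "v \<in> L" "v \<in> \<real>" for v
  proof
    assume v2: "v\<^sup>2 = \<eta>"
    then have "v \<in> unit_group L" using L.unit_of_power[OF v(1), of 2] \<eta> by simp
    then have "v \<in> unit_group Kp"
      using L.unit_sub[OF is_subfield_field_gen] real_L_Kp[OF v] by blast
    then have "v \<in> U" by (rule index_1[OF q1])
    then obtain \<alpha> \<beta> \<delta> where u: "\<alpha> \<in> unit_group A.F" "\<beta> \<in> unit_group B.F" "\<delta> \<in> unit_group D.F"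
      and vabd: "v = \<alpha> * (\<beta> * \<delta>)" by (elim U_E)
    have F: "\<alpha> \<in> A.F" "\<beta> \<in> B.F" "\<delta> \<in> D.F" using A.unitD(1)[OF u(1)] B.unitD(1)[OF u(2)] D.unitD(1)[OF u(3)] .
    have inL: "\<alpha> \<in> L" "\<beta> \<in> L" "\<delta> \<in> L" using F subsets_L(4-6) by blast+
    have nz: "\<alpha> \<noteq> 0" "\<beta> \<noteq> 0" "\<delta> \<noteq> 0" using A.unitD(2)[OF u(1)] B.unitD(2)[OF u(2)] D.unitD(2)[OF u(3)] .
    have "(\<beta> * \<tau>1 \<beta>)\<^sup>2 = 1" "(\<delta> * \<tau>1 \<delta>)\<^sup>2 = 1" "(\<alpha> * \<sigma> \<alpha>)\<^sup>2 = 1"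
      using B.norm_unit[OF u(2)] D.norm_unit[OF u(3)] A.norm_unit[OF u(1)]
        restrict_B(2)[OF F(2)] restrict_D(2)[OF F(3)] restrict_A(1)[OF F(1)] by auto
    then have sq: "\<beta>\<^sup>2 * (\<tau>1 \<beta>)\<^sup>2 = 1" "\<delta>\<^sup>2 * (\<tau>1 \<delta>)\<^sup>2 = 1" "\<alpha>\<^sup>2 * (\<sigma> \<alpha>)\<^sup>2 = 1"
      by (simp_all add: power_mult_distrib)
    have e: "\<alpha>\<^sup>2 * (\<beta>\<^sup>2 * \<delta>\<^sup>2) = a * b * c" using v2 by (simp add: vabd \<eta>_def power_mult_distrib)
    have "\<tau>1 (\<alpha>\<^sup>2 * (\<beta>\<^sup>2 * \<delta>\<^sup>2)) = \<tau>1 (a * b * c)" unfolding e ..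
    then have e': "\<alpha>\<^sup>2 * ((\<tau>1 \<beta>)\<^sup>2 * (\<tau>1 \<delta>)\<^sup>2) = a * (inverse b * inverse c)"
      using inL restrict_A(2)[OF F(1)] by (simp add: i)
    have "(\<alpha>\<^sup>2 * \<alpha>\<^sup>2) * ((\<beta>\<^sup>2 * (\<tau>1 \<beta>)\<^sup>2) * (\<delta>\<^sup>2 * (\<tau>1 \<delta>)\<^sup>2)) =
        (\<alpha>\<^sup>2 * (\<beta>\<^sup>2 * \<delta>\<^sup>2)) * (\<alpha>\<^sup>2 * ((\<tau>1 \<beta>)\<^sup>2 * (\<tau>1 \<delta>)\<^sup>2))" by (simp add: mult_ac)
    also have "\<dots> = a * a" unfolding e e' using cF(2) by (simp add: field_simps)
    finally have "\<alpha>\<^sup>2 * \<alpha>\<^sup>2 = a * a" by (simp add: sq)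
    then have aa: "\<alpha>\<^sup>2 = a \<or> \<alpha>\<^sup>2 = - a" by (simp only: square_eq_iff)
    then have "\<alpha>\<^sup>2 * \<sigma> (\<alpha>\<^sup>2) = a * \<sigma> a" by auto
    then have "\<alpha>\<^sup>2 * (\<sigma> \<alpha>)\<^sup>2 = -1" using inL by (simp add: a_images)
    then show False using sq(3) by simp
  qed
  have "\<exists>y\<in>L. y\<^sup>2 = of_int p1 * \<eta>"
  proof -
    have A2: "A.rt\<^sup>2 = 2" "B.rt\<^sup>2 = of_int q" "D.rt\<^sup>2 = of_int d"
      using rt_simps D.rt_square by (simp_all add: power2_eq_square)
    have pz: "(of_int p1 :: complex) \<noteq> 0" "(of_int p2 :: complex) \<noteq> 0" "(of_int q :: complex) \<noteq> 0" "(of_int d :: complex) \<noteq> 0"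
      using gt2 q_gt by (auto simp: d_def)
    \<comment> \<open>As 2, q and d are squares in \<open>L\<close>, the values 1, d, 2, q give a
      root of \<open>\<eta>\<close>, contrary to \<open>nsq\<close>; the other four give a root of
      p1 times \<open>\<eta>\<close>.\<close>
    from cases consider "r0 = 1" | "r0 = d" | "r0 = 2" | "r0 = q" | "r0 = p1" | "r0 = 2 * p2" | "r0 = p2" | "r0 = 2 * p1"
      by blast
    then show ?thesis
    proof cases
      case 1
      then show ?thesis using nsq[OF N] N2 by simp
    next
      case 2
      then have "(N / D.rt)\<^sup>2 = \<eta>" using N2 pz by (simp add: power_divide A2)
      then show ?thesis using nsq[of "N / D.rt"] N by simp
    next
      case 3
      then have "(N / A.rt)\<^sup>2 = \<eta>" using N2 pz by (simp add: power_divide A2)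
      then show ?thesis using nsq[of "N / A.rt"] N by simp
    next
      case 4
      then have "(N / B.rt)\<^sup>2 = \<eta>" using N2 pz by (simp add: power_divide A2)
      then show ?thesis using nsq[of "N / B.rt"] N by simp
    next
      case 5
      then show ?thesis using N N2 by blast
    next
      case 6
      have "(N * B.rt / (of_int p2 * A.rt))\<^sup>2 = of_int p1 * \<eta>"
        unfolding power_divide power_mult_distrib N2 A2 6 using pz by (simp add: q_def power2_eq_square)
      then show ?thesis using N by (intro bexI[of _ "N * B.rt / (of_int p2 * A.rt)"]) simp_all
    next
      case 7
      have "(N * B.rt / of_int p2)\<^sup>2 = of_int p1 * \<eta>"
        unfolding power_divide power_mult_distrib N2 A2 7 using pz by (simp add: q_def power2_eq_square)
      then show ?thesis using N by (intro bexI[of _ "N * B.rt / of_int p2"]) simp_all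
    next
      case 8
      have "(N / A.rt)\<^sup>2 = of_int p1 * \<eta>"
        unfolding power_divide N2 A2 8 by simp
      then show ?thesis using N by (intro bexI[of _ "N / A.rt"]) simp_all
    qed
  qed
  then obtain y where y: "y \<in> L" "y\<^sup>2 = of_int p1 * \<eta>" by blast
  then show ?thesis using \<sigma>_sqrt[OF y(1) \<eta>L(1) y(2) \<sigma>\<eta>] \<eta> by blast
qed

end

section \<open>Classes with principal square, and square classes in \<open>k\<close>\<close>

context complex_ring
begin

lemma ideal_mult_interchange:
  assumes "is_ideal R I" "is_ideal R J" "is_ideal R K" "is_ideal R M"
  shows "ideal_mult R (ideal_mult R I J) (ideal_mult R K M) = ideal_mult R (ideal_mult R I K) (ideal_mult R J M)"
proof -
  have "ideal_mult R (ideal_mult R I J) (ideal_mult R K M) = ideal_mult R I (ideal_mult R J (ideal_mult R K M))"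
    by (rule ideal_mult_assoc) (use assms in \<open>auto intro: is_ideal_mult\<close>)
  also have "ideal_mult R J (ideal_mult R K M) = ideal_mult R (ideal_mult R J K) M"
    using ideal_mult_assoc[OF assms(2-4)] by simp
  also have "ideal_mult R J K = ideal_mult R K J" by (rule ideal_mult_commute)
  also have "ideal_mult R (ideal_mult R K J) M = ideal_mult R K (ideal_mult R J M)"
    by (rule ideal_mult_assoc[OF assms(3,2,4)])
  also have "ideal_mult R I (ideal_mult R K (ideal_mult R J M)) = ideal_mult R (ideal_mult R I K) (ideal_mult R J M)"
    using ideal_mult_assoc[OF assms(1,3) is_ideal_mult[OF assms(2,4)]] by simp
  finally show ?thesis .
qed

lemma principal_ideal_mult:
  assumes "x \<in> R" "y \<in> R"
  shows "ideal_mult R (principal_ideal R x) (principal_ideal R y) = principal_ideal R (x * y)"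
  unfolding ideal_mult_principal[OF is_ideal_principal[OF assms(2)] assms(1)]
  unfolding principal_ideal_def scale_scale ..

lemma ideal_mult_square_principal:
  assumes "is_ideal R I" "is_ideal R J" "x \<in> R" "y \<in> R"
    "ideal_mult R I I = principal_ideal R x" "ideal_mult R J J = principal_ideal R y"
  shows "ideal_mult R (ideal_mult R I J) (ideal_mult R I J) = principal_ideal R (x * y)"
  unfolding ideal_mult_interchange[OF assms(1,2,1,2)] assms(5,6) by (rule principal_ideal_mult[OF assms(3,4)])

lemma ideal_pow_square_principal:
  assumes "is_ideal R I" "x \<in> R" "ideal_mult R I I = principal_ideal R x"
  shows "ideal_mult R (ideal_pow R I n) (ideal_pow R I n) = principal_ideal R (x ^ n)"
proof (induction n)
  case 0
  show ?case using ideal_mult_ring[OF is_ideal_ring] by (simp add: principal_ideal_one)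
next
  case (Suc n)
  have "x ^ n \<in> R" using assms(2) by (induction n) auto
  then show ?case
    using ideal_mult_square_principal[OF assms(1) is_ideal_pow[OF assms(1)] assms(2) _ assms(3) Suc] by simp
qed

text \<open>The class of \<open>Y\<close> is its own inverse, so multiplying by \<open>Y\<close>
  again undoes the multiplication without inverse ideals.\<close>

lemma ideal_equiv_of_square:
  assumes I: "is_ideal R I" and Y: "is_ideal R Y" "ideal_mult R Y Y = principal_ideal R c" "c \<in> R" "c \<noteq> 0"
    and IY: "ideal_equiv R (ideal_mult R I Y) R"
  shows "ideal_equiv R I Y"
proof -
  have YY: "ideal_equiv R (ideal_mult R Y Y) R" using Y ideal_equiv_principal by simp
  have YY': "is_ideal R (ideal_mult R Y Y)" using Y by (intro is_ideal_mult)
  have "ideal_equiv R (ideal_mult R (ideal_mult R Y Y) I) (ideal_mult R R I)"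
    by (rule ideal_equiv_mult_right[OF YY' is_ideal_ring I YY])
  then have "ideal_equiv R (ideal_mult R I (ideal_mult R Y Y)) I"
    by (simp add: ideal_mult_ring[OF I] ideal_mult_commute[of I])
  moreover have "ideal_equiv R (ideal_mult R (ideal_mult R I Y) Y) (ideal_mult R R Y)"
    by (rule ideal_equiv_mult_right[OF is_ideal_mult[OF I Y(1)] is_ideal_ring Y(1) IY])
  then have "ideal_equiv R (ideal_mult R I (ideal_mult R Y Y)) Y"
    by (simp add: ideal_mult_ring[OF Y(1)] ideal_mult_assoc[OF I Y(1) Y(1)])
  ultimately show ?thesis using ideal_equiv_sym ideal_equiv_trans by blast
qed

end

context capitulation
begin

text \<open>According to the sign of the real unit, \<open>z\<close> or i z is real, and a real
  element of \<open>k\<close> lies in \<open>D.F\<close>.\<close>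

lemma k_square_times_unit:
  assumes z: "z \<in> k" "z\<^sup>2 = of_int r * \<epsilon>" and \<epsilon>: "\<epsilon> \<in> unit_group D.F" and r: "squarefree r" "r > 0"
  shows "r = 1 \<or> r = d"
proof -
  obtain e where e: "\<epsilon> = of_real e" using D.F_Reals[OF D.unitD(1)[OF \<epsilon>]] by (elim Reals_cases)
  show ?thesis
  proof (cases "e \<ge> 0")
    case True
    have "z \<in> \<real>" by (rule Reals_of_square_pos[of z "of_int r * e"]) (use True r z(2) e in simp_all)
    then have "z \<in> D.F" by (rule D.Fi_Reals[OF z(1)])
    then show ?thesis using D_square_times_unit'[OF _ \<epsilon> z(2) r] by simp
  next
    case False
    have eq: "(\<i> * z)\<^sup>2 = of_int r * (- \<epsilon>)" using z(2) by (simp add: power_mult_distrib)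
    have "\<i> * z \<in> \<real>" by (rule Reals_of_square_pos[of "\<i> * z" "of_int r * (- e)"]) (use False r eq e in \<open>simp_all add: mult_nonneg_nonpos\<close>)
    moreover have "\<i> * z \<in> k" using z(1) gens_sub(2) by (rule D.Fi.mult[rotated])
    ultimately have "\<i> * z \<in> D.F" using D.Fi_Reals by blast
    then show ?thesis using D_square_times_unit'[OF _ D.unit_uminus[OF \<epsilon>] eq r] by simp
  qed
qed

text \<open>The obstruction to principality. For odd \<open>m\<close>, multiplication by the complex
  conjugate makes 2 a square in \<open>k\<close>, against \<open>A_notin_k\<close>. For odd
  \<open>n\<close>, either p1 or 2 p1 times a real unit would be a square in
  \<open>k\<close>.\<close>

lemma square_class_k:
  assumes x: "x \<in> k" and \<eta>: "\<eta> \<in> unit_group k" and eq: "x\<^sup>2 = (1 + \<i>) ^ m * of_int p1 ^ n * \<eta>"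
  shows "even m \<and> even n"
proof -
  obtain l \<epsilon> where l: "\<epsilon> \<in> unit_group D.F" "\<eta> = \<i> ^ l * \<epsilon>" using unit_k[OF \<eta>] by blast
  have \<epsilon>0: "\<epsilon> \<noteq> 0" and \<epsilon>F: "\<epsilon> \<in> D.F" by (rule D.unitD[OF l(1)])+
  have \<epsilon>k: "\<epsilon> \<in> k" using D.F_subset_Fi \<epsilon>F by blast
  have p0: "(of_int p1 :: complex) \<noteq> 0" using gt2 by simp
  have ik: "\<i> \<in> k" by (rule gens_sub)
  have i1: "1 + \<i> \<noteq> 0" by (simp add: complex_eq_iff)
  have even_m: "even m"
  proof (rule ccontr)
    assume "odd m"
    then obtain m' where m': "m = 2 * m' + 1" by (elim oddE)
    have "cnj \<epsilon> = \<epsilon>" using D.F_Reals[OF \<epsilon>F] by (simp add: Reals_cnj_iff)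
    then have "\<eta> * cnj \<eta> = (\<i> ^ l * (- \<i>) ^ l) * \<epsilon>\<^sup>2"
      by (simp add: l(2) power2_eq_square)
    also have "\<i> ^ l * (- \<i>) ^ l = 1" by (simp flip: power_mult_distrib)
    finally have \<eta>\<eta>: "\<eta> * cnj \<eta> = \<epsilon>\<^sup>2" by simp
    have "(1 + \<i>) * cnj (1 + \<i>) = 2" by (simp add: algebra_simps)
    have "(x * cnj x)\<^sup>2 = x\<^sup>2 * cnj (x\<^sup>2)" by (simp add: power_mult_distrib)
    also have "\<dots> = ((1 + \<i>) * cnj (1 + \<i>)) ^ m * (of_int p1 ^ n)\<^sup>2 * (\<eta> * cnj \<eta>)"
      unfolding eq by (simp add: power_mult_distrib power2_eq_square mult_ac)
    also have "\<dots> = 2 * (2 ^ m' * of_int p1 ^ n * \<epsilon>)\<^sup>2"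
      unfolding \<open>(1 + \<i>) * cnj (1 + \<i>) = 2\<close> \<eta>\<eta> m'
      by (simp add: power_mult_distrib power_add power_mult power2_eq_square mult_ac)
    finally have e: "(x * cnj x)\<^sup>2 = 2 * (2 ^ m' * of_int p1 ^ n * \<epsilon>)\<^sup>2" .
    define t where "t = x * cnj x / (2 ^ m' * of_int p1 ^ n * \<epsilon>)"
    have tk: "t \<in> k" using x D.cnj_Fi[OF x] \<epsilon>k by (simp add: t_def)
    have "t * t = A.rt * A.rt"
      using e \<epsilon>0 p0 by (simp add: t_def power2_eq_square rt_simps field_simps)
    then have "t = A.rt \<or> t = - A.rt" by (simp only: square_eq_iff)
    then have "A.rt \<in> k" using tk D.Fi.uminus_iff[of A.rt] by metis
    then show False using A_notin_k by contradiction
  qed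
  then obtain m' where m': "m = 2 * m'" by (elim evenE)
  have "even n"
  proof (rule ccontr)
    assume "odd n"
    then obtain n' where n': "n = 2 * n' + 1" by (elim oddE)
    define z where "z = x / ((1 + \<i>) ^ m' * of_int p1 ^ n')"
    have zk: "z \<in> k" using x ik by (simp add: z_def)
    have z2: "z\<^sup>2 = of_int p1 * \<eta>"
      unfolding z_def power_divide eq m' n' using i1 p0
      by (simp add: power_mult_distrib power_mult power_add power2_eq_square field_simps)
    have sp1: "squarefree p1" using prime by (auto intro: squarefree_prime_elem prime_imp_prime_elem)
    have s2p1: "squarefree (2 * p1)"
      by (rule squarefree_mult_coprime[OF coprime(2) A.squarefree_m sp1])
    have nd: "p1 \<noteq> 1" "p1 \<noteq> d" "2 * p1 \<noteq> 1" "2 * p1 \<noteq> d"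
      using gt2 by (auto simp: d_def q_def)
    have i4: "\<i> ^ l \<in> {1, -1, \<i>, - \<i>}"
      by (induction l) auto
    \<comment> \<open>Since (1 + i)^2 = 2 i, a leftover factor i in \<open>\<eta>\<close> is
      absorbed by replacing p1 with 2 p1.\<close>
    have half: "((1 + \<i>) * z)\<^sup>2 = of_int (2 * p1) * (\<i> * \<eta>)"
    proof -
      have "((1 + \<i>) * z)\<^sup>2 = (1 + \<i>)\<^sup>2 * z\<^sup>2" by (rule power_mult_distrib)
      also have "(1 + \<i>)\<^sup>2 = 2 * \<i>" by (simp add: power2_eq_square algebra_simps)
      finally show ?thesis unfolding z2 by simp
    qed
    have hk: "(1 + \<i>) * z \<in> k" using zk ik by simp
    have p1pos: "p1 > 0" "2 * p1 > 0" using gt2 by simp_all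
    have "False" if "\<eta> = \<epsilon> \<or> \<eta> = - \<epsilon>"
      using that k_square_times_unit[OF zk _ l(1) sp1 p1pos(1)]
        k_square_times_unit[OF zk _ D.unit_uminus[OF l(1)] sp1 p1pos(1)] z2 nd by metis
    moreover have "False" if "\<i> * \<eta> = \<epsilon> \<or> \<i> * \<eta> = - \<epsilon>"
      using that k_square_times_unit[OF hk _ l(1) s2p1 p1pos(2)]
        k_square_times_unit[OF hk _ D.unit_uminus[OF l(1)] s2p1 p1pos(2)] half nd by metis
    moreover have "\<eta> = \<epsilon> \<or> \<eta> = - \<epsilon> \<or> \<i> * \<eta> = \<epsilon> \<or> \<i> * \<eta> = - \<epsilon>"
      unfolding l(2) using i4 by (auto simp flip: mult.assoc)
    ultimately show False by blast
  qed
  with even_m show ?thesis by blast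
qed

end

section \<open>Generators of ideals that become principal in \<open>L\<close>\<close>

context capitulation_units
begin

text \<open>Rests on (1 + zeta)^2 = (1 + i)(1 + sqrt 2). Having norm -1, the unit 1 + sqrt 2 is an
  odd power of \<open>a\<close> up to sign; dividing 1 + zeta by A' removes the even part, so the
  conjugate quotient becomes exactly 1/(i a) up to sign.\<close>

lemma H0_generator:
  "\<exists>\<alpha>\<in>L. \<exists>\<eta>\<in>unit_group L. \<alpha>\<^sup>2 = (1 + \<i>) * \<eta> \<and>
     (\<sigma> \<alpha> = \<alpha> * inverse (\<i> * a) \<or> \<sigma> \<alpha> = - (\<alpha> * inverse (\<i> * a)))"
proof -
  define v where "v = 1 + A.rt"
  have v: "v \<in> unit_group A.F" "v * A.\<tau> v = -1" "v = 1 + A.rt"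
    unfolding v_def by (rule A_unit_norm_minus_one)+ simp
  have v0: "v \<noteq> 0" by (rule A.unitD[OF v(1)])
  obtain n :: int where n: "v = a powi n \<or> v = - (a powi n)" using a_gen[OF v(1)] by blast
  have "odd n" using norm_a_power[OF n] v(2) by (auto simp: power_int_minus_one_cases split: if_splits)
  then obtain n' where n': "n = n' + n' + 1" by (metis oddE mult_2)
  define A' where "A' = a powi n'"
  have A': "A' \<noteq> 0" "A' \<in> L" by (simp_all add: A'_def)
  have vA: "v = A'\<^sup>2 * a \<or> v = - (A'\<^sup>2 * a)"
    using n unfolding A'_def n' by (simp only: power_int_double_Suc ab_nonzero not_False_eq_True)
  have "A' * \<sigma> A' = (a * \<sigma> a) powi n'" by (simp add: A'_def power_int_mult_distrib)
  then have "A' * \<sigma> A' = 1 \<or> A' * \<sigma> A' = -1"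
    unfolding a_images by (auto simp: power_int_minus_one_cases)
  then have \<sigma>A': "inverse (\<sigma> A') = A' \<or> inverse (\<sigma> A') = - A'"
    by (rule inverse_of_mult_unit)
  define \<alpha> where "\<alpha> = (1 + \<zeta>) * inverse A'"
  have sq: "(1 + \<zeta>)\<^sup>2 = (1 + \<i>) * v"
  proof -
    have "(1 + \<zeta>)\<^sup>2 = 1 + \<i> + 2 * \<zeta>" using \<zeta>_square by (simp add: power2_eq_square algebra_simps)
    also have "\<dots> = \<zeta> * A.rt + (A.rt * A.rt) * \<zeta>" unfolding one_plus_i rt_simps ..
    finally show ?thesis unfolding one_plus_i v(3) by (simp add: algebra_simps)
  qed
  have i1: "1 + \<i> \<noteq> 0" by (simp add: complex_eq_iff)
  have z1: "1 + \<zeta> \<noteq> 0" using sq v0 i1 by auto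
  have "v \<in> unit_group L" by (rule A.unit_mono[OF sf_L subsets_L(4) v(1)])
  moreover have "A' \<in> unit_group L" unfolding A'_def by (intro L.unit_power_int ab_unit_L)
  ultimately have \<eta>: "v * (inverse A')\<^sup>2 \<in> unit_group L"
    by (intro L.unit_mult L.unit_power L.unit_inverse)
  have \<alpha>2: "\<alpha>\<^sup>2 = (1 + \<i>) * (v * (inverse A')\<^sup>2)" unfolding \<alpha>_def power_mult_distrib sq by simp
  have \<sigma>1: "1 - \<zeta> = (1 + \<zeta>) * (- \<i> * inverse v)"
  proof -
    have "(1 - \<zeta>) * (1 + \<zeta>) = 1 - \<i>" using \<zeta>_square by (simp add: power2_eq_square algebra_simps)
    also have "\<dots> = (1 + \<i>) * (- \<i>)" by (simp add: algebra_simps)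
    also have "\<dots> = (1 + \<zeta>)\<^sup>2 * (- \<i> * inverse v)" unfolding sq using v0 by simp
    finally have "(1 + \<zeta>) * (1 - \<zeta>) = (1 + \<zeta>) * ((1 + \<zeta>) * (- \<i> * inverse v))"
      by (simp add: power2_eq_square mult_ac)
    then show ?thesis using z1 by (simp only: mult_cancel_left) simp
  qed
  have "\<sigma> \<alpha> = (1 - \<zeta>) * inverse (\<sigma> A')" using A' by (simp add: \<alpha>_def)
  also have "\<dots> = (1 + \<zeta>) * (- \<i> * inverse v) * inverse (\<sigma> A')" unfolding \<sigma>1 ..
  finally have "\<sigma> \<alpha> = (1 + \<zeta>) * (- \<i> * inverse v) * A' \<or> \<sigma> \<alpha> = - ((1 + \<zeta>) * (- \<i> * inverse v) * A')"
    using \<sigma>A' by auto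
  moreover have "(1 + \<zeta>) * (- \<i> * inverse v) * A' = \<alpha> * inverse (\<i> * a) \<or>
      (1 + \<zeta>) * (- \<i> * inverse v) * A' = - (\<alpha> * inverse (\<i> * a))"
    using vA A' by (auto simp: \<alpha>_def power2_eq_square field_simps)
  ultimately have "\<sigma> \<alpha> = \<alpha> * inverse (\<i> * a) \<or> \<sigma> \<alpha> = - (\<alpha> * inverse (\<i> * a))" by (metis minus_minus)
  moreover have "\<alpha> \<in> L" using A' by (simp add: \<alpha>_def)
  ultimately show ?thesis using \<alpha>2 \<eta> by blast
qed

text \<open>The extended ideal is generated by elements of \<open>k\<close>, hence stable under
  \<open>\<sigma>\<close>, so alpha divides its conjugate. Applying the involution again shows that
  the quotient is a unit of relative norm one.\<close>

lemma generator_conjugate: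
  assumes I: "nonzero_ideal \<sigma>.R I" "ideal_gen \<sigma>.S I = principal_ideal \<sigma>.S \<alpha>" "\<alpha> \<in> \<sigma>.S"
  shows "\<alpha> \<noteq> 0" "\<exists>u\<in>unit_group L. \<sigma> \<alpha> = \<alpha> * u \<and> u * \<sigma> u = 1"
proof -
  have Ii: "is_ideal \<sigma>.R I" using I(1) by (simp add: nonzero_ideal_def)
  then have IR: "I \<subseteq> \<sigma>.R" by (simp add: is_ideal_def)
  then have IS: "I \<subseteq> \<sigma>.S" using \<sigma>.R_subset_S by blast
  have E: "is_ideal \<sigma>.S (ideal_gen \<sigma>.S I)" by (rule L.O.is_ideal_gen[OF IS])
  show \<alpha>0: "\<alpha> \<noteq> 0"
  proof
    assume "\<alpha> = 0"
    then have "I \<subseteq> {0}" using L.O.ideal_gen_superset[of I] I(2) by (auto simp: principal_ideal_def)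
    then show False using I(1) Ii by (auto simp: nonzero_ideal_def is_ideal_def)
  qed
  have "is_ideal \<sigma>.S {x \<in> \<sigma>.S. \<sigma> x \<in> ideal_gen \<sigma>.S I}"
    using E \<sigma>.integer_hom by (auto simp: is_ideal_def L.mem_ring_of_integers algebraic_int_add algebraic_int_mult)
  moreover have "\<sigma> x = x" if "x \<in> I" for x
    using that IR \<sigma>.fixed_iff[of x] subsets_L(1) by (auto simp: ring_of_integers_def)
  then have "I \<subseteq> {x \<in> \<sigma>.S. \<sigma> x \<in> ideal_gen \<sigma>.S I}" using IS L.O.ideal_gen_superset[of I] by auto
  ultimately have "ideal_gen \<sigma>.S I \<subseteq> {x \<in> \<sigma>.S. \<sigma> x \<in> ideal_gen \<sigma>.S I}"
    by (simp add: L.O.ideal_gen_subset_iff)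
  moreover have "\<alpha> \<in> ideal_gen \<sigma>.S I" unfolding I(2) by (rule L.O.principal_ideal_self)
  ultimately have "\<sigma> \<alpha> \<in> principal_ideal \<sigma>.S \<alpha>" using I(2) by blast
  then obtain u where u: "u \<in> \<sigma>.S" "\<sigma> \<alpha> = \<alpha> * u" by (auto simp: principal_ideal_def)
  have \<alpha>L: "\<alpha> \<in> L" and uL: "u \<in> L" using I(3) u by (simp_all add: L.mem_ring_of_integers)
  have "\<alpha> * 1 = \<sigma> (\<sigma> \<alpha>)" using \<sigma>.involution[OF \<alpha>L] by simp
  also have "\<dots> = \<alpha> * (u * \<sigma> u)" unfolding u(2) using \<alpha>L uL u(2) by (simp add: mult.assoc)
  finally have uu: "u * \<sigma> u = 1" using \<alpha>0 by (simp only: mult_cancel_left) simp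
  then have "u \<in> unit_group L" using u(1) \<sigma>.integer_hom[OF u(1)] by (auto simp: units_of_ring_def)
  with u(2) uu show "\<exists>u\<in>unit_group L. \<sigma> \<alpha> = \<alpha> * u \<and> u * \<sigma> u = 1" by blast
qed

end

lemma power_int_split:
  fixes z :: complex
  assumes "z \<noteq> 0"
  obtains n :: nat and l :: int where "n < 2" "z powi s = z ^ n * (z\<^sup>2) powi l"
proof
  show "nat (s mod 2) < 2" by simp
  have "z powi s = z powi (s mod 2 + 2 * (s div 2))" by simp
  also have "\<dots> = z powi (s mod 2) * z powi (2 * (s div 2))" using assms by (subst power_int_add) auto
  also have "z powi (s mod 2) = z ^ nat (s mod 2)" by (simp add: power_int_def)
  also have "z powi (2 * (s div 2)) = (z\<^sup>2) powi (s div 2)" by (subst power_int_mult) simp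
  finally show "z powi s = z ^ nat (s mod 2) * (z\<^sup>2) powi (s div 2)" .
qed

section \<open>The capitulation kernel and the distinctness of its classes\<close>

context capitulation_units
begin

abbreviation "\<O>k \<equiv> ring_of_integers k"
abbreviation "\<O>L \<equiv> ring_of_integers L"

lemma one_plus_i_nonzero: "1 + \<i> \<noteq> 0"
  by (simp add: complex_eq_iff)

lemma one_plus_i_R: "1 + \<i> \<in> \<O>k"
  using gens_sub(2) D.Fi.mem_ring_of_integers algebraic_int_add[of 1 \<i>] by simp

lemma ideal_gen_pow:
  assumes "is_ideal \<O>k H" "ideal_gen \<O>L H = principal_ideal \<O>L y"
  shows "ideal_gen \<O>L (ideal_pow \<O>k H n) = principal_ideal \<O>L (y ^ n)"
proof (induction n)
  case 0
  have "1 \<in> ideal_gen \<O>L \<O>k" using L.O.ideal_gen_superset[of \<O>k] by auto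
  moreover have "is_ideal \<O>L (ideal_gen \<O>L \<O>k)" by (rule L.O.is_ideal_gen[OF \<sigma>.R_subset_S])
  ultimately have "ideal_gen \<O>L \<O>k = \<O>L" by (force simp: is_ideal_def)
  then show ?case by (simp add: L.O.principal_ideal_one)
next
  case (Suc n)
  show ?case
    unfolding ideal_pow.simps power_Suc
    by (rule L.O.ideal_gen_ideal_mult[OF D.Fi.O.complex_ring_axioms \<sigma>.R_subset_S assms(1)
          D.Fi.O.is_ideal_pow[OF assms(1)] assms(2) Suc])
qed

text \<open>For \<open>I\<O>\<^sub>L = \<alpha>\<O>\<^sub>L\<close> the unit \<open>\<sigma>\<alpha>/\<alpha>\<close> has relative norm one, hence is known up to
  sign by \<open>relative_norm_one_unit\<close>; multiplying \<open>\<alpha>\<close> by powers of the generators \<open>\<alpha>0\<close>, \<open>y\<close>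
  of the extended ideals (and by \<open>\<zeta>\<close> to fix the sign) gives an element of \<open>k\<close>.\<close>
lemma capitulation_kernel_eq:
  assumes H0: "is_ideal \<O>k H0" "ideal_mult \<O>k H0 H0 = principal_ideal \<O>k (1 + \<i>)"
    and J: "is_ideal \<O>k J" "ideal_mult \<O>k J J = principal_ideal \<O>k c" "c \<in> \<O>k" "c \<noteq> 0"
    and y: "y \<in> L" "\<eta> \<in> unit_group L" "y\<^sup>2 = c * \<eta>" "\<sigma> y = y * inverse w \<or> \<sigma> y = - (y * inverse w)"
  shows "capitulation_kernel k L =
      (\<lambda>(s, t). ideal_class \<O>k (ideal_mult \<O>k (ideal_pow \<O>k H0 s) (ideal_pow \<O>k J t))) ` ({..<2} \<times> {..<2})"
    and "capitulation_kernel k L =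
      {ideal_class \<O>k (ideal_mult \<O>k (ideal_pow \<O>k H0 s) (ideal_pow \<O>k J t)) | s t. True}"
proof -
  define Y where "Y s t = ideal_mult \<O>k (ideal_pow \<O>k H0 s) (ideal_pow \<O>k J t)" for s t
  obtain \<alpha>0 \<eta>0 where \<alpha>0: "\<alpha>0 \<in> L" "\<eta>0 \<in> unit_group L" "\<alpha>0\<^sup>2 = (1 + \<i>) * \<eta>0"
    "\<sigma> \<alpha>0 = \<alpha>0 * inverse (\<i> * a) \<or> \<sigma> \<alpha>0 = - (\<alpha>0 * inverse (\<i> * a))"
    using H0_generator by blast
  have ck: "c \<in> k" "1 + \<i> \<in> k" using J(3) one_plus_i_R by (simp_all add: ring_of_integers_def)
  have nz: "\<alpha>0 \<noteq> 0" "y \<noteq> 0"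
    using \<alpha>0(3) y(3) J(4) one_plus_i_nonzero L.unitD(2)[OF \<alpha>0(2)] L.unitD(2)[OF y(2)] by auto
  have gH0: "ideal_gen \<O>L H0 = principal_ideal \<O>L \<alpha>0"
    by (rule \<sigma>.ideal_gen_sqrt[OF H0 one_plus_i_nonzero one_plus_i_R \<alpha>0(1)])
      (use \<alpha>0 one_plus_i_nonzero in simp)
  have gJ: "ideal_gen \<O>L J = principal_ideal \<O>L y"
    by (rule \<sigma>.ideal_gen_sqrt[OF J(1,2,4,3) y(1)]) (use y J(4) in simp)
  have Yi: "is_ideal \<O>k (Y s t)" for s t
    unfolding Y_def by (intro D.Fi.O.is_ideal_mult D.Fi.O.is_ideal_pow H0 J)
  have gY: "ideal_gen \<O>L (Y s t) = principal_ideal \<O>L (\<alpha>0 ^ s * y ^ t)" for s t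
    unfolding Y_def
    by (rule L.O.ideal_gen_ideal_mult[OF D.Fi.O.complex_ring_axioms \<sigma>.R_subset_S
          D.Fi.O.is_ideal_pow[OF H0(1)] D.Fi.O.is_ideal_pow[OF J(1)]
          ideal_gen_pow[OF H0(1) gH0] ideal_gen_pow[OF J(1) gJ]])
  have cR: "(1 + \<i>) ^ s \<in> \<O>k" "c ^ t \<in> \<O>k" for s t
    by (induction s; use one_plus_i_R in simp) (induction t; use J(3) in simp)
  have YY: "ideal_mult \<O>k (Y s t) (Y s t) = principal_ideal \<O>k ((1 + \<i>) ^ s * c ^ t)" for s t
    unfolding Y_def
    by (rule D.Fi.O.ideal_mult_square_principal[OF D.Fi.O.is_ideal_pow[OF H0(1)] D.Fi.O.is_ideal_pow[OF J(1)] cR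
          D.Fi.O.ideal_pow_square_principal[OF H0(1) one_plus_i_R H0(2)]
          D.Fi.O.ideal_pow_square_principal[OF J(1,3,2)]])
  have cnz: "(1 + \<i>) ^ s * c ^ t \<noteq> 0" and cRR: "(1 + \<i>) ^ s * c ^ t \<in> \<O>k" for s t
    using one_plus_i_nonzero J(4) cR by simp_all
  have Ynz: "nonzero_ideal \<O>k (Y s t)" for s t
  proof -
    have "Y s t \<noteq> {0}"
    proof
      assume "Y s t = {0}"
      then have "ideal_gen \<O>L (Y s t) \<subseteq> {0}"
        by (subst L.O.ideal_gen_subset_iff) (auto simp: is_ideal_def)
      then have "\<alpha>0 ^ s * y ^ t = 0" unfolding gY using L.O.principal_ideal_self by blast
      then show False using nz by simp
    qed
    then show ?thesis using Yi by (simp add: nonzero_ideal_def)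
  qed
  have Ysub: "ideal_class \<O>k (Y s t) \<in> capitulation_kernel k L" for s t
  proof -
    have E: "is_ideal \<O>L (ideal_gen \<O>L (Y s t))"
      by (rule L.O.is_ideal_gen[OF subset_trans[OF D.Fi.O.ideal_subset[OF Yi] \<sigma>.R_subset_S]])
    then have "\<alpha>0 ^ s * y ^ t \<in> \<O>L"
      using gY L.O.principal_ideal_self[of "\<alpha>0 ^ s * y ^ t"] by (auto simp: is_ideal_def)
    then have "is_principal \<O>L (ideal_gen \<O>L (Y s t))" unfolding is_principal_def gY by blast
    then show ?thesis unfolding capitulation_kernel_def using Ynz by blast
  qed
  have sup: "\<exists>s t. s < 2 \<and> t < 2 \<and> C = ideal_class \<O>k (Y s t)" if C: "C \<in> capitulation_kernel k L" for C
  proof -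
    obtain I where I: "C = ideal_class \<O>k I" "nonzero_ideal \<O>k I" "is_principal \<O>L (ideal_gen \<O>L I)"
      using C unfolding capitulation_kernel_def by blast
    then obtain \<alpha> where \<alpha>: "\<alpha> \<in> \<O>L" "ideal_gen \<O>L I = principal_ideal \<O>L \<alpha>"
      unfolding is_principal_def by blast
    note gc = generator_conjugate[OF I(2) \<alpha>(2,1)]
    obtain u where u: "u \<in> unit_group L" "\<sigma> \<alpha> = \<alpha> * u" "u * \<sigma> u = 1" using gc(2) by blast
    obtain s t :: int where st: "u = (\<i> * a) powi s * w powi t \<or> u = - ((\<i> * a) powi s * w powi t)"
      using relative_norm_one_unit[OF u(1,3)] by blast
    have \<alpha>L: "\<alpha> \<in> L" using \<alpha>(1) by (simp add: L.mem_ring_of_integers)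
    define \<beta> where "\<beta> = \<alpha> * \<alpha>0 powi s * y powi t"
    have \<beta>L: "\<beta> \<in> L" using \<alpha>L \<alpha>0(1) y(1) by (simp add: \<beta>_def)
    have pm: "z powi n = x powi n \<or> z powi n = - (x powi n)" if "z = x \<or> z = - x" for z x :: complex and n :: int
      using that by (auto simp: power_int_minus_left)
    have pinv: "(x * inverse z) powi n = x powi n * inverse (z powi n)" for x z :: complex and n :: int
      by (simp only: power_int_mult_distrib power_int_inverse)
    have "\<sigma> \<beta> = (\<alpha> * u) * (\<sigma> \<alpha>0) powi s * (\<sigma> y) powi t"
      using \<alpha>L \<alpha>0(1) y(1) by (simp add: \<beta>_def u(2))
    moreover have "(\<sigma> \<alpha>0) powi s = \<alpha>0 powi s * inverse ((\<i> * a) powi s) \<or> (\<sigma> \<alpha>0) powi s = - (\<alpha>0 powi s * inverse ((\<i> * a) powi s))"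
      using pm[OF \<alpha>0(4), of s] unfolding pinv .
    moreover have "(\<sigma> y) powi t = y powi t * inverse (w powi t) \<or> (\<sigma> y) powi t = - (y powi t * inverse (w powi t))"
      using pm[OF y(4), of t] unfolding pinv .
    ultimately have "\<sigma> \<beta> = (\<alpha> * u) * (\<alpha>0 powi s * inverse ((\<i> * a) powi s)) * (y powi t * inverse (w powi t)) \<or>
        \<sigma> \<beta> = - ((\<alpha> * u) * (\<alpha>0 powi s * inverse ((\<i> * a) powi s)) * (y powi t * inverse (w powi t)))"
      by auto
    moreover have "(\<alpha> * u) * (\<alpha>0 powi s * inverse ((\<i> * a) powi s)) * (y powi t * inverse (w powi t)) = \<beta> \<or>
        (\<alpha> * u) * (\<alpha>0 powi s * inverse ((\<i> * a) powi s)) * (y powi t * inverse (w powi t)) = - \<beta>"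
    proof -
      define P Q where "P = (\<i> * a) powi s" and "Q = w powi t"
      have PQ: "P \<noteq> 0" "Q \<noteq> 0" by (simp_all add: P_def Q_def)
      from st[folded P_def Q_def] show ?thesis
        unfolding \<beta>_def P_def[symmetric] Q_def[symmetric] using PQ by (elim disjE) (simp_all add: field_simps)
    qed
    ultimately have "\<sigma> \<beta> = \<beta> \<or> \<sigma> \<beta> = - \<beta>" by auto
    \<comment> \<open>A remaining sign is repaired by the unit \<open>\<zeta>\<close>, which
      \<open>\<sigma>\<close> negates.\<close>
    then have "\<exists>e\<in>unit_group L. \<sigma> (\<beta> * e) = \<beta> * e"
    proof
      assume "\<sigma> \<beta> = - \<beta>"
      then have "\<sigma> (\<beta> * \<zeta>) = \<beta> * \<zeta>" using \<beta>L by simp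
      then show ?thesis using \<zeta>_unit by blast
    qed (use L.unit_one in force)
    then obtain e where e: "e \<in> unit_group L" "\<sigma> (\<beta> * e) = \<beta> * e" by blast
    have "\<beta> * e \<in> k" using e \<sigma>.fixed_iff[of "\<beta> * e"] \<beta>L L.unitD(1)[OF e(1)] by simp
    \<comment> \<open>Only parities of the exponents matter: the squares of \<open>\<alpha>0\<close>
      and \<open>y\<close> are elements of \<open>k\<close> times units of \<open>L\<close>.\<close>
    obtain s0 :: nat and s1 :: int where s0: "s0 < 2" "\<alpha>0 powi s = \<alpha>0 ^ s0 * (\<alpha>0\<^sup>2) powi s1"
      using power_int_split[OF nz(1)] by blast
    obtain t0 :: nat and t1 :: int where t0: "t0 < 2" "y powi t = y ^ t0 * (y\<^sup>2) powi t1"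
      using power_int_split[OF nz(2)] by blast
    define v where "v = \<eta>0 powi s1 * \<eta> powi t1 * e"
    have v: "v \<in> unit_group L" unfolding v_def using \<alpha>0(2) y(2) e(1) by (intro L.unit_mult L.unit_power_int)
    define f where "f = (1 + \<i>) powi s1 * c powi t1"
    have f: "f \<in> k" "f \<noteq> 0" using ck one_plus_i_nonzero J(4) by (simp_all add: f_def)
    have \<beta>e: "\<beta> * e = (\<alpha> * (\<alpha>0 ^ s0 * y ^ t0)) * v * f"
      unfolding \<beta>_def s0(2) t0(2) \<alpha>0(3) y(3) v_def f_def by (simp add: power_int_mult_distrib mult_ac)
    \<comment> \<open>Dropping the factor \<open>f\<close> keeps the element in \<open>k\<close>,
      and what remains is a generator of the extension of I Y times a unit; descent then
      applies.\<close>
    define \<gamma> where "\<gamma> = (\<alpha> * (\<alpha>0 ^ s0 * y ^ t0)) * v"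
    have "\<gamma> = \<beta> * e / f" using f by (simp add: \<beta>e \<gamma>_def)
    then have \<gamma>k: "\<gamma> \<in> k" using \<open>\<beta> * e \<in> k\<close> f by simp
    have \<gamma>0: "\<gamma> \<noteq> 0" using gc(1) nz L.unitD(2)[OF v] by (simp add: \<gamma>_def)
    have Ii: "is_ideal \<O>k I" using I(2) by (simp add: nonzero_ideal_def)
    have "ideal_gen \<O>L (ideal_mult \<O>k I (Y s0 t0)) = principal_ideal \<O>L (\<alpha> * (\<alpha>0 ^ s0 * y ^ t0))"
      by (rule L.O.ideal_gen_ideal_mult[OF D.Fi.O.complex_ring_axioms \<sigma>.R_subset_S Ii Yi \<alpha>(2) gY])
    also have "\<dots> = principal_ideal \<O>L \<gamma>" unfolding \<gamma>_def L.principal_ideal_unit[OF v] ..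
    finally have "ideal_mult \<O>k I (Y s0 t0) = principal_ideal \<O>k \<gamma>"
      by (rule \<sigma>.ideal_gen_principal_descend[OF D.Fi.O.is_ideal_mult[OF Ii Yi] _ \<gamma>k \<gamma>0])
    moreover have "\<gamma> \<in> \<O>k"
      using calculation D.Fi.O.is_ideal_mult[OF Ii Yi, of s0 t0] D.Fi.O.principal_ideal_self[of \<gamma>]
      by (auto simp: is_ideal_def)
    ultimately have "ideal_equiv \<O>k (ideal_mult \<O>k I (Y s0 t0)) \<O>k"
      using D.Fi.O.ideal_equiv_principal \<gamma>0 by simp
    then have "ideal_equiv \<O>k I (Y s0 t0)"
      by (rule D.Fi.O.ideal_equiv_of_square[OF Ii Yi YY cRR cnz])
    then have "C = ideal_class \<O>k (Y s0 t0)"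
      unfolding I(1) using D.Fi.O.ideal_class_eq_iff[OF I(2) Ynz] by simp
    then show ?thesis using s0(1) t0(1) by blast
  qed
  show "capitulation_kernel k L =
      (\<lambda>(s, t). ideal_class \<O>k (ideal_mult \<O>k (ideal_pow \<O>k H0 s) (ideal_pow \<O>k J t))) ` ({..<2} \<times> {..<2})"
    unfolding Y_def[symmetric]
  proof
    show "capitulation_kernel k L \<subseteq> (\<lambda>(s, t). ideal_class \<O>k (Y s t)) ` ({..<2} \<times> {..<2})"
      using sup by (fastforce simp: image_iff)
  qed (use Ysub in auto)
  show "capitulation_kernel k L =
      {ideal_class \<O>k (ideal_mult \<O>k (ideal_pow \<O>k H0 s) (ideal_pow \<O>k J t)) | s t. True}"
    unfolding Y_def[symmetric] using sup Ysub by blast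
qed

text \<open>If two of the ideals were equivalent, their product would be principal up to a scalar of
  \<open>k\<close>. Squaring turns this into (1 + i)^(s + s') p1^(t + t') times a unit being a
  square in \<open>k\<close>, so \<open>square_class_k\<close> gives equal parities.\<close>

lemma inj_on_classes:
  assumes H0: "is_ideal \<O>k H0" "ideal_mult \<O>k H0 H0 = principal_ideal \<O>k (1 + \<i>)"
    and J: "is_ideal \<O>k J" "ideal_mult \<O>k J J = principal_ideal \<O>k (of_int p1)"
    and nz: "nonzero_ideal \<O>k H0" "nonzero_ideal \<O>k J"
  shows "inj_on (\<lambda>(s, t). ideal_class \<O>k (ideal_mult \<O>k (ideal_pow \<O>k H0 s) (ideal_pow \<O>k J t))) ({..<2} \<times> {..<2})"
proof (rule inj_onI)
  define Y where "Y s t = ideal_mult \<O>k (ideal_pow \<O>k H0 s) (ideal_pow \<O>k J t)" for s t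
  have Ynz: "nonzero_ideal \<O>k (Y s t)" for s t
    unfolding Y_def by (intro D.Fi.O.nonzero_ideal_mult D.Fi.O.nonzero_ideal_pow nz)
  have Yi: "is_ideal \<O>k (Y s t)" for s t using Ynz by (simp add: nonzero_ideal_def)
  have p1R: "(of_int p1 :: complex) \<in> \<O>k" by (simp add: D.Fi.mem_ring_of_integers)
  have cR: "(1 + \<i>) ^ s \<in> \<O>k" "of_int p1 ^ t \<in> \<O>k" for s t
    by (induction s; use one_plus_i_R in simp) (induction t; use p1R in simp)
  have YY: "ideal_mult \<O>k (Y s t) (Y s t) = principal_ideal \<O>k ((1 + \<i>) ^ s * of_int p1 ^ t)" for s t
    unfolding Y_def
    by (rule D.Fi.O.ideal_mult_square_principal[OF D.Fi.O.is_ideal_pow[OF H0(1)] D.Fi.O.is_ideal_pow[OF J(1)] cR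
          D.Fi.O.ideal_pow_square_principal[OF H0(1) one_plus_i_R H0(2)]
          D.Fi.O.ideal_pow_square_principal[OF J(1) p1R J(2)]])
  fix st st' assume in2: "st \<in> {..<2} \<times> {..<(2::nat)}" "st' \<in> {..<2} \<times> {..<(2::nat)}"
    and eq: "(case st of (s, t) \<Rightarrow> ideal_class \<O>k (ideal_mult \<O>k (ideal_pow \<O>k H0 s) (ideal_pow \<O>k J t))) =
      (case st' of (s, t) \<Rightarrow> ideal_class \<O>k (ideal_mult \<O>k (ideal_pow \<O>k H0 s) (ideal_pow \<O>k J t)))"
  obtain s t s' t' where st: "st = (s, t)" "st' = (s', t')" by (metis surj_pair)
  have lt: "s < 2" "t < 2" "s' < 2" "t' < 2" using in2 st by auto
  have "ideal_equiv \<O>k (Y s t) (Y s' t')"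
    using eq D.Fi.O.ideal_class_eq_iff[OF Ynz Ynz] by (simp add: st Y_def)
  then have "ideal_equiv \<O>k (ideal_mult \<O>k (Y s t) (Y s' t')) (ideal_mult \<O>k (Y s' t') (Y s' t'))"
    by (rule D.Fi.O.ideal_equiv_mult_right[OF Yi Yi Yi])
  then obtain x z where xz: "x \<in> \<O>k" "z \<in> \<O>k" "x \<noteq> 0" "z \<noteq> 0"
    "(\<lambda>r. x * r) ` ideal_mult \<O>k (Y s t) (Y s' t') = (\<lambda>r. z * r) ` ideal_mult \<O>k (Y s' t') (Y s' t')"
    unfolding ideal_equiv_def by blast
  define c c' where "c = (1 + \<i>) ^ s * of_int p1 ^ t" and "c' = (1 + \<i>) ^ s' * of_int p1 ^ t'"
  have cc: "c \<in> \<O>k" "c' \<in> \<O>k" "c \<noteq> 0" "c' \<noteq> 0"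
    using cR gt2 one_plus_i_nonzero by (simp_all add: c_def c'_def)
  define Z where "Z = ideal_mult \<O>k (Y s t) (Y s' t')"
  have Zi: "is_ideal \<O>k Z" unfolding Z_def by (rule D.Fi.O.is_ideal_mult[OF Yi Yi])
  have ZZ: "ideal_mult \<O>k Z Z = principal_ideal \<O>k (c * c')"
    unfolding Z_def c_def c'_def
    by (rule D.Fi.O.ideal_mult_square_principal[OF Yi Yi _ _ YY YY]) (use cR in simp_all)
  have xZ: "(\<lambda>r. x * r) ` Z = principal_ideal \<O>k (z * c')"
    using xz(5) unfolding Z_def YY c'_def[symmetric] principal_ideal_def D.Fi.O.scale_scale .
  have zc: "z * c' \<in> \<O>k" using xz(2) cc by simp
  have "(\<lambda>r. x * r) ` (\<lambda>r. x * r) ` principal_ideal \<O>k (c * c') = ideal_mult \<O>k ((\<lambda>r. x * r) ` Z) ((\<lambda>r. x * r) ` Z)"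
    unfolding D.Fi.O.ideal_mult_scale[OF Zi D.Fi.O.is_ideal_scale[OF xz(1) Zi] xz(1)]
      D.Fi.O.ideal_mult_commute[of Z "(\<lambda>r. x * r) ` Z"] D.Fi.O.ideal_mult_scale[OF Zi Zi xz(1)] ZZ ..
  also have "\<dots> = principal_ideal \<O>k ((z * c') * (z * c'))"
    unfolding xZ by (rule D.Fi.O.principal_ideal_mult[OF zc zc])
  finally have "principal_ideal \<O>k ((z * c') * (z * c')) = principal_ideal \<O>k (x * x * (c * c'))"
    unfolding principal_ideal_def D.Fi.O.scale_scale by (simp add: mult_ac)
  then have "(z * c') * (z * c') / (x * x * (c * c')) \<in> unit_group k"
    by (rule D.Fi.principal_ideal_eq) (use xz cc in simp)
  moreover define g where "g = (z * c') * (z * c') / (x * x * (c * c'))"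
  ultimately have g: "g \<in> unit_group k" by simp
  have "(z * c' / x)\<^sup>2 = (c * c') * g"
    using xz cc by (simp add: g_def power2_eq_square)
  also have "\<dots> = (1 + \<i>) ^ (s + s') * of_int p1 ^ (t + t') * g"
    by (simp add: c_def c'_def power_add mult_ac)
  finally have "even (s + s') \<and> even (t + t')"
    by (rule square_class_k[rotated 2]) (use g xz cc in \<open>simp_all add: ring_of_integers_def\<close>)
  then have "s = s' \<and> t = t'" using lt by presburger
  then show "st = st'" by (simp add: st)
qed

end

theorem theorem44:
  fixes p1 p2 e f g h :: int and H0 H1 H2 :: "complex set"
  defines "k \<equiv> field_gen {complex_of_real (sqrt (real_of_int (2 * p1 * p2))), \<i>}"
  defines "K3 \<equiv> field_gen {complex_of_real (sqrt 2),
                           complex_of_real (sqrt (real_of_int (p1 * p2))), \<i>}"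
  defines "\<pi>1 \<equiv> of_int e + 2 * \<i> * of_int f"
  defines "\<pi>2 \<equiv> of_int e - 2 * \<i> * of_int f"
  assumes "prime p1" and "prime p2" and "p1 \<noteq> p2"
    and "p1 mod 4 = 1" and "p2 mod 4 = 1"
    and "(Legendre p1 p2 = -1 \<and> Legendre 2 p1 = -1) \<or>
         (Legendre p1 p2 = -1 \<and> Legendre 2 p2 = -1) \<or>
         (Legendre 2 p1 = -1 \<and> Legendre 2 p2 = -1)"
    and "p1 = e\<^sup>2 + 4 * f\<^sup>2" and "p2 = g\<^sup>2 + 4 * h\<^sup>2"
    and "prime_ideal (ring_of_integers k) H0"
    and "ideal_mult (ring_of_integers k) H0 H0 = principal_ideal (ring_of_integers k) (1 + \<i>)"
    and "prime_ideal (ring_of_integers k) H1"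
    and "ideal_mult (ring_of_integers k) H1 H1 = principal_ideal (ring_of_integers k) \<pi>1"
    and "prime_ideal (ring_of_integers k) H2"
    and "ideal_mult (ring_of_integers k) H2 H2 = principal_ideal (ring_of_integers k) \<pi>2"
  shows "(unit_index_q 2 (p1 * p2) = 1 \<longrightarrow>
            card (capitulation_kernel k K3) = 4 \<and>
            capitulation_kernel k K3 =
              {ideal_class (ring_of_integers k)
                 (ideal_mult (ring_of_integers k)
                    (ideal_pow (ring_of_integers k) H0 a)
                    (ideal_pow (ring_of_integers k)
                       (ideal_mult (ring_of_integers k) H1 H2) b)) | a b. True})
       \<and> (unit_index_q 2 (p1 * p2) = 2 \<longrightarrow>
            capitulation_kernel k K3 =
              {ideal_class (ring_of_integers k) (ideal_pow (ring_of_integers k) H0 a) | a. True})"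
proof -
  interpret C: capitulation p1 p2
    by (rule capitulation.intro) (fact assms)+
  obtain a where a: "a \<in> unit_group C.A.F" "Re a > 1"
    "\<And>u. u \<in> unit_group C.A.F \<Longrightarrow> \<exists>n::int. u = a powi n \<or> u = - (a powi n)"
    using C.A.fundamental_unit by blast
  obtain b where b: "b \<in> unit_group C.B.F" "Re b > 1"
    "\<And>u. u \<in> unit_group C.B.F \<Longrightarrow> \<exists>n::int. u = b powi n \<or> u = - (b powi n)"
    using C.B.fundamental_unit by blast
  have aF: "a \<in> C.A.F" by (rule C.A.unitD[OF a(1)])
  \<comment> \<open>With norm 1, every unit would have norm 1, but 1 + sqrt 2 does not.\<close>
  have a_norm: "a * C.A.\<tau> a = -1"
  proof (rule ccontr)
    assume "a * C.A.\<tau> a \<noteq> -1"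
    then have a1: "a * C.A.\<tau> a = 1" using C.A.norm_unit[OF a(1)] by blast
    obtain n :: int where n: "1 + C.A.rt = a powi n \<or> 1 + C.A.rt = - (a powi n)"
      using a(3)[OF C.A_unit_norm_minus_one(1)] by blast
    have "a powi n * C.A.\<tau> (a powi n) = (a * C.A.\<tau> a) powi n"
      using aF by (simp add: power_int_mult_distrib)
    then have "a powi n * C.A.\<tau> (a powi n) = 1" unfolding a1 by simp
    moreover have "- (a powi n) * C.A.\<tau> (- (a powi n)) = a powi n * C.A.\<tau> (a powi n)"
      using aF by simp
    ultimately have "(1 + C.A.rt) * C.A.\<tau> (1 + C.A.rt) = 1" using n by metis
    then show False unfolding C.A_unit_norm_minus_one(2) by simp
  qed
  interpret U: capitulation_units p1 p2 a b
    by unfold_locales (use a b a_norm in auto)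
  have k: "k = C.k" unfolding k_def C.d_def C.q_def csqrt_int_def by (simp add: mult.assoc)
  have K3: "K3 = C.L" unfolding K3_def C.q_def csqrt_int_def by simp
  have id: "is_ideal U.\<O>k H0" "is_ideal U.\<O>k H1" "is_ideal U.\<O>k H2"
    using assms by (simp_all add: prime_ideal_def k)
  have sq0: "ideal_mult U.\<O>k H0 H0 = principal_ideal U.\<O>k (1 + \<i>)" using assms by (simp add: k)
  have ii: "\<i> \<in> U.\<O>k" using C.gens_sub(2) by (simp add: C.D.Fi.mem_ring_of_integers)
  have R_of_int: "of_int z \<in> U.\<O>k" for z by (simp add: C.D.Fi.mem_ring_of_integers)
  have \<pi>R: "\<pi>1 \<in> U.\<O>k" "\<pi>2 \<in> U.\<O>k"
  proof -
    have "\<pi>1 = of_int e + of_int (2 * f) * \<i>" "\<pi>2 = of_int e + of_int (- 2 * f) * \<i>"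
      by (simp_all add: \<pi>1_def \<pi>2_def)
    then show "\<pi>1 \<in> U.\<O>k" "\<pi>2 \<in> U.\<O>k"
      using C.D.Fi.O.ring_add[OF R_of_int C.D.Fi.O.ring_mult[OF R_of_int ii]] by metis+
  qed
  have \<pi>\<pi>: "\<pi>1 * \<pi>2 = of_int p1"
    unfolding \<pi>1_def \<pi>2_def \<open>p1 = e\<^sup>2 + 4 * f\<^sup>2\<close> by (simp add: algebra_simps power2_eq_square)
  define J where "J = ideal_mult U.\<O>k H1 H2"
  have Ji: "is_ideal U.\<O>k J" unfolding J_def by (rule C.D.Fi.O.is_ideal_mult[OF id(2,3)])
  have sqJ: "ideal_mult U.\<O>k J J = principal_ideal U.\<O>k (of_int p1)"
    unfolding J_def \<pi>\<pi>[symmetric]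
    by (rule C.D.Fi.O.ideal_mult_square_principal[OF id(2,3) \<pi>R]) (use assms in \<open>simp_all add: k\<close>)
  have p1R: "(of_int p1 :: complex) \<in> U.\<O>k" "(of_int p1 :: complex) \<noteq> 0"
    using C.gt2 R_of_int by simp_all
  have nonzero: "nonzero_ideal U.\<O>k H"
    if "is_ideal U.\<O>k H" "ideal_mult U.\<O>k H H = principal_ideal U.\<O>k c" "c \<noteq> 0" for H c
  proof -
    have "H \<noteq> {0}"
    proof
      assume "H = {0}"
      then have "ideal_mult U.\<O>k H H \<subseteq> {0}"
        by (subst C.D.Fi.O.ideal_mult_subset_iff) (auto simp: is_ideal_def)
      then show False using that(2,3) C.D.Fi.O.principal_ideal_self[of c] by auto
    qed
    then show ?thesis using that(1) by (simp add: nonzero_ideal_def)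
  qed
  have 1: "card (capitulation_kernel C.k C.L) = 4 \<and>
      capitulation_kernel C.k C.L = {ideal_class U.\<O>k (ideal_mult U.\<O>k (ideal_pow U.\<O>k H0 a) (ideal_pow U.\<O>k J b)) | a b. True}"
    if q1: "unit_index_q 2 (p1 * p2) = 1"
  proof -
    obtain y \<eta> where y: "y \<in> C.L" "\<eta> \<in> unit_group C.L" "y\<^sup>2 = of_int p1 * \<eta>"
      "C.\<sigma> y = y * inverse U.w \<or> C.\<sigma> y = - (y * inverse U.w)" using U.index_1_sqrt[OF q1] by blast
    note ker = U.capitulation_kernel_eq[OF id(1) sq0 Ji sqJ p1R y]
    have "card (capitulation_kernel C.k C.L) = card ({..<2::nat} \<times> {..<2::nat})"
      unfolding ker(1)
      by (rule card_image[OF U.inj_on_classes[OF id(1) sq0 Ji sqJ nonzero[OF id(1) sq0 U.one_plus_i_nonzero]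
              nonzero[OF Ji sqJ p1R(2)]]])
    then show ?thesis using ker(2) by simp
  qed
  have 2: "capitulation_kernel C.k C.L = {ideal_class U.\<O>k (ideal_pow U.\<O>k H0 a) | a. True}"
    if q2: "unit_index_q 2 (p1 * p2) = 2"
  proof -
    obtain y where y: "y \<in> unit_group C.L" "C.\<sigma> y = y * inverse U.w \<or> C.\<sigma> y = - (y * inverse U.w)"
      using U.index_2_unit[OF q2] by blast
    \<comment> \<open>For index two the kernel lemma is applied with the unit ideal in place of H1
      H2: c = 1 and the unit \<open>y\<close> serves as generator, so \<open>w\<close> contributes
      no new class.\<close>
    have Ri: "is_ideal U.\<O>k U.\<O>k" by (rule C.D.Fi.O.is_ideal_ring)
    have sqR: "ideal_mult U.\<O>k U.\<O>k U.\<O>k = principal_ideal U.\<O>k 1"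
      unfolding C.D.Fi.O.ideal_mult_ring[OF Ri] C.D.Fi.O.principal_ideal_one ..
    have "ideal_pow U.\<O>k U.\<O>k t = U.\<O>k" for t
      by (induction t) (simp_all add: C.D.Fi.O.ideal_mult_ring[OF Ri])
    then have "ideal_mult U.\<O>k (ideal_pow U.\<O>k H0 s) (ideal_pow U.\<O>k U.\<O>k t) = ideal_pow U.\<O>k H0 s" for s t
      using C.D.Fi.O.ideal_mult_ring[OF C.D.Fi.O.is_ideal_pow[OF id(1)]]
      by (simp add: C.D.Fi.O.ideal_mult_commute[of _ U.\<O>k])
    moreover have "capitulation_kernel C.k C.L =
        {ideal_class U.\<O>k (ideal_mult U.\<O>k (ideal_pow U.\<O>k H0 s) (ideal_pow U.\<O>k U.\<O>k t)) | s t. True}"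
      by (rule U.capitulation_kernel_eq(2)[OF id(1) sq0 Ri sqR _ _ C.L.unitD(1)[OF y(1)] C.L.unit_power[OF y(1), of 2] _ y(2)])
        simp_all
    ultimately show ?thesis by simp
  qed
  show ?thesis using 1 2 unfolding k K3 J_def by blast
qed

end
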